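(* Fix $\theta\in(-\frac{\pi}{2},\frac{\pi}{2})$. The operator $\mathcal{L}_\theta$ is a densely defined closed linear operator on $L^2(\gamma)$ and is a normal diffusion operator, namely: 1) $\mathcal{L}_\theta$ is a normal operator on $\mathcal{D}(\mathcal{L}_\theta)$; 2) $1\in\mathcal{D}(\mathcal{L}_\theta)$ and $\mathcal{L}_\theta1=0$; 3) there exists a linear subspace $\mathcal{D}\subset\{\phi\in\mathcal{D}(\mathcal{L}_\theta)\cap L^4(\gamma):\mathcal{L}_\theta\phi\in L^4(\gamma),\ |\phi|^2\in\mathcal{D}(\mathcal{L}_\theta)\}$ such that the graph of $\mathcal{L}_\theta|_{\mathcal{D}}$ is dense in the graph of $\mathcal{L}_\theta$; 4) defining, for $\phi,\psi\in\mathcal{D}$, $$\Gamma(\phi,\psi)=\frac{1}{2\cos\theta}\big[\mathcal{L}_\theta(\phi\bar\psi)-\phi\,\mathcal{L}_\theta(\bar\psi)-\bar\psi\,\mathcal{L}_\theta(\phi)\big],$$ $\Gamma:\mathcal{D}\times\mathcal{D}\to L^2(\gamma)$ is a non-negative definite bilinear form over the field $\mathbb{C}$; 5) (diffusion property) if $\vec\phi=(\phi_1,\dots,\phi_n)\in\mathcal{D}^n$ and $F\in C^2_{\uparrow}(\mathbb{C}^n)$, then $F\circ\vec\phi\in\mathcal{D}(\mathcal{L}_\theta)$ and $$\mathcal{L}_\theta(F\circ\vec\phi)=\cos\theta\sum_{i,j=1}^n\Big[\Gamma(\phi_i,\bar\phi_j)\frac{\partial^2F}{\partial z_i\partial z_j}\circ\vec\phi+\Gamma(\bar\phi_i,\phi_j)\frac{\partial^2F}{\partial\bar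 z_i\partial\bar z_j}\circ\vec\phi+2\Gamma(\phi_i,\phi_j)\frac{\partial^2F}{\partial z_i\partial\bar z_j}\circ\vec\phi\Big]+\sum_{i=1}^n\Big[\mathcal{L}_\theta\phi_i\,\frac{\partial F}{\partial z_i}\circ\vec\phi+\mathcal{L}_\theta\bar\phi_i\,\frac{\partial F}{\partial\bar z_i}\circ\vec\phi\Big];$$ 6) $\mathcal{L}_\theta$ has an extension $\mathcal{A}_1$ to $L^1(\gamma)$, with domain $\mathcal{D}(\mathcal{A}_1)$, such that $\mathcal{D}(\mathcal{L}_\theta)=\{\phi\in\mathcal{D}(\mathcal{A}_1)\cap L^2(\gamma):\mathcal{A}_1\phi\in L^2(\gamma)\}$, i.e., the closure of $\mathcal{L}_\theta$ in $L^1(\gamma)$ is $\mathcal{A}_1$.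
   Context: Write $z=x+\mathrm{i}y$ and identify $\mathbb{C}$ with $\mathbb{R}^2$ (and $\mathbb{C}^n$ with $\mathbb{R}^{2n}$). Let $d\gamma=\frac{1}{2\pi}e^{-(x^2+y^2)/2}\,dx\,dy$, $L^p(\gamma)$ the complex $L^p$ spaces, and $\langle f,g\rangle=\int f\bar g\,d\gamma$. Wirtinger derivatives: $\frac{\partial}{\partial z}=\frac12(\partial_x-\mathrm{i}\partial_y)$, $\frac{\partial}{\partial\bar z}=\frac12(\partial_x+\mathrm{i}\partial_y)$ (similarly in each variable $z_i$ of $\mathbb{C}^n$). For $m,n\in\mathbb{N}$ the complex Hermite polynomials are $$J_{m,n}(z)=(m!\,n!\,2^{m+n})^{-1/2}\sum_{r=0}^{m\wedge n}(-1)^r r!\,2^r\binom{m}{r}\binom{n}{r}z^{m-r}\bar z^{n-r},$$ an orthonormal basis of $L^2(\gamma)$. $\mathcal{L}_\theta$ has domain $\mathcal{D}(\mathcal{L}_\theta)=\{f\in L^2(\gamma):\sum_{m,n\ge0}(m^2+n^2+2mn\cos2\theta)|\langle f,J_{m,n}\rangle|^2<\infty\}$ and $\mathcal{L}_\theta f=-\sum_{m,n\ge0}[(m+n)\cos\theta+\mathrm{i}(m-n)\sin\theta]\langle f,J_{m,n}\rangle J_{m,n}$ (on smooth functions it coincides with $4\cos\theta\,\partial_z\partial_{\bar z}-e^{\mathrm{i}\theta}z\partial_z-e^{-\mathrm{i}\theta}\bar z\partial_{\bar z}$). A continuous function is slowly increasing if it is bounded by a constant times $(1+|x|^2)^{k/2}$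 for some integer $k$; $C^m_{\uparrow}$ denotes functions whose partial derivatives of order $\le m$ exist, are continuous and slowly increasing. A closed densely defined operator $N$ is normal if $D(N)=D(N^* )$ and $NN^*=N^*N$. "Non-negative definite" means $\Gamma(\phi,\phi)\ge0$ a.e. *)

theory Defs
  imports "HOL-Analysis.Analysis"
begin

definition gauss :: "complex measure" where
  "gauss = density lborel (\<lambda>z. ennreal (exp (- (cmod z)\<^sup>2 / 2) / (2 * pi)))"

definition ae_eq :: "(complex \<Rightarrow> complex) \<Rightarrow> (complex \<Rightarrow> complex) \<Rightarrow> bool" where
  "ae_eq f g \<longleftrightarrow> (AE z in gauss. f z = g z)"

definition Lp :: "nat \<Rightarrow> (complex \<Rightarrow> complex) \<Rightarrow> bool" where
  "Lp p f \<longleftrightarrow> f \<in> borel_measurable gauss \<and> integrable gauss (\<lambda>z. (cmod (f z)) ^ p)"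

definition Lpnorm :: "nat \<Rightarrow> (complex \<Rightarrow> complex) \<Rightarrow> real" where
  "Lpnorm p f = (\<integral>z. (cmod (f z)) ^ p \<partial>gauss) powr (1 / real p)"

definition inner_g :: "(complex \<Rightarrow> complex) \<Rightarrow> (complex \<Rightarrow> complex) \<Rightarrow> complex" where
  "inner_g f g = (\<integral>z. f z * cnj (g z) \<partial>gauss)"

definition J :: "nat \<Rightarrow> nat \<Rightarrow> complex \<Rightarrow> complex" where
  "J m n z = complex_of_real (1 / sqrt (real (fact m * fact n * 2 ^ (m + n)))) *
     (\<Sum>r = 0..min m n. complex_of_real ((-1) ^ r * fact r * 2 ^ r * real (m choose r) * real (n choose r))
        * z ^ (m - r) * (cnj z) ^ (n - r))"

definition eig :: "real \<Rightarrow> nat \<Rightarrow> nat \<Rightarrow> complex" where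
  "eig \<theta> m n = complex_of_real (real (m + n) * cos \<theta>) + \<i> * complex_of_real ((real m - real n) * sin \<theta>)"

definition domL :: "real \<Rightarrow> (complex \<Rightarrow> complex) set" where
  "domL \<theta> = {f. Lp 2 f \<and>
     (\<lambda>(m, n). (real m ^ 2 + real n ^ 2 + 2 * real m * real n * cos (2 * \<theta>)) * (cmod (inner_g f (J m n)))\<^sup>2)
        summable_on (UNIV :: (nat \<times> nat) set)}"

text \<open>g represents L_theta f: the series defining L_theta f converges (unconditionally) to g in L^2.\<close>
definition Lrel :: "real \<Rightarrow> (complex \<Rightarrow> complex) \<Rightarrow> (complex \<Rightarrow> complex) \<Rightarrow> bool" where
  "Lrel \<theta> f g \<longleftrightarrow> f \<in> domL \<theta> \<and> Lp 2 g \<and>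
     (\<forall>e>0. \<exists>F0. finite F0 \<and> (\<forall>F. finite F \<and> F0 \<subseteq> F \<longrightarrow>
        Lpnorm 2 (\<lambda>z. g z + (\<Sum>(m, n)\<in>F. eig \<theta> m n * inner_g f (J m n) * J m n z)) < e))"

definition Lop :: "real \<Rightarrow> (complex \<Rightarrow> complex) \<Rightarrow> (complex \<Rightarrow> complex)" where
  "Lop \<theta> f = (SOME g. Lrel \<theta> f g)"

definition lin_op :: "(complex \<Rightarrow> complex) set \<Rightarrow> ((complex \<Rightarrow> complex) \<Rightarrow> (complex \<Rightarrow> complex)) \<Rightarrow> bool" where
  "lin_op D A \<longleftrightarrow> D \<subseteq> Collect (Lp 2) \<and> (\<forall>f\<in>D. Lp 2 (A f)) \<and>
     (\<forall>f\<in>D. \<forall>g\<in>D. \<forall>a b. (\<lambda>z. a * f z + b * g z) \<in> D \<and>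
        ae_eq (A (\<lambda>z. a * f z + b * g z)) (\<lambda>z. a * A f z + b * A g z)) \<and>
     (\<forall>f\<in>D. \<forall>g. ae_eq f g \<longrightarrow> Lp 2 g \<longrightarrow> g \<in> D \<and> ae_eq (A f) (A g))"

definition densely_defined :: "(complex \<Rightarrow> complex) set \<Rightarrow> bool" where
  "densely_defined D \<longleftrightarrow> (\<forall>f. Lp 2 f \<longrightarrow> (\<forall>e>0. \<exists>g\<in>D. Lpnorm 2 (\<lambda>z. f z - g z) < e))"

definition closed_op :: "(complex \<Rightarrow> complex) set \<Rightarrow> ((complex \<Rightarrow> complex) \<Rightarrow> (complex \<Rightarrow> complex)) \<Rightarrow> bool" where
  "closed_op D A \<longleftrightarrow> (\<forall>fs f g. (\<forall>k. fs k \<in> D) \<longrightarrow> Lp 2 f \<longrightarrow> Lp 2 g \<longrightarrow>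
      (\<lambda>k. Lpnorm 2 (\<lambda>z. fs k z - f z)) \<longlonglongrightarrow> 0 \<longrightarrow>
      (\<lambda>k. Lpnorm 2 (\<lambda>z. A (fs k) z - g z)) \<longlonglongrightarrow> 0 \<longrightarrow>
      f \<in> D \<and> ae_eq (A f) g)"

definition adj_dom :: "(complex \<Rightarrow> complex) set \<Rightarrow> ((complex \<Rightarrow> complex) \<Rightarrow> (complex \<Rightarrow> complex)) \<Rightarrow> (complex \<Rightarrow> complex) set" where
  "adj_dom D A = {g. Lp 2 g \<and> (\<exists>h. Lp 2 h \<and> (\<forall>f\<in>D. inner_g (A f) g = inner_g f h))}"

definition adj_op :: "(complex \<Rightarrow> complex) set \<Rightarrow> ((complex \<Rightarrow> complex) \<Rightarrow> (complex \<Rightarrow> complex)) \<Rightarrow> (complex \<Rightarrow> complex) \<Rightarrow> (complex \<Rightarrow> complex)" where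
  "adj_op D A g = (SOME h. Lp 2 h \<and> (\<forall>f\<in>D. inner_g (A f) g = inner_g f h))"

definition normal_op :: "(complex \<Rightarrow> complex) set \<Rightarrow> ((complex \<Rightarrow> complex) \<Rightarrow> (complex \<Rightarrow> complex)) \<Rightarrow> bool" where
  "normal_op D A \<longleftrightarrow> D = adj_dom D A \<and>
     (\<forall>f. (f \<in> adj_dom D A \<and> adj_op D A f \<in> D) \<longleftrightarrow> (f \<in> D \<and> A f \<in> adj_dom D A)) \<and>
     (\<forall>f. f \<in> adj_dom D A \<and> adj_op D A f \<in> D \<longrightarrow> ae_eq (A (adj_op D A f)) (adj_op D A (A f)))"

definition Gam :: "real \<Rightarrow> (complex \<Rightarrow> complex) \<Rightarrow> (complex \<Rightarrow> complex) \<Rightarrow> (complex \<Rightarrow> complex)" where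
  "Gam \<theta> \<phi> \<psi> = (\<lambda>z. complex_of_real (1 / (2 * cos \<theta>)) *
      (Lop \<theta> (\<lambda>w. \<phi> w * cnj (\<psi> w)) z - \<phi> z * Lop \<theta> (\<lambda>w. cnj (\<psi> w)) z - cnj (\<psi> z) * Lop \<theta> \<phi> z))"

definition Cn :: "nat \<Rightarrow> (nat \<Rightarrow> complex) set" where
  "Cn n = {w. \<forall>i\<ge>n. w i = 0}"

text \<open>Real directional partial derivative in coordinate i along c (c = 1: d/dx_i, c = i: d/dy_i).\<close>
definition pdiff_ex :: "((nat \<Rightarrow> complex) \<Rightarrow> complex) \<Rightarrow> nat \<Rightarrow> complex \<Rightarrow> (nat \<Rightarrow> complex) \<Rightarrow> bool" where
  "pdiff_ex F i c w \<longleftrightarrow> (\<lambda>t::real. F (w(i := w i + complex_of_real t * c))) differentiable (at 0)"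

definition pdiff :: "((nat \<Rightarrow> complex) \<Rightarrow> complex) \<Rightarrow> nat \<Rightarrow> complex \<Rightarrow> (nat \<Rightarrow> complex) \<Rightarrow> complex" where
  "pdiff F i c w = vector_derivative (\<lambda>t::real. F (w(i := w i + complex_of_real t * c))) (at 0)"

definition Wz :: "nat \<Rightarrow> ((nat \<Rightarrow> complex) \<Rightarrow> complex) \<Rightarrow> (nat \<Rightarrow> complex) \<Rightarrow> complex" where
  "Wz i F w = (pdiff F i 1 w - \<i> * pdiff F i \<i> w) / 2"

definition Wzb :: "nat \<Rightarrow> ((nat \<Rightarrow> complex) \<Rightarrow> complex) \<Rightarrow> (nat \<Rightarrow> complex) \<Rightarrow> complex" where
  "Wzb i F w = (pdiff F i 1 w + \<i> * pdiff F i \<i> w) / 2"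

definition slowly_increasing :: "nat \<Rightarrow> ((nat \<Rightarrow> complex) \<Rightarrow> complex) \<Rightarrow> bool" where
  "slowly_increasing n G \<longleftrightarrow> continuous_on (Cn n) G \<and>
     (\<exists>C (k::nat). \<forall>w\<in>Cn n. cmod (G w) \<le> C * (1 + (\<Sum>i<n. (cmod (w i))\<^sup>2)) powr (real k / 2))"

definition C2_up :: "nat \<Rightarrow> ((nat \<Rightarrow> complex) \<Rightarrow> complex) \<Rightarrow> bool" where
  "C2_up n F \<longleftrightarrow> slowly_increasing n F \<and>
     (\<forall>i<n. \<forall>c\<in>{1, \<i>}. (\<forall>w\<in>Cn n. pdiff_ex F i c w) \<and> slowly_increasing n (pdiff F i c) \<and>
        (\<forall>j<n. \<forall>d\<in>{1, \<i>}. (\<forall>w\<in>Cn n. pdiff_ex (pdiff F i c) j d w) \<and>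
            slowly_increasing n (pdiff (pdiff F i c) j d)))"

definition compv :: "nat \<Rightarrow> ((nat \<Rightarrow> complex) \<Rightarrow> complex) \<Rightarrow> (nat \<Rightarrow> complex \<Rightarrow> complex) \<Rightarrow> complex \<Rightarrow> complex" where
  "compv n F \<phi> = (\<lambda>z. F (\<lambda>i. if i < n then \<phi> i z else 0))"

definition A1rel :: "real \<Rightarrow> (complex \<Rightarrow> complex) \<Rightarrow> (complex \<Rightarrow> complex) \<Rightarrow> bool" where
  "A1rel \<theta> f g \<longleftrightarrow> Lp 1 f \<and> Lp 1 g \<and>
     (\<exists>fs. (\<forall>k. fs k \<in> domL \<theta>) \<and>
        (\<lambda>k. Lpnorm 1 (\<lambda>z. fs k z - f z)) \<longlonglongrightarrow> 0 \<and>
        (\<lambda>k. Lpnorm 1 (\<lambda>z. Lop \<theta> (fs k) z - g z)) \<longlonglongrightarrow> 0)"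

end

theory Submission
  imports Defs "HOL-Probability.Distributions"
begin

text \<open>
  In the orthonormal basis of complex Hermite polynomials the operator is multiplication by
  \<open>- eig\<close>, so \<open>g\<close> represents \<open>L f\<close> iff both are square integrable and their coefficients are related
  by that factor; closedness, density and normality are then statements about coefficient sequences.
  Gaussian integration by parts shows that every \<open>C\<^sup>2\<close> function with slowly growing
  derivatives lies in the domain and that the operator acts on it as the second-order differential
  operator. The core is the algebra of polynomials in \<open>z\<close> and its conjugate, where the form
  \<open>\<Gamma>\<close> is the inner product of gradients and the diffusion property is the chain rule.
  The functions \<open>p exp (-\<epsilon>|z|\<^sup>2)\<close> with \<open>p\<close> a polynomial are bounded together with their
  images under the adjoint, hence survive \<open>L\<^sup>1\<close> limits; by Stone-Weierstrass they separate
  \<open>L\<^sup>1\<close> functions, which gives both the completeness of the Hermite basis and the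
  closability in \<open>L\<^sup>1\<close>, and \<open>\<epsilon> \<rightarrow> 0\<close> recovers the coefficients.
\<close>

section \<open>The Gaussian measure and its Lebesgue spaces\<close>

text \<open>In real coordinates the operator has real coefficients: \<open>cos \<theta>\<close>
  times a symmetric second-order part plus \<open>sin \<theta>\<close> times the rotation field,
  which is skew for the Gaussian. Hence its transpose and its Hilbert space adjoint are both the
  same expression at \<open>-\<theta>\<close>. The condition on \<open>\<theta>\<close> enters as
  \<open>cos \<theta> \<noteq> 0\<close>, the divisor in \<open>Gam\<close>. Stone-Weierstrass needs
  a compact set, which the plane is not; the weighted embedding has bounded image and supplies one.
  Orthogonality to polynomials becomes orthogonality to damped polynomials through the Taylor series
  of \<open>exp (-|z|^2/8)\<close>: its partial sums are polynomials dominated by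
  \<open>exp (|z|^2/8)\<close>, which is still square integrable for the Gaussian.
  \<open>C2_up\<close> speaks only of derivatives along coordinate axes, so Schwarz's theorem and
  the chain rule are derived from the continuity of the partial derivatives. Since
  \<open>Lop\<close> is a choice among a.e. equal functions, arguments run on the relation
  \<open>Lrel\<close> and reach \<open>Lop\<close> by a.e. equality.\<close>

lemma lborel_complex_eq: "lborel = distr (lborel \<Otimes>\<^sub>M lborel) borel (\<lambda>(x, y). Complex x y)"
proof (rule lborel_eqI)
  have cont: "continuous_on UNIV (\<lambda>p::real\<times>real. Complex (fst p) (snd p))"
    by (intro continuous_intros)
  have [measurable]: "(\<lambda>(x, y). Complex x y) \<in> borel_measurable (lborel \<Otimes>\<^sub>M lborel)"
    using borel_measurable_continuous_onI[OF cont]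
    by (simp add: lborel_prod case_prod_unfold)
  fix l u :: complex assume le: "\<And>b. b \<in> Basis \<Longrightarrow> l \<bullet> b \<le> u \<bullet> b"
  have le': "Re l \<le> Re u" "Im l \<le> Im u"
    using le[of 1] le[of \<i>] by (auto simp: Basis_complex_def)
  have eq: "(\<lambda>(x, y). Complex x y) -` box l u \<inter> space (lborel \<Otimes>\<^sub>M lborel)
      = {Re l<..<Re u} \<times> {Im l<..<Im u}"
    by (auto simp: box_def Basis_complex_def space_pair_measure)
  show "emeasure (distr (lborel \<Otimes>\<^sub>M lborel) borel (\<lambda>(x, y). Complex x y)) (box l u)
      = (\<Prod>b\<in>Basis. (u - l) \<bullet> b)"
    using le' by (simp add: emeasure_distr eq lborel.emeasure_pair_measure_Times Basis_complex_def
        ennreal_mult)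
qed simp

text \<open>The integrand is \<open>sqrt (pi / a)\<close> times the centred normal density of
  variance \<open>1 / (2 * a)\<close>, whose mass is 1.\<close>

lemma nn_integral_gaussian_real:
  assumes "a > 0"
  shows "(\<integral>\<^sup>+x. ennreal (exp (- (a * x\<^sup>2))) \<partial>lborel) = ennreal (sqrt (pi / a))"
proof -
  define s where "s = 1 / sqrt (2 * a)"
  have s: "s > 0" "s\<^sup>2 = 1 / (2 * a)" using assms by (auto simp: s_def field_simps)
  have eq: "exp (- (a * x\<^sup>2)) = sqrt (pi / a) * normal_density 0 s x" for x
    using assms by (simp add: normal_density_def s)
  have "(\<integral>\<^sup>+x. ennreal (normal_density 0 s x) \<partial>lborel) = ennreal (integral\<^sup>L lborel (normal_density 0 s))"
    by (rule nn_integral_eq_integral) (use s in auto)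
  also have "\<dots> = 1" using s by (simp add: integral_normal_density)
  finally have *: "(\<integral>\<^sup>+x. ennreal (normal_density 0 s x) \<partial>lborel) = 1" .
  have "(\<integral>\<^sup>+x. ennreal (exp (- (a * x\<^sup>2))) \<partial>lborel)
      = (\<integral>\<^sup>+x. ennreal (sqrt (pi / a)) * ennreal (normal_density 0 s x) \<partial>lborel)"
    unfolding eq using assms by (intro nn_integral_cong) (subst ennreal_mult, auto)
  also have "\<dots> = ennreal (sqrt (pi / a))"
    by (subst nn_integral_cmult) (auto simp: *)
  finally show ?thesis .
qed

text \<open>The exponential of \<open>|z|^2\<close> factors into its two real coordinates, so
  Tonelli yields the square of the one-dimensional value.\<close>

lemma nn_integral_gaussian_complex:
  assumes "a > 0"
  shows "(\<integral>\<^sup>+z. ennreal (exp (- (a * (cmod z)\<^sup>2))) \<partial>lborel) = ennreal (pi / a)"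
proof -
  have cont: "continuous_on UNIV (\<lambda>p::real\<times>real. Complex (fst p) (snd p))"
    by (intro continuous_intros)
  have [measurable]: "(\<lambda>(x, y). Complex x y) \<in> borel_measurable (lborel \<Otimes>\<^sub>M lborel)"
    using borel_measurable_continuous_onI[OF cont]
    by (simp add: lborel_prod case_prod_unfold)
  have "(\<integral>\<^sup>+z. ennreal (exp (- (a * (cmod z)\<^sup>2))) \<partial>lborel)
      = (\<integral>\<^sup>+p. ennreal (exp (- (a * (cmod (Complex (fst p) (snd p)))\<^sup>2))) \<partial>(lborel \<Otimes>\<^sub>M lborel))"
    by (subst lborel_complex_eq, subst nn_integral_distr) (auto simp: case_prod_unfold)
  also have "\<dots> = (\<integral>\<^sup>+p. ennreal (exp (- (a * (fst p)\<^sup>2))) * ennreal (exp (- (a * (snd p)\<^sup>2))) \<partial>(lborel \<Otimes>\<^sub>M lborel))"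
    by (intro nn_integral_cong) (simp add: ennreal_mult'[symmetric] cmod_def exp_add[symmetric] algebra_simps)
  also have "\<dots> = (\<integral>\<^sup>+x. (\<integral>\<^sup>+y. ennreal (exp (- (a * x\<^sup>2))) * ennreal (exp (- (a * y\<^sup>2))) \<partial>lborel) \<partial>lborel)"
    by (subst lborel.nn_integral_fst[symmetric]) auto
  also have "\<dots> = (\<integral>\<^sup>+x. ennreal (exp (- (a * x\<^sup>2))) * ennreal (sqrt (pi / a)) \<partial>lborel)"
    by (subst nn_integral_cmult) (auto simp: nn_integral_gaussian_real[OF assms])
  also have "\<dots> = ennreal (sqrt (pi / a)) * ennreal (sqrt (pi / a))"
    by (subst nn_integral_multc) (auto simp: nn_integral_gaussian_real[OF assms])
  also have "\<dots> = ennreal (pi / a)"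
    using assms by (simp add: ennreal_mult[symmetric] real_sqrt_mult[symmetric])
  finally show ?thesis .
qed

lemma integrable_gaussian_complex:
  assumes "a > 0"
  shows "integrable lborel (\<lambda>z::complex. exp (- (a * (cmod z)\<^sup>2)))"
  using nn_integral_gaussian_complex[OF assms]
  by (intro integrableI_bounded) auto

section \<open>The Gaussian probability measure and its density\<close>

definition gden :: "complex \<Rightarrow> real" where "gden z = exp (- (cmod z)\<^sup>2 / 2) / (2 * pi)"

lemma gden_pos [simp]: "gden z > 0" "gden z \<ge> 0"
  by (auto simp: gden_def)

lemma gden_measurable [measurable]: "gden \<in> borel_measurable borel"
  unfolding gden_def by measurable

lemma gauss_eq: "gauss = density lborel (\<lambda>z. ennreal (gden z))"
  by (simp add: gauss_def gden_def)

lemma sets_gauss [simp, measurable_cong]: "sets gauss = sets borel"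
  by (simp add: gauss_def)

lemma space_gauss [simp]: "space gauss = UNIV"
  by (simp add: gauss_def)

lemma prob_space_gauss: "prob_space gauss"
proof
  have "emeasure gauss (space gauss) = (\<integral>\<^sup>+z. ennreal (gden z) \<partial>lborel)"
    by (simp add: gauss_eq emeasure_density)
  also have "\<dots> = (\<integral>\<^sup>+z. ennreal (1 / (2 * pi)) * ennreal (exp (- (1/2 * (cmod z)\<^sup>2))) \<partial>lborel)"
    by (intro nn_integral_cong) (simp add: ennreal_mult'[symmetric] gden_def)
  also have "\<dots> = ennreal (1 / (2 * pi)) * ennreal (pi / (1/2))"
    by (subst nn_integral_cmult, simp, subst nn_integral_gaussian_complex) auto
  also have "\<dots> = 1"
    by (simp add: ennreal_mult'[symmetric] del: ennreal_1 add: ennreal_1[symmetric])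
  finally show "emeasure gauss (space gauss) = 1" .
qed

interpretation gauss: prob_space gauss
  by (rule prob_space_gauss)

lemma integrable_gauss_iff:
  fixes f :: "complex \<Rightarrow> 'a::{banach, second_countable_topology}"
  assumes [measurable]: "f \<in> borel_measurable borel"
  shows "integrable gauss f \<longleftrightarrow> integrable lborel (\<lambda>z. gden z *\<^sub>R f z)"
  unfolding gauss_eq by (rule integrable_density) auto

lemma integral_gauss_eq:
  fixes f :: "complex \<Rightarrow> 'a::{banach, second_countable_topology}"
  assumes [measurable]: "f \<in> borel_measurable borel"
  shows "integral\<^sup>L gauss f = (\<integral>z. gden z *\<^sub>R f z \<partial>lborel)"
  unfolding gauss_eq by (rule integral_density) auto

lemma borel_measurable_cnj [measurable (raw)]:
  assumes "f \<in> borel_measurable M"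
  shows "(\<lambda>x. cnj (f x)) \<in> borel_measurable M"
  by (rule borel_measurable_continuous_on[OF _ assms]) (intro continuous_intros)

section \<open>L^p classes, norms and the inner product\<close>

lemma Lp_measurable [measurable_dest]: "Lp p f \<Longrightarrow> f \<in> borel_measurable borel"
  by (simp add: Lp_def cong: measurable_cong_sets)

lemma Lp_iff: "Lp p f \<longleftrightarrow> f \<in> borel_measurable borel \<and> integrable gauss (\<lambda>z. cmod (f z) ^ p)"
  by (simp add: Lp_def cong: measurable_cong_sets)

lemma Lp_integrable: "Lp p f \<Longrightarrow> integrable gauss (\<lambda>z. cmod (f z) ^ p)"
  by (simp add: Lp_def)

lemma Lp_1_iff: "Lp 1 f \<longleftrightarrow> integrable gauss f"
  unfolding Lp_def by (auto simp: integrable_norm_iff)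

lemma Lp_add:
  assumes "Lp p f" "Lp p g"
  shows "Lp p (\<lambda>z. f z + g z)"
  unfolding Lp_iff
proof (intro conjI)
  note [measurable] = Lp_measurable[OF assms(1)] Lp_measurable[OF assms(2)]
  show "(\<lambda>z. f z + g z) \<in> borel_measurable borel" by measurable
  show "integrable gauss (\<lambda>z. cmod (f z + g z) ^ p)"
  proof (rule Bochner_Integration.integrable_bound)
    show "integrable gauss (\<lambda>z. 2 ^ p * (cmod (f z) ^ p + cmod (g z) ^ p))"
      using assms by (intro integrable_mult_right Bochner_Integration.integrable_add Lp_integrable)
    show "AE z in gauss. norm (cmod (f z + g z) ^ p) \<le> norm (2 ^ p * (cmod (f z) ^ p + cmod (g z) ^ p))"
    proof (rule AE_I2)
      fix z
      \<comment> \<open>Twice the larger summand dominates the sum, which settles every exponent at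
        once without a convexity argument.\<close>
      let ?m = "max (cmod (f z)) (cmod (g z))"
      have "cmod (f z + g z) \<le> 2 * ?m"
        using norm_triangle_ineq[of "f z" "g z"] by linarith
      then have "cmod (f z + g z) ^ p \<le> (2 * ?m) ^ p" by (rule power_mono) auto
      also have "\<dots> = 2 ^ p * ?m ^ p" by (simp add: power_mult_distrib)
      also have "?m ^ p \<le> cmod (f z) ^ p + cmod (g z) ^ p" by (auto simp: max_def)
      finally show "norm (cmod (f z + g z) ^ p) \<le> norm (2 ^ p * (cmod (f z) ^ p + cmod (g z) ^ p))"
        by simp
    qed
  qed measurable
qed

lemma Lp_cmult: "Lp p f \<Longrightarrow> Lp p (\<lambda>z. a * f z)"
  by (auto simp: Lp_iff norm_mult power_mult_distrib)

lemma Lp_uminus: "Lp p f \<Longrightarrow> Lp p (\<lambda>z. - f z)"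
  using Lp_cmult[of p f "-1"] by simp

lemma Lp_diff: "Lp p f \<Longrightarrow> Lp p g \<Longrightarrow> Lp p (\<lambda>z. f z - g z)"
  using Lp_add[of p f "\<lambda>z. - g z"] Lp_uminus by auto

lemma Lp_cnj: "Lp p f \<Longrightarrow> Lp p (\<lambda>z. cnj (f z))"
  by (simp add: Lp_iff borel_measurable_cnj)

lemma Lp_zero: "p > 0 \<Longrightarrow> Lp p (\<lambda>z. 0)"
  by (auto simp: Lp_iff)

lemma Lp_sum: "finite A \<Longrightarrow> p > 0 \<Longrightarrow> (\<And>i. i \<in> A \<Longrightarrow> Lp p (f i)) \<Longrightarrow> Lp p (\<lambda>z. \<Sum>i\<in>A. f i z)"
  by (induct A rule: finite_induct) (auto intro: Lp_add Lp_zero)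

lemma Lp_cong_AE: "Lp p f \<Longrightarrow> ae_eq f g \<Longrightarrow> g \<in> borel_measurable borel \<Longrightarrow> Lp p g"
proof -
  assume f: "Lp p f" and e: "ae_eq f g" and [measurable]: "g \<in> borel_measurable borel"
  have "integrable gauss (\<lambda>z. cmod (g z) ^ p)"
    by (rule integrable_cong_AE_imp[OF Lp_integrable[OF f]]) (use e in \<open>auto simp: ae_eq_def elim: eventually_mono\<close>)
  then show "Lp p g" by (simp add: Lp_iff)
qed

lemma Lp_2_imp_1: "Lp 2 f \<Longrightarrow> Lp 1 f"
proof -
  assume L: "Lp 2 f"
  note [measurable] = Lp_measurable[OF L]
  have "integrable gauss (\<lambda>z. cmod (f z))"
    by (rule gauss.square_integrable_imp_integrable) (use L in \<open>auto simp: Lp_iff\<close>)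
  then show "Lp 1 f" by (auto simp: Lp_iff)
qed

lemma L2_integrable_norm_mult:
  assumes "Lp 2 f" "Lp 2 g"
  shows "integrable gauss (\<lambda>z. cmod (f z) * cmod (g z))"
proof (rule Bochner_Integration.integrable_bound)
  note [measurable] = Lp_measurable[OF assms(1)] Lp_measurable[OF assms(2)]
  show "integrable gauss (\<lambda>z. cmod (f z) ^ 2 + cmod (g z) ^ 2)"
    using assms by (intro Bochner_Integration.integrable_add Lp_integrable)
  show "(\<lambda>z. cmod (f z) * cmod (g z)) \<in> borel_measurable gauss" by measurable
  show "AE z in gauss. norm (cmod (f z) * cmod (g z)) \<le> norm (cmod (f z) ^ 2 + cmod (g z) ^ 2)"
  proof (rule AE_I2)
    fix z show "norm (cmod (f z) * cmod (g z)) \<le> norm (cmod (f z) ^ 2 + cmod (g z) ^ 2)"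
    proof -
      have "0 \<le> cmod (f z) * cmod (g z)" by simp
      then have "cmod (f z) * cmod (g z) \<le> cmod (f z) ^ 2 + cmod (g z) ^ 2"
        using sum_squares_bound[of "cmod (f z)" "cmod (g z)"] by linarith
      then show ?thesis by simp
    qed
  qed
qed

lemma L2_integrable_mult:
  assumes "Lp 2 f" "Lp 2 g"
  shows "integrable gauss (\<lambda>z. f z * g z)"
proof (rule Bochner_Integration.integrable_bound[OF L2_integrable_norm_mult[OF assms]])
  note [measurable] = Lp_measurable[OF assms(1)] Lp_measurable[OF assms(2)]
  show "(\<lambda>z. f z * g z) \<in> borel_measurable gauss" by measurable
qed (auto simp: norm_mult)

lemma L2_integrable_cnj_mult:
  "Lp 2 f \<Longrightarrow> Lp 2 g \<Longrightarrow> integrable gauss (\<lambda>z. f z * cnj (g z))"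
  by (intro L2_integrable_mult Lp_cnj)

text \<open>Boundedness of the second factor replaces square integrability, so functions that are
  only L^1 can be tested.\<close>

lemma integrable_mult_bounded:
  assumes h: "integrable gauss h" and [measurable]: "q \<in> borel_measurable borel"
    and b: "\<And>z. cmod (q z) \<le> B"
  shows "integrable gauss (\<lambda>z. h z * q z)"
proof (rule Bochner_Integration.integrable_bound)
  have [measurable]: "h \<in> borel_measurable borel"
    using h by (simp add: integrable_iff_bounded cong: measurable_cong_sets)
  show "integrable gauss (\<lambda>z. B * cmod (h z))" using h by simp
  show "(\<lambda>z. h z * q z) \<in> borel_measurable gauss" by measurable
  show "AE z in gauss. norm (h z * q z) \<le> norm (B * cmod (h z))"
  proof (rule AE_I2)
    fix z
    have "cmod (q z) \<le> \<bar>B\<bar>" using b[of z] by linarith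
    then show "norm (h z * q z) \<le> norm (B * cmod (h z))"
      by (simp add: norm_mult abs_mult mult.commute[of "cmod (h z)"] mult_right_mono)
  qed
qed

lemma Lpnorm_2_eq: "Lpnorm 2 f = sqrt (\<integral>z. (cmod (f z))\<^sup>2 \<partial>gauss)"
  by (simp add: Lpnorm_def powr_half_sqrt)

lemma Lpnorm_1_eq: "Lpnorm 1 f = (\<integral>z. cmod (f z) \<partial>gauss)"
  by (simp add: Lpnorm_def)

lemma Lpnorm_nonneg [simp]: "Lpnorm p f \<ge> 0"
  by (simp add: Lpnorm_def)

lemma Lpnorm_2_sq: "(Lpnorm 2 f)\<^sup>2 = (\<integral>z. (cmod (f z))\<^sup>2 \<partial>gauss)"
  by (simp add: Lpnorm_2_eq)

lemma Lpnorm_cong_AE: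
  assumes "ae_eq f g" "f \<in> borel_measurable borel" "g \<in> borel_measurable borel"
  shows "Lpnorm p f = Lpnorm p g"
proof -
  note [measurable] = assms(2,3)
  have "(\<integral>z. (cmod (f z)) ^ p \<partial>gauss) = (\<integral>z. (cmod (g z)) ^ p \<partial>gauss)"
    by (rule integral_cong_AE) (use assms(1) in \<open>auto simp: ae_eq_def\<close>)
  then show ?thesis by (simp add: Lpnorm_def)
qed

lemma Lpnorm_minus_commute: "Lpnorm p (\<lambda>z. f z - g z) = Lpnorm p (\<lambda>z. g z - f z)"
  by (simp add: Lpnorm_def norm_minus_commute)

lemma Lpnorm_2_zero_iff: "Lp 2 f \<Longrightarrow> Lpnorm 2 f = 0 \<longleftrightarrow> ae_eq f (\<lambda>_. 0)"
  unfolding Lpnorm_2_eq ae_eq_def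
  by (simp add: integral_nonneg_eq_0_iff_AE Lp_integrable)

lemma L2_Cauchy_Schwarz_norm:
  assumes f: "Lp 2 f" and g: "Lp 2 g"
  shows "(\<integral>z. cmod (f z) * cmod (g z) \<partial>gauss) \<le> Lpnorm 2 f * Lpnorm 2 g"
proof (cases "Lpnorm 2 f = 0 \<or> Lpnorm 2 g = 0")
  case True
  note [measurable] = Lp_measurable[OF f] Lp_measurable[OF g]
  have "AE z in gauss. cmod (f z) * cmod (g z) = 0"
    using True Lpnorm_2_zero_iff[OF f] Lpnorm_2_zero_iff[OF g] by (auto simp: ae_eq_def)
  then have "(\<integral>z. cmod (f z) * cmod (g z) \<partial>gauss) = 0"
    by (rule integral_eq_zero_AE)
  then show ?thesis by simp
next
  case False
  \<comment> \<open>The optimal weight in \<open>a b \<le> s a^2 / 2 + b^2 / (2 s)\<close>: with it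
    both terms integrate to half the product of the norms.\<close>
  define s where "s = Lpnorm 2 g / Lpnorm 2 f"
  have pos: "Lpnorm 2 f > 0" "Lpnorm 2 g > 0" using False by (auto simp: less_le)
  then have s: "s > 0" by (simp add: s_def)
  have "(\<integral>z. cmod (f z) * cmod (g z) \<partial>gauss)
      \<le> (\<integral>z. s / 2 * (cmod (f z))\<^sup>2 + 1 / (2 * s) * (cmod (g z))\<^sup>2 \<partial>gauss)"
  proof (rule integral_mono)
    fix z
    have "0 \<le> (s * cmod (f z) - cmod (g z))\<^sup>2 / (2 * s)" using s by simp
    also have "\<dots> = s / 2 * (cmod (f z))\<^sup>2 + 1 / (2 * s) * (cmod (g z))\<^sup>2 - cmod (f z) * cmod (g z)"
      using s by (simp add: field_simps power2_eq_square)
    finally show "cmod (f z) * cmod (g z) \<le> s / 2 * (cmod (f z))\<^sup>2 + 1 / (2 * s) * (cmod (g z))\<^sup>2"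
      by simp
  qed (intro Bochner_Integration.integrable_add integrable_mult_right Lp_integrable L2_integrable_norm_mult f g)+
  also have "\<dots> = s / 2 * (Lpnorm 2 f)\<^sup>2 + 1 / (2 * s) * (Lpnorm 2 g)\<^sup>2"
    using f g by (subst Bochner_Integration.integral_add) (auto simp: Lpnorm_2_sq Lp_integrable)
  also have "\<dots> = Lpnorm 2 f * Lpnorm 2 g"
    using pos by (simp add: s_def field_simps power2_eq_square)
  finally show ?thesis .
qed

lemma inner_g_Cauchy_Schwarz:
  assumes "Lp 2 f" "Lp 2 g"
  shows "cmod (inner_g f g) \<le> Lpnorm 2 f * Lpnorm 2 g"
proof -
  have "cmod (inner_g f g) \<le> (\<integral>z. cmod (f z * cnj (g z)) \<partial>gauss)"
    unfolding inner_g_def by (rule integral_norm_bound)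
  also have "\<dots> \<le> Lpnorm 2 f * Lpnorm 2 g"
    using L2_Cauchy_Schwarz_norm[OF assms] by (simp add: norm_mult)
  finally show ?thesis .
qed

lemma Lpnorm_2_triangle:
  assumes "Lp 2 f" "Lp 2 g"
  shows "Lpnorm 2 (\<lambda>z. f z + g z) \<le> Lpnorm 2 f + Lpnorm 2 g"
proof (rule power2_le_imp_le)
  have "(Lpnorm 2 (\<lambda>z. f z + g z))\<^sup>2
      \<le> (\<integral>z. (cmod (f z))\<^sup>2 + 2 * (cmod (f z) * cmod (g z)) + (cmod (g z))\<^sup>2 \<partial>gauss)"
    unfolding Lpnorm_2_sq
  proof (rule integral_mono)
    fix z
    have "(cmod (f z + g z))\<^sup>2 \<le> (cmod (f z) + cmod (g z))\<^sup>2"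
      by (intro power_mono norm_triangle_ineq) auto
    then show "(cmod (f z + g z))\<^sup>2 \<le> (cmod (f z))\<^sup>2 + 2 * (cmod (f z) * cmod (g z)) + (cmod (g z))\<^sup>2"
      by (simp add: power2_sum)
  qed (intro Bochner_Integration.integrable_add integrable_mult_right Lp_integrable Lp_add L2_integrable_norm_mult assms)+
  also have "\<dots> = (Lpnorm 2 f)\<^sup>2 + 2 * (\<integral>z. cmod (f z) * cmod (g z) \<partial>gauss) + (Lpnorm 2 g)\<^sup>2"
    using assms by (simp add: Lpnorm_2_sq Lp_integrable L2_integrable_norm_mult)
  also have "\<dots> \<le> (Lpnorm 2 f + Lpnorm 2 g)\<^sup>2"
    using L2_Cauchy_Schwarz_norm[OF assms] by (simp add: power2_sum)
  finally show "(Lpnorm 2 (\<lambda>z. f z + g z))\<^sup>2 \<le> (Lpnorm 2 f + Lpnorm 2 g)\<^sup>2" .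
qed auto

lemma Lpnorm_2_triangle_diff:
  assumes "Lp 2 f" "Lp 2 g" "Lp 2 h"
  shows "Lpnorm 2 (\<lambda>z. f z - h z) \<le> Lpnorm 2 (\<lambda>z. f z - g z) + Lpnorm 2 (\<lambda>z. g z - h z)"
  using Lpnorm_2_triangle[of "\<lambda>z. f z - g z" "\<lambda>z. g z - h z"] assms by (simp add: Lp_diff)

text \<open>Cauchy-Schwarz against the constant 1, which has norm 1 because the measure is a
  probability.\<close>

lemma Lpnorm_1_le_2: "Lp 2 f \<Longrightarrow> Lpnorm 1 f \<le> Lpnorm 2 f"
  using L2_Cauchy_Schwarz_norm[of f "\<lambda>_. 1"]
  unfolding Lpnorm_1_eq by (simp add: Lp_iff) (simp add: Lpnorm_2_eq gauss.prob_space[simplified])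

lemma inner_g_add_left: "Lp 2 f \<Longrightarrow> Lp 2 g \<Longrightarrow> Lp 2 h \<Longrightarrow> inner_g (\<lambda>z. f z + g z) h = inner_g f h + inner_g g h"
  by (simp add: inner_g_def ring_distribs L2_integrable_cnj_mult)

lemma inner_g_diff_left: "Lp 2 f \<Longrightarrow> Lp 2 g \<Longrightarrow> Lp 2 h \<Longrightarrow> inner_g (\<lambda>z. f z - g z) h = inner_g f h - inner_g g h"
  by (simp add: inner_g_def ring_distribs L2_integrable_cnj_mult)

lemma inner_g_cmult_left: "inner_g (\<lambda>z. a * f z) h = a * inner_g f h"
  by (simp add: inner_g_def mult.assoc)

lemma inner_g_cnj: "cnj (inner_g f g) = inner_g g f"
proof -
  have "cnj (inner_g f g) = (\<integral>z. cnj (f z * cnj (g z)) \<partial>gauss)"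
    unfolding inner_g_def by (rule Bochner_Integration.integral_cnj[symmetric])
  then show ?thesis by (simp add: inner_g_def mult.commute)
qed

lemma inner_g_cmult_right: "inner_g f (\<lambda>z. a * h z) = cnj a * inner_g f h"
  by (metis (no_types, lifting) complex_cnj_mult inner_g_cmult_left inner_g_cnj)

lemma inner_g_sum_left:
  assumes "finite A" "\<And>i. i \<in> A \<Longrightarrow> Lp 2 (f i)" "Lp 2 h"
  shows "inner_g (\<lambda>z. \<Sum>i\<in>A. f i z) h = (\<Sum>i\<in>A. inner_g (f i) h)"
  using assms
  by (induction A rule: finite_induct) (auto simp: inner_g_add_left Lp_sum, simp add: inner_g_def)

lemma inner_g_self: "inner_g f f = complex_of_real ((Lpnorm 2 f)\<^sup>2)"
proof -
  have "inner_g f f = (\<integral>z. complex_of_real ((cmod (f z))\<^sup>2) \<partial>gauss)"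
    unfolding inner_g_def by (intro Bochner_Integration.integral_cong) (simp_all only: complex_norm_square)
  also have "\<dots> = complex_of_real (\<integral>z. (cmod (f z))\<^sup>2 \<partial>gauss)"
    by (rule integral_complex_of_real)
  finally show ?thesis by (simp only: Lpnorm_2_sq)
qed

lemma inner_g_cong_AE_left:
  assumes "ae_eq f f'" "f \<in> borel_measurable borel" "f' \<in> borel_measurable borel" "g \<in> borel_measurable borel"
  shows "inner_g f g = inner_g f' g"
proof -
  note [measurable] = assms(2-4)
  show ?thesis unfolding inner_g_def
    by (rule integral_cong_AE) (use assms(1) in \<open>auto simp: ae_eq_def\<close>)
qed

lemma ae_eq_refl [simp]: "ae_eq f f" by (simp add: ae_eq_def)
lemma ae_eq_sym: "ae_eq f g \<Longrightarrow> ae_eq g f" by (auto simp: ae_eq_def elim: eventually_mono)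
section \<open>Completeness and orthonormal bases\<close>

text \<open>Monotone convergence gives the sum of the moduli a finite integral; it is therefore
  finite a.e., and absolute convergence follows.\<close>

lemma AE_summable_of_summable_L1:
  fixes d :: "nat \<Rightarrow> complex \<Rightarrow> complex"
  assumes d: "\<And>k. integrable gauss (d k)" and s: "summable (\<lambda>k. \<integral>z. cmod (d k z) \<partial>gauss)"
  shows "AE z in gauss. summable (\<lambda>k. d k z)"
proof -
  have [measurable]: "d k \<in> borel_measurable borel" for k
    using d[of k] by (simp add: integrable_iff_bounded cong: measurable_cong_sets)
  have "(\<integral>\<^sup>+z. (\<Sum>k. ennreal (cmod (d k z))) \<partial>gauss) = (\<Sum>k. \<integral>\<^sup>+z. ennreal (cmod (d k z)) \<partial>gauss)"
    by (rule nn_integral_suminf) measurable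
  also have "\<dots> = (\<Sum>k. ennreal (\<integral>z. cmod (d k z) \<partial>gauss))"
    using d by (intro suminf_cong nn_integral_eq_integral) auto
  also have "\<dots> = ennreal (\<Sum>k. \<integral>z. cmod (d k z) \<partial>gauss)"
    by (rule suminf_ennreal2) (use s in auto)
  finally have "(\<integral>\<^sup>+z. (\<Sum>k. ennreal (cmod (d k z))) \<partial>gauss) \<noteq> \<infinity>" by simp
  then have "AE z in gauss. (\<Sum>k. ennreal (cmod (d k z))) \<noteq> \<infinity>"
    by (intro nn_integral_PInf_AE) measurable
  then show ?thesis
    by eventually_elim
      (auto intro!: summable_norm_cancel[OF summable_suminf_not_top])
qed

text \<open>Fatou's lemma applied to the squared distances from the fixed member
  \<open>f n\<close>.\<close>

lemma L2_limit_of_AE_limit: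
  assumes f: "\<And>k. Lp 2 (f k)" and [measurable]: "g \<in> borel_measurable borel"
    and lim: "AE z in gauss. (\<lambda>k. f k z) \<longlonglongrightarrow> g z"
    and c: "\<And>m. m \<ge> n \<Longrightarrow> Lpnorm 2 (\<lambda>z. f m z - f n z) \<le> e"
  shows "Lp 2 (\<lambda>z. g z - f n z)" "Lpnorm 2 (\<lambda>z. g z - f n z) \<le> e"
proof -
  note [measurable] = Lp_measurable[OF f]
  have e: "e \<ge> 0" using c[of n] Lpnorm_nonneg order_trans by blast
  have "(\<integral>\<^sup>+z. ennreal ((cmod (g z - f n z))\<^sup>2) \<partial>gauss)
      = (\<integral>\<^sup>+z. liminf (\<lambda>m. ennreal ((cmod (f m z - f n z))\<^sup>2)) \<partial>gauss)"
    using lim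
    by (intro nn_integral_cong_AE)
      (auto elim!: eventually_mono intro!: lim_imp_Liminf[symmetric] tendsto_intros)
  also have "\<dots> \<le> liminf (\<lambda>m. \<integral>\<^sup>+z. ennreal ((cmod (f m z - f n z))\<^sup>2) \<partial>gauss)"
    by (rule nn_integral_liminf) measurable
  also have "(\<lambda>m. \<integral>\<^sup>+z. ennreal ((cmod (f m z - f n z))\<^sup>2) \<partial>gauss)
      = (\<lambda>m. ennreal ((Lpnorm 2 (\<lambda>z. f m z - f n z))\<^sup>2))"
    unfolding Lpnorm_2_sq
    by (intro ext nn_integral_eq_integral) (auto intro!: Lp_integrable Lp_diff f)
  also have "liminf \<dots> \<le> liminf (\<lambda>m. ennreal (e\<^sup>2))"
    by (intro Liminf_mono eventually_sequentiallyI[of n] ennreal_leI power_mono c) auto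
  also have "\<dots> = ennreal (e\<^sup>2)" by (simp add: Liminf_const)
  finally have le: "(\<integral>\<^sup>+z. ennreal ((cmod (g z - f n z))\<^sup>2) \<partial>gauss) \<le> ennreal (e\<^sup>2)" .
  have int: "integrable gauss (\<lambda>z. (cmod (g z - f n z))\<^sup>2)"
    using le by (intro integrableI_bounded) (auto simp: le_less_trans)
  then show "Lp 2 (\<lambda>z. g z - f n z)" by (simp add: Lp_iff)
  have "ennreal ((Lpnorm 2 (\<lambda>z. g z - f n z))\<^sup>2) \<le> ennreal (e\<^sup>2)"
    unfolding Lpnorm_2_sq using le nn_integral_eq_integral[OF int] by simp
  then have "(Lpnorm 2 (\<lambda>z. g z - f n z))\<^sup>2 \<le> e\<^sup>2" by simp
  then show "Lpnorm 2 (\<lambda>z. g z - f n z) \<le> e" using e by (rule power2_le_imp_le)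
qed

text \<open>Riesz-Fischer: a subsequence with geometric gaps converges a.e., since its gaps are
  summable in L^1, and the Fatou bound turns the pointwise limit into a limit in norm.\<close>

lemma L2_complete:
  assumes f: "\<And>k. Lp 2 (f k)"
    and cauchy: "\<And>e. e > 0 \<Longrightarrow> \<exists>N. \<forall>m\<ge>N. \<forall>n\<ge>N. Lpnorm 2 (\<lambda>z. f m z - f n z) < e"
  shows "\<exists>g. Lp 2 g \<and> (\<lambda>k. Lpnorm 2 (\<lambda>z. f k z - g z)) \<longlonglongrightarrow> 0"
proof -
  have "\<forall>k. \<exists>N. \<forall>m\<ge>N. \<forall>n\<ge>N. Lpnorm 2 (\<lambda>z. f m z - f n z) < (1/2)^k"
    using cauchy by simp
  then obtain N where N: "\<And>k m n. m \<ge> N k \<Longrightarrow> n \<ge> N k \<Longrightarrow> Lpnorm 2 (\<lambda>z. f m z - f n z) < (1/2)^k"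
    by metis
  \<comment> \<open>Partial sums make the indices monotone while keeping each one above its
    threshold \<open>N k\<close>.\<close>
  define r where "r k = (\<Sum>j\<le>k. N j)" for k
  have rN: "r k \<ge> N k" for k unfolding r_def by (intro member_le_sum) auto
  have rmono: "j \<le> k \<Longrightarrow> r j \<le> r k" for j k
    unfolding r_def by (intro sum_mono2) auto
  define d where "d k z = f (r (Suc k)) z - f (r k) z" for k z
  have d2: "Lp 2 (d k)" for k unfolding d_def by (intro Lp_diff f)
  have dn: "Lpnorm 2 (d k) \<le> (1/2)^k" for k
    using N[of k "r (Suc k)" "r k"] rN[of k] rmono[of k "Suc k"] unfolding d_def by fastforce
  have d1: "integrable gauss (d k)" for k using Lp_2_imp_1[OF d2[of k]] Lp_1_iff by blast
  have "summable (\<lambda>k. \<integral>z. cmod (d k z) \<partial>gauss)"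
  proof (rule summable_comparison_test'[where N=0])
    show "summable (\<lambda>k. (1/2::real)^k)" by (simp add: summable_geometric)
    show "norm (\<integral>z. cmod (d k z) \<partial>gauss) \<le> (1/2)^k" for k
      using Lpnorm_1_le_2[OF d2[of k]] dn[of k] unfolding Lpnorm_1_eq by simp
  qed
  from AE_summable_of_summable_L1[OF d1 this]
  have conv: "AE z in gauss. convergent (\<lambda>k. f (r k) z)"
  proof eventually_elim
    case (elim z)
    have "(\<lambda>n. \<Sum>k<n. d k z) = (\<lambda>n. f (r n) z - f (r 0) z)"
      unfolding d_def by (rule ext, rule sum_lessThan_telescope)
    with elim have "convergent (\<lambda>n. f (r n) z - f (r 0) z)"
      by (simp add: summable_iff_convergent)
    then show ?case
      by (auto simp: convergent_diff_const_right_iff)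
  qed
  note [measurable] = Lp_measurable[OF f]
  define g where "g z = lim (\<lambda>k. f (r k) z)" for z
  have gm [measurable]: "g \<in> borel_measurable borel"
    unfolding g_def by (rule borel_measurable_lim_metric) measurable
  have lim: "AE z in gauss. (\<lambda>k. f (r k) z) \<longlonglongrightarrow> g z"
    using conv by eventually_elim (simp add: g_def convergent_LIMSEQ_iff)
  have close: "Lpnorm 2 (\<lambda>z. f (r m) z - f (r n) z) \<le> (1/2)^n" if "m \<ge> n" for m n
    using N[of n "r m" "r n"] rN[of n] rmono[OF that] by fastforce
  have gn: "Lp 2 (\<lambda>z. g z - f (r n) z)" "Lpnorm 2 (\<lambda>z. g z - f (r n) z) \<le> (1/2)^n" for n
    using L2_limit_of_AE_limit[of "\<lambda>k. f (r k)" g n "(1/2)^n", OF f gm lim close] by auto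
  have g2: "Lp 2 g" using Lp_add[OF gn(1)[of 0] f[of "r 0"]] by simp
  have "(\<lambda>k. Lpnorm 2 (\<lambda>z. f k z - g z)) \<longlonglongrightarrow> 0"
  proof (rule LIMSEQ_I)
    fix e :: real assume e: "e > 0"
    obtain n where n: "(1/2::real)^n < e / 2" using real_arch_pow_inv[of "e/2" "1/2"] e by auto
    have "norm (Lpnorm 2 (\<lambda>z. f k z - g z) - 0) < e" if "k \<ge> r n" for k
    proof -
      have "Lpnorm 2 (\<lambda>z. f k z - g z) \<le> Lpnorm 2 (\<lambda>z. f k z - f (r n) z) + Lpnorm 2 (\<lambda>z. f (r n) z - g z)"
        by (rule Lpnorm_2_triangle_diff) (use f g2 in auto)
      also have "\<dots> < (1/2)^n + (1/2)^n"
        using N[of n k "r n"] that rN[of n] gn(2)[of n] Lpnorm_minus_commute[of 2 g "f (r n)"] by simp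
      finally show ?thesis using n by simp
    qed
    then show "\<exists>no. \<forall>k\<ge>no. norm (Lpnorm 2 (\<lambda>z. f k z - g z) - 0) < e" by blast
  qed
  with g2 show ?thesis by blast
qed

text \<open>Unordered convergence over finite index sets, with the same quantifiers as in
  \<open>Lrel\<close>, so that the defining series of the operator is literally an instance.\<close>

definition L2_series :: "('i \<Rightarrow> complex \<Rightarrow> complex) \<Rightarrow> ('i \<Rightarrow> complex) \<Rightarrow> (complex \<Rightarrow> complex) \<Rightarrow> bool" where
  "L2_series E c g \<longleftrightarrow> (\<forall>e>0. \<exists>F0. finite F0 \<and> (\<forall>F. finite F \<and> F0 \<subseteq> F \<longrightarrow>
      Lpnorm 2 (\<lambda>z. g z - (\<Sum>i\<in>F. c i * E i z)) < e))"

locale L2_orthonormal =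
  fixes E :: "'i \<Rightarrow> complex \<Rightarrow> complex"
  assumes E_L2: "\<And>i. Lp 2 (E i)"
    and E_orthonormal: "\<And>i j. inner_g (E i) (E j) = (if i = j then 1 else 0)"
begin

lemma sum_L2: "finite F \<Longrightarrow> Lp 2 (\<lambda>z. \<Sum>i\<in>F. c i * E i z)"
  by (intro Lp_sum Lp_cmult E_L2) auto

lemma inner_sum_E:
  assumes "finite F"
  shows "inner_g (\<lambda>z. \<Sum>i\<in>F. c i * E i z) (E j) = (if j \<in> F then c j else 0)"
proof -
  have "inner_g (\<lambda>z. \<Sum>i\<in>F. c i * E i z) (E j) = (\<Sum>i\<in>F. c i * (if i = j then 1 else 0))"
    using assms by (subst inner_g_sum_left) (auto intro: Lp_cmult E_L2 simp: inner_g_cmult_left E_orthonormal)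
  then show ?thesis using assms by (simp add: sum.delta if_distrib cong: if_cong)
qed

lemma inner_sum_right:
  assumes "finite F" "Lp 2 f"
  shows "inner_g f (\<lambda>z. \<Sum>i\<in>F. c i * E i z) = (\<Sum>i\<in>F. cnj (c i) * inner_g f (E i))"
proof -
  have "inner_g (\<lambda>z. \<Sum>i\<in>F. c i * E i z) f = (\<Sum>i\<in>F. c i * inner_g (E i) f)"
    using assms by (subst inner_g_sum_left) (auto intro: Lp_cmult E_L2 simp: inner_g_cmult_left)
  then have "cnj (inner_g (\<lambda>z. \<Sum>i\<in>F. c i * E i z) f) = (\<Sum>i\<in>F. cnj (c i) * cnj (inner_g (E i) f))"
    by simp
  then show ?thesis by (simp add: inner_g_cnj)
qed

lemma norm_sum_sq:
  assumes "finite F"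
  shows "(Lpnorm 2 (\<lambda>z. \<Sum>i\<in>F. c i * E i z))\<^sup>2 = (\<Sum>i\<in>F. (cmod (c i))\<^sup>2)"
proof -
  have "complex_of_real ((Lpnorm 2 (\<lambda>z. \<Sum>i\<in>F. c i * E i z))\<^sup>2) = (\<Sum>i\<in>F. cnj (c i) * c i)"
    unfolding inner_g_self[symmetric] using assms
    by (subst inner_sum_right) (auto simp: sum_L2 inner_sum_E)
  also have "\<dots> = complex_of_real (\<Sum>i\<in>F. (cmod (c i))\<^sup>2)"
    unfolding of_real_sum by (intro sum.cong refl) (simp only: complex_norm_square mult.commute)
  finally show ?thesis by (simp only: of_real_eq_iff)
qed

text \<open>Pairing \<open>f\<close> with its own projection \<open>S\<close> gives
  \<open>|S|^2\<close>; Cauchy-Schwarz then forces \<open>|S| \<le> |f|\<close>.\<close>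

lemma Bessel_finite:
  assumes "Lp 2 f" "finite F"
  shows "(\<Sum>i\<in>F. (cmod (inner_g f (E i)))\<^sup>2) \<le> (Lpnorm 2 f)\<^sup>2"
proof -
  let ?S = "\<lambda>z. \<Sum>i\<in>F. inner_g f (E i) * E i z"
  have S: "Lp 2 ?S" using assms(2) by (rule sum_L2)
  have fS: "inner_g f ?S = complex_of_real (\<Sum>i\<in>F. (cmod (inner_g f (E i)))\<^sup>2)"
    unfolding of_real_sum inner_sum_right[OF assms(2,1)]
    by (intro sum.cong refl) (simp only: complex_norm_square mult.commute)
  have "(\<Sum>i\<in>F. (cmod (inner_g f (E i)))\<^sup>2) = cmod (inner_g f ?S)"
    unfolding fS norm_of_real by (simp add: sum_nonneg)
  also have "\<dots> \<le> Lpnorm 2 f * Lpnorm 2 ?S" by (rule inner_g_Cauchy_Schwarz[OF assms(1) S])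
  finally have "(Lpnorm 2 ?S)\<^sup>2 \<le> Lpnorm 2 f * Lpnorm 2 ?S" by (simp add: norm_sum_sq[OF assms(2)])
  then have "Lpnorm 2 ?S \<le> Lpnorm 2 f"
    by (cases "Lpnorm 2 ?S = 0") (auto simp: power2_eq_square mult_le_cancel_right less_le)
  then have "(Lpnorm 2 ?S)\<^sup>2 \<le> (Lpnorm 2 f)\<^sup>2" by (intro power_mono) auto
  then show ?thesis by (simp add: norm_sum_sq[OF assms(2)])
qed

lemma Bessel_summable:
  assumes "Lp 2 f"
  shows "(\<lambda>i. (cmod (inner_g f (E i)))\<^sup>2) summable_on UNIV"
  by (rule nonneg_bdd_above_summable_on)
    (auto intro!: bdd_aboveI2[where M="(Lpnorm 2 f)\<^sup>2"] Bessel_finite assms)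

text \<open>Every partial sum whose index set contains \<open>i\<close> already has coefficient
  \<open>c i\<close>, and the remaining error is controlled by Cauchy-Schwarz.\<close>

lemma L2_series_coeff:
  assumes g: "Lp 2 g" and s: "L2_series E c g"
  shows "inner_g g (E i) = c i"
proof -
  have "cmod (inner_g g (E i) - c i) < e" if e: "e > 0" for e
  proof -
    obtain F0 where F0: "finite F0" "\<And>F. finite F \<Longrightarrow> F0 \<subseteq> F \<Longrightarrow> Lpnorm 2 (\<lambda>z. g z - (\<Sum>i\<in>F. c i * E i z)) < e"
      using s[unfolded L2_series_def, rule_format, OF e] by auto
    define F where "F = insert i F0"
    have F: "finite F" "i \<in> F" "F0 \<subseteq> F" using F0 by (auto simp: F_def)
    have "inner_g g (E i) - c i = inner_g (\<lambda>z. g z - (\<Sum>i\<in>F. c i * E i z)) (E i)"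
      using F by (subst inner_g_diff_left) (auto simp: inner_sum_E intro: g E_L2 sum_L2)
    also have "cmod \<dots> \<le> Lpnorm 2 (\<lambda>z. g z - (\<Sum>i\<in>F. c i * E i z)) * Lpnorm 2 (E i)"
      by (intro inner_g_Cauchy_Schwarz Lp_diff g sum_L2 F E_L2)
    also have "Lpnorm 2 (E i) = 1"
    proof -
      have "(Lpnorm 2 (E i))\<^sup>2 = 1"
        using inner_g_self[of "E i"] E_orthonormal[of i i] by (metis of_real_eq_1_iff)
      then show ?thesis using Lpnorm_nonneg[of 2 "E i"] by (simp add: power2_eq_1_iff)
    qed
    finally show ?thesis using F0(2)[OF F(1,3)] by simp
  qed
  then have "cmod (inner_g g (E i) - c i) \<le> 0" by (meson less_irrefl not_le)
  then show ?thesis by simp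
qed

lemma L2_series_exists:
  assumes "(\<lambda>i. (cmod (c i))\<^sup>2) summable_on UNIV"
  shows "\<exists>g. Lp 2 g \<and> L2_series E c g"
proof -
  let ?a = "\<lambda>i. (cmod (c i))\<^sup>2"
  define T where "T = infsum ?a UNIV"
  have T: "(?a has_sum T) UNIV" unfolding T_def using assms by simp
  have le_T: "sum ?a F \<le> T" if "finite F" for F
    unfolding T_def using assms that by (intro finite_sum_le_infsum) auto
  have "\<exists>F. finite F \<and> T - e < sum ?a F" if "e > 0" for e
  proof -
    have "eventually (\<lambda>F. dist (sum ?a F) T < e) (finite_subsets_at_top UNIV)"
      using T that unfolding has_sum_def by (rule tendstoD)
    then obtain F where "finite F" "dist (sum ?a F) T < e"
      unfolding eventually_finite_subsets_at_top by blast
    then show ?thesis by (intro exI[of _ F]) (auto simp: dist_real_def)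
  qed
  \<comment> \<open>The tolerance is squared because the tails are measured by squared norms, which
    then have norm at most \<open>(1/2)^n\<close>.\<close>
  then have "\<forall>n. \<exists>F. finite F \<and> T - ((1/2)^n)\<^sup>2 < sum ?a F" by simp
  then obtain F where F: "\<And>n. finite (F n)" "\<And>n. T - ((1/2)^n)\<^sup>2 < sum ?a (F n)" by metis
  let ?S = "\<lambda>F z. \<Sum>i\<in>F. c i * E i z"
  have near: "Lpnorm 2 (\<lambda>z. ?S G z - ?S (F n) z) \<le> (1/2)^n" if G: "finite G" "F n \<subseteq> G" for G n
  proof -
    have "(\<lambda>z. ?S G z - ?S (F n) z) = ?S (G - F n)"
      using G F(1) by (auto simp: sum_diff)
    then have "(Lpnorm 2 (\<lambda>z. ?S G z - ?S (F n) z))\<^sup>2 = sum ?a (G - F n)"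
      using norm_sum_sq[of "G - F n" c] G by simp
    also have "\<dots> = sum ?a G - sum ?a (F n)" using G F(1) by (simp add: sum_diff)
    also have "\<dots> \<le> ((1/2)^n)\<^sup>2" using le_T[OF G(1)] F(2)[of n] by simp
    finally show ?thesis by (rule power2_le_imp_le) auto
  qed
  \<comment> \<open>The sets \<open>F n\<close> need not be nested, so two of them are compared
    through their union.\<close>
  have near2: "Lpnorm 2 (\<lambda>z. ?S (F m) z - ?S (F n) z) \<le> (1/2)^m + (1/2)^n" for m n
  proof -
    have "Lpnorm 2 (\<lambda>z. ?S (F m) z - ?S (F n) z)
      \<le> Lpnorm 2 (\<lambda>z. ?S (F m) z - ?S (F m \<union> F n) z) + Lpnorm 2 (\<lambda>z. ?S (F m \<union> F n) z - ?S (F n) z)"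
      using F(1) by (intro Lpnorm_2_triangle_diff sum_L2) auto
    also have "\<dots> \<le> (1/2)^m + (1/2)^n"
      using near[of "F m \<union> F n" m] near[of "F m \<union> F n" n] F(1)
      by (simp add: Lpnorm_minus_commute[of 2 "?S (F m)"])
    finally show ?thesis .
  qed
  have "\<exists>g. Lp 2 g \<and> (\<lambda>k. Lpnorm 2 (\<lambda>z. ?S (F k) z - g z)) \<longlonglongrightarrow> 0"
  proof (rule L2_complete)
    show "Lp 2 (?S (F k))" for k using F(1) by (rule sum_L2)
    fix e :: real assume "e > 0"
    then obtain N where N: "(1/2::real)^N < e / 2" using real_arch_pow_inv[of "e/2" "1/2"] by auto
    have "Lpnorm 2 (\<lambda>z. ?S (F m) z - ?S (F n) z) < e" if "m \<ge> N" "n \<ge> N" for m n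
    proof -
      have "(1/2::real)^m \<le> (1/2)^N" "(1/2::real)^n \<le> (1/2)^N"
        using that by (auto intro!: power_decreasing)
      then show ?thesis using near2[of m n] N by linarith
    qed
    then show "\<exists>N. \<forall>m\<ge>N. \<forall>n\<ge>N. Lpnorm 2 (\<lambda>z. ?S (F m) z - ?S (F n) z) < e" by blast
  qed
  then obtain g where g: "Lp 2 g" "(\<lambda>k. Lpnorm 2 (\<lambda>z. ?S (F k) z - g z)) \<longlonglongrightarrow> 0" by blast
  have "L2_series E c g" unfolding L2_series_def
  proof (intro allI impI)
    fix e :: real assume e: "e > 0"
    then obtain N where N: "(1/2::real)^N < e / 2" using real_arch_pow_inv[of "e/2" "1/2"] by auto
    obtain M where M: "\<And>k. k \<ge> M \<Longrightarrow> Lpnorm 2 (\<lambda>z. ?S (F k) z - g z) < e / 2"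
      using LIMSEQ_D[OF g(2), of "e/2"] e by auto
    define k where "k = max M N"
    have "(1/2::real)^k \<le> (1/2)^N" by (auto intro!: power_decreasing simp: k_def)
    then have k: "(1/2::real)^k < e / 2" "Lpnorm 2 (\<lambda>z. ?S (F k) z - g z) < e / 2"
      using N M[of k] by (linarith, simp add: k_def)
    have "Lpnorm 2 (\<lambda>z. g z - ?S G z) < e" if G: "finite G" "F k \<subseteq> G" for G
    proof -
      have "Lpnorm 2 (\<lambda>z. g z - ?S G z) \<le> Lpnorm 2 (\<lambda>z. g z - ?S (F k) z) + Lpnorm 2 (\<lambda>z. ?S (F k) z - ?S G z)"
        using g F(1) G by (intro Lpnorm_2_triangle_diff sum_L2) auto
      then show ?thesis
        using near[OF G] k Lpnorm_minus_commute[of 2 g "?S (F k)"] Lpnorm_minus_commute[of 2 "?S (F k)" "?S G"]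
        by linarith
    qed
    then show "\<exists>F0. finite F0 \<and> (\<forall>F. finite F \<and> F0 \<subseteq> F \<longrightarrow> Lpnorm 2 (\<lambda>z. g z - ?S F z) < e)"
      using F(1)[of k] by blast
  qed
  with g(1) show ?thesis by blast
qed

end

locale L2_basis = L2_orthonormal +
  assumes E_complete: "\<And>f. Lp 2 f \<Longrightarrow> (\<And>i. inner_g f (E i) = 0) \<Longrightarrow> ae_eq f (\<lambda>_. 0)"
begin

lemma coeff_eq_imp_ae_eq:
  assumes "Lp 2 f" "Lp 2 g" "\<And>i. inner_g f (E i) = inner_g g (E i)"
  shows "ae_eq f g"
proof -
  have "ae_eq (\<lambda>z. f z - g z) (\<lambda>_. 0)"
    using assms by (intro E_complete Lp_diff) (auto simp: inner_g_diff_left E_L2)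
  then show ?thesis by (simp add: ae_eq_def)
qed

text \<open>Bessel makes the series converge to some \<open>g\<close>; \<open>g\<close> has the
  coefficients of \<open>f\<close>, so completeness identifies the two a.e.\<close>

lemma L2_series_of_coeff:
  assumes f: "Lp 2 f" and c: "\<And>i. inner_g f (E i) = c i"
  shows "L2_series E c f"
proof -
  have "(\<lambda>i. (cmod (c i))\<^sup>2) summable_on UNIV" using Bessel_summable[OF f] by (simp add: c)
  then obtain g where g: "Lp 2 g" "L2_series E c g" using L2_series_exists by blast
  have ae: "ae_eq g f" by (rule coeff_eq_imp_ae_eq) (use g f c L2_series_coeff in auto)
  have eq: "Lpnorm 2 (\<lambda>z. g z - (\<Sum>i\<in>F. c i * E i z)) = Lpnorm 2 (\<lambda>z. f z - (\<Sum>i\<in>F. c i * E i z))"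
    if F: "finite F" for F
  proof (rule Lpnorm_cong_AE)
    show "ae_eq (\<lambda>z. g z - (\<Sum>i\<in>F. c i * E i z)) (\<lambda>z. f z - (\<Sum>i\<in>F. c i * E i z))"
      using ae by (auto simp: ae_eq_def elim: eventually_mono)
  qed (intro Lp_measurable[of 2] Lp_diff sum_L2 F f g(1))+
  show ?thesis unfolding L2_series_def
  proof (intro allI impI)
    fix e :: real assume "e > 0"
    from g(2)[unfolded L2_series_def, rule_format, OF this] obtain F0 where
      "finite F0" "\<forall>F. finite F \<and> F0 \<subseteq> F \<longrightarrow> Lpnorm 2 (\<lambda>z. g z - (\<Sum>i\<in>F. c i * E i z)) < e" by blast
    then show "\<exists>F0. finite F0 \<and> (\<forall>F. finite F \<and> F0 \<subseteq> F \<longrightarrow> Lpnorm 2 (\<lambda>z. f z - (\<Sum>i\<in>F. c i * E i z)) < e)"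
      by (intro exI[of _ F0]) (simp add: eq)
  qed
qed

text \<open>Parseval's identity as an unordered sum. The adjoint is computed from it term by
  term.\<close>

lemma has_sum_inner:
  assumes f: "Lp 2 f" and g: "Lp 2 g"
  shows "((\<lambda>i. inner_g f (E i) * cnj (inner_g g (E i))) has_sum inner_g f g) UNIV"
  unfolding has_sum_def
proof (rule tendstoI)
  fix e :: real assume e: "e > 0"
  define c where "c i = inner_g f (E i)" for i
  \<comment> \<open>The summand 1 covers the case in which \<open>g\<close> has norm 0.\<close>
  define d where "d = e / (Lpnorm 2 g + 1)"
  have pos: "Lpnorm 2 g + 1 > 0" using Lpnorm_nonneg[of 2 g] by linarith
  have d: "d > 0" using e pos by (simp add: d_def)
  have ser: "L2_series E c f" by (rule L2_series_of_coeff) (use f c_def in auto)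
  obtain F0 where F0: "finite F0"
    "\<And>F. finite F \<Longrightarrow> F0 \<subseteq> F \<Longrightarrow> Lpnorm 2 (\<lambda>z. f z - (\<Sum>i\<in>F. c i * E i z)) < d"
    using ser[unfolded L2_series_def, rule_format, OF d] by auto
  have "dist (\<Sum>i\<in>F. inner_g f (E i) * cnj (inner_g g (E i))) (inner_g f g) < e" if F: "finite F" "F0 \<subseteq> F" for F
  proof -
    have S: "Lp 2 (\<lambda>z. \<Sum>i\<in>F. c i * E i z)" by (rule sum_L2[OF F(1)])
    have "inner_g (\<lambda>z. \<Sum>i\<in>F. c i * E i z) g = cnj (inner_g g (\<lambda>z. \<Sum>i\<in>F. c i * E i z))"
      by (simp add: inner_g_cnj)
    also have "\<dots> = (\<Sum>i\<in>F. c i * cnj (inner_g g (E i)))"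
      by (simp add: inner_sum_right[OF F(1) g])
    finally have "inner_g f g - (\<Sum>i\<in>F. inner_g f (E i) * cnj (inner_g g (E i)))
        = inner_g (\<lambda>z. f z - (\<Sum>i\<in>F. c i * E i z)) g"
      by (subst inner_g_diff_left[OF f S g]) (simp add: c_def)
    then have "dist (\<Sum>i\<in>F. inner_g f (E i) * cnj (inner_g g (E i))) (inner_g f g)
        = cmod (inner_g (\<lambda>z. f z - (\<Sum>i\<in>F. c i * E i z)) g)"
      unfolding dist_norm by (simp only: norm_minus_commute)
    also have "\<dots> \<le> Lpnorm 2 (\<lambda>z. f z - (\<Sum>i\<in>F. c i * E i z)) * Lpnorm 2 g"
      by (intro inner_g_Cauchy_Schwarz Lp_diff f g S)
    also have "\<dots> \<le> d * Lpnorm 2 g"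
      using F0(2)[OF F] by (intro mult_right_mono) auto
    also have "\<dots> < d * (Lpnorm 2 g + 1)" using d by simp
    also have "\<dots> = e" using pos by (simp add: d_def)
    finally show ?thesis .
  qed
  then show "eventually (\<lambda>F. dist (\<Sum>i\<in>F. inner_g f (E i) * cnj (inner_g g (E i))) (inner_g f g) < e)
     (finite_subsets_at_top UNIV)"
    unfolding eventually_finite_subsets_at_top using F0(1) by (intro exI[of _ F0]) auto
qed

end

section \<open>Directional derivatives and integration by parts\<close>

text \<open>The relational form asserts existence of the derivative at every point, whereas
  \<open>dd\<close> below only names a value; \<open>hasd_imp_dd\<close> links the two.\<close>

definition hasd :: "complex \<Rightarrow> (complex \<Rightarrow> complex) \<Rightarrow> (complex \<Rightarrow> complex) \<Rightarrow> bool" where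
  "hasd c u u' \<longleftrightarrow> (\<forall>z. ((\<lambda>t::real. u (z + of_real t * c)) has_vector_derivative u' z) (at 0))"

definition dd :: "complex \<Rightarrow> (complex \<Rightarrow> complex) \<Rightarrow> complex \<Rightarrow> complex" where
  "dd c u z = vector_derivative (\<lambda>t::real. u (z + of_real t * c)) (at 0)"

lemma hasd_imp_dd: "hasd c u u' \<Longrightarrow> dd c u = u'"
  unfolding hasd_def dd_def by (auto intro: vector_derivative_at)

lemma hasd_cong: "hasd c u u' \<Longrightarrow> (\<And>z. u' z = u'' z) \<Longrightarrow> hasd c u u''"
  by (simp add: hasd_def)

text \<open>The condition at parameter 0 holds at every base point, so moving the base point along
  the line gives the derivative at every parameter.\<close>

lemma hasd_line:
  assumes "hasd c u u'"
  shows "((\<lambda>t::real. u (z + of_real t * c)) has_vector_derivative u' (z + of_real s * c)) (at s)"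
proof -
  have "((\<lambda>t::real. u ((z + of_real s * c) + of_real t * c)) has_vector_derivative u' (z + of_real s * c)) (at (s - s))"
    using assms by (simp add: hasd_def)
  moreover have "((\<lambda>t. t - s) has_vector_derivative 1) (at s)"
    by (auto intro!: derivative_eq_intros)
  ultimately have "((\<lambda>t::real. u ((z + of_real s * c) + of_real t * c)) \<circ> (\<lambda>t. t - s) has_vector_derivative 1 *\<^sub>R u' (z + of_real s * c)) (at s)"
    by (intro vector_diff_chain_at)
  then show ?thesis by (simp add: o_def algebra_simps)
qed

lemma hasd_const: "hasd c (\<lambda>_. a) (\<lambda>_. 0)"
  by (auto simp: hasd_def)

lemma hasd_id: "hasd c (\<lambda>z. z) (\<lambda>_. c)"
  unfolding hasd_def by (auto intro!: derivative_eq_intros)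

lemma hasd_of_real_linear:
  assumes "linear l"
  shows "hasd c (\<lambda>z. complex_of_real (l z)) (\<lambda>_. complex_of_real (l c))"
proof -
  have "l (z + of_real t * c) = l z + t * l c" for z t
    using linear_add[OF assms, of z "t *\<^sub>R c"] linear_scale[OF assms, of t c] by (simp add: scaleR_conv_of_real)
  then show ?thesis unfolding hasd_def
    by (auto intro!: derivative_eq_intros)
qed

lemma hasd_Re: "hasd c (\<lambda>z. complex_of_real (Re z)) (\<lambda>_. complex_of_real (Re c))"
  by (rule hasd_of_real_linear) (auto simp: linear_iff)

lemma hasd_Im: "hasd c (\<lambda>z. complex_of_real (Im z)) (\<lambda>_. complex_of_real (Im c))"
  by (rule hasd_of_real_linear) (auto simp: linear_iff)

lemma hasd_cnj: "hasd c u u' \<Longrightarrow> hasd c (\<lambda>z. cnj (u z)) (\<lambda>z. cnj (u' z))"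
  unfolding hasd_def by (auto intro: has_vector_derivative_cnj)

lemma hasd_add: "hasd c u u' \<Longrightarrow> hasd c w w' \<Longrightarrow> hasd c (\<lambda>z. u z + w z) (\<lambda>z. u' z + w' z)"
  unfolding hasd_def by (auto intro!: derivative_intros)

lemma hasd_diff: "hasd c u u' \<Longrightarrow> hasd c w w' \<Longrightarrow> hasd c (\<lambda>z. u z - w z) (\<lambda>z. u' z - w' z)"
  unfolding hasd_def by (auto intro!: derivative_intros)

lemma hasd_mult: "hasd c u u' \<Longrightarrow> hasd c w w' \<Longrightarrow> hasd c (\<lambda>z. u z * w z) (\<lambda>z. u' z * w z + u z * w' z)"
  unfolding hasd_def
proof (intro allI)
  fix z assume "\<forall>z. ((\<lambda>t. u (z + of_real t * c)) has_vector_derivative u' z) (at 0)"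
    "\<forall>z. ((\<lambda>t. w (z + of_real t * c)) has_vector_derivative w' z) (at 0)"
  then have "((\<lambda>t. u (z + of_real t * c)) has_vector_derivative u' z) (at 0)"
    "((\<lambda>t. w (z + of_real t * c)) has_vector_derivative w' z) (at 0)" by auto
  from has_vector_derivative_mult[OF this]
  show "((\<lambda>t. u (z + of_real t * c) * w (z + of_real t * c)) has_vector_derivative u' z * w z + u z * w' z) (at 0)"
    by (simp add: add.commute)
qed

lemma hasd_cmult: "hasd c u u' \<Longrightarrow> hasd c (\<lambda>z. a * u z) (\<lambda>z. a * u' z)"
  unfolding hasd_def by (auto intro!: has_vector_derivative_mult_right)

lemma hasd_sum: "finite A \<Longrightarrow> (\<And>i. i \<in> A \<Longrightarrow> hasd c (u i) (u' i)) \<Longrightarrow> hasd c (\<lambda>z. \<Sum>i\<in>A. u i z) (\<lambda>z. \<Sum>i\<in>A. u' i z)"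
  by (induct A rule: finite_induct) (auto intro: hasd_const hasd_add)

lemma cmod_line_sq: "(cmod (z + of_real t * c))\<^sup>2 = (cmod z)\<^sup>2 + 2 * t * Re (z * cnj c) + t\<^sup>2 * (cmod c)\<^sup>2"
  unfolding cmod_power2 by (simp add: power2_eq_square algebra_simps)

lemma hasd_gaussian:
  "hasd c (\<lambda>z. complex_of_real (exp (- (e * (cmod z)\<^sup>2))))
    (\<lambda>z. complex_of_real (- 2 * e * Re (z * cnj c)) * complex_of_real (exp (- (e * (cmod z)\<^sup>2))))"
proof -
  have "((\<lambda>t. complex_of_real (exp (- (e * (cmod (z + of_real t * c))\<^sup>2)))) has_vector_derivative
      complex_of_real (- 2 * e * Re (z * cnj c) * exp (- (e * (cmod z)\<^sup>2)))) (at 0)" for z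
    unfolding cmod_line_sq
    by (rule has_vector_derivative_of_real) (auto intro!: derivative_eq_intros simp: algebra_simps)
  then show ?thesis unfolding hasd_def by simp
qed

text \<open>The one-variable counterpart of \<open>slowly_increasing\<close>. Integer powers of
  \<open>1 + |z|\<close> make closure under sums and products immediate.\<close>

definition slow :: "(complex \<Rightarrow> complex) \<Rightarrow> bool" where
  "slow f \<longleftrightarrow> continuous_on UNIV f \<and> (\<exists>C k. \<forall>z. cmod (f z) \<le> C * (1 + cmod z) ^ k)"

lemma slowI: "continuous_on UNIV f \<Longrightarrow> (\<And>z. cmod (f z) \<le> C * (1 + cmod z) ^ k) \<Longrightarrow> slow f"
  unfolding slow_def by blast

lemma slowE:
  assumes "slow f"
  obtains C k where "C > 0" "\<And>z. cmod (f z) \<le> C * (1 + cmod z) ^ k"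
proof -
  obtain C k where C: "\<And>z. cmod (f z) \<le> C * (1 + cmod z) ^ k" using assms unfolding slow_def by blast
  have "cmod (f z) \<le> (\<bar>C\<bar> + 1) * (1 + cmod z) ^ k" for z
    by (rule order_trans[OF C mult_right_mono]) auto
  then show ?thesis using that[of "\<bar>C\<bar> + 1" k] by force
qed

lemma slow_measurable: "slow f \<Longrightarrow> f \<in> borel_measurable borel"
  by (simp add: slow_def borel_measurable_continuous_onI)

lemma slow_const: "slow (\<lambda>_. a)"
  by (rule slowI[of _ "cmod a" 0]) auto

lemma slow_id: "slow (\<lambda>z. z)"
  by (rule slowI[of _ 1 1]) auto

lemma slow_cnj: "slow f \<Longrightarrow> slow (\<lambda>z. cnj (f z))"
  by (auto simp: slow_def intro: continuous_intros)

lemma slow_add: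
  assumes "slow f" "slow g" shows "slow (\<lambda>z. f z + g z)"
proof -
  obtain C k where C: "C > 0" "\<And>z. cmod (f z) \<le> C * (1 + cmod z) ^ k" using slowE[OF assms(1)] by blast
  obtain D l where D: "D > 0" "\<And>z. cmod (g z) \<le> D * (1 + cmod z) ^ l" using slowE[OF assms(2)] by blast
  show ?thesis
  proof (rule slowI[where C="C + D" and k="max k l"])
    show "continuous_on UNIV (\<lambda>z. f z + g z)" using assms by (auto simp: slow_def intro: continuous_intros)
    fix z
    have "cmod (f z + g z) \<le> C * (1 + cmod z) ^ k + D * (1 + cmod z) ^ l"
      by (rule order_trans[OF norm_triangle_ineq add_mono[OF C(2) D(2)]])
    also have "\<dots> \<le> C * (1 + cmod z) ^ max k l + D * (1 + cmod z) ^ max k l"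
      using C(1) D(1) by (intro add_mono mult_left_mono power_increasing) auto
    finally show "cmod (f z + g z) \<le> (C + D) * (1 + cmod z) ^ max k l" by (simp add: algebra_simps)
  qed
qed

lemma slow_mult:
  assumes "slow f" "slow g" shows "slow (\<lambda>z. f z * g z)"
proof -
  obtain C k where C: "C > 0" "\<And>z. cmod (f z) \<le> C * (1 + cmod z) ^ k" using slowE[OF assms(1)] by blast
  obtain D l where D: "D > 0" "\<And>z. cmod (g z) \<le> D * (1 + cmod z) ^ l" using slowE[OF assms(2)] by blast
  show ?thesis
  proof (rule slowI[where C="C * D" and k="k + l"])
    show "continuous_on UNIV (\<lambda>z. f z * g z)" using assms by (auto simp: slow_def intro: continuous_intros)
    fix z
    have "cmod (f z * g z) \<le> (C * (1 + cmod z) ^ k) * (D * (1 + cmod z) ^ l)"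
      unfolding norm_mult by (rule mult_mono[OF C(2) D(2)]) (use C in auto)
    then show "cmod (f z * g z) \<le> (C * D) * (1 + cmod z) ^ (k + l)" by (simp add: power_add algebra_simps)
  qed
qed

lemma slow_cmult: "slow f \<Longrightarrow> slow (\<lambda>z. a * f z)"
  by (intro slow_mult slow_const)

lemma slow_diff: "slow f \<Longrightarrow> slow g \<Longrightarrow> slow (\<lambda>z. f z - g z)"
  using slow_add[of f "\<lambda>z. (-1) * g z"] slow_cmult[of g "-1"] by simp

lemma slow_sum: "finite A \<Longrightarrow> (\<And>i. i \<in> A \<Longrightarrow> slow (f i)) \<Longrightarrow> slow (\<lambda>z. \<Sum>i\<in>A. f i z)"
  by (induct A rule: finite_induct) (auto intro: slow_const slow_add)

lemma slow_power: "slow f \<Longrightarrow> slow (\<lambda>z. f z ^ n)"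
  by (induct n) (auto intro: slow_const slow_mult)

lemma slow_of_real_norm: "slow f \<Longrightarrow> slow (\<lambda>z. complex_of_real (cmod (f z)))"
  by (auto simp: slow_def intro: continuous_intros)

lemma slow_Re_cnj: "slow (\<lambda>z. complex_of_real (Re (z * cnj c)))"
proof (rule slowI[of _ "cmod c" 1])
  show "cmod (complex_of_real (Re (z * cnj c))) \<le> cmod c * (1 + cmod z) ^ 1" for z
    using abs_Re_le_cmod[of "z * cnj c"] unfolding norm_of_real norm_mult
    by (simp add: algebra_simps add_increasing)
qed (intro continuous_intros)

lemma slow_Re: "slow (\<lambda>z. complex_of_real (Re z))"
  using slow_Re_cnj[of 1] by simp

lemma slow_Im: "slow (\<lambda>z. complex_of_real (Im z))"
  using slow_Re_cnj[of \<i>] by simp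

lemma slow_bounded: "continuous_on UNIV f \<Longrightarrow> (\<And>z. cmod (f z) \<le> C) \<Longrightarrow> slow f"
  by (rule slowI[of f C 0]) auto

lemma poly_le_exp_square:
  assumes "a > (0::real)"
  shows "\<exists>K>0. \<forall>x\<ge>0. (1 + x) ^ k \<le> K * exp (a * x\<^sup>2)"
proof (intro exI[of _ "fact k * exp (1 + 1 / (4 * a))"] conjI allI impI)
  fix x :: real assume x: "x \<ge> 0"
  have "(1 + x) ^ k / fact k \<le> exp (1 + x)"
  proof -
    have "(\<Sum>n\<in>{k}. (1 + x) ^ n /\<^sub>R fact n) \<le> (\<Sum>n. (1 + x) ^ n /\<^sub>R fact n)"
      by (rule sum_le_suminf[OF summable_exp_generic]) (use x in auto)
    then show ?thesis by (simp add: exp_def divide_inverse_commute)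
  qed
  then have "(1 + x) ^ k \<le> fact k * exp (1 + x)" by (simp add: field_simps)
  \<comment> \<open>Completing the square trades the linear exponent for a quadratic one with
    arbitrarily small factor \<open>a\<close>.\<close>
  also have "x \<le> 1 / (4 * a) + a * x\<^sup>2"
  proof -
    have "0 \<le> (2 * a * x - 1)\<^sup>2 / (4 * a)" using assms by simp
    also have "\<dots> = 1 / (4 * a) + a * x\<^sup>2 - x" using assms by (simp add: field_simps power2_eq_square)
    finally show ?thesis by simp
  qed
  then have "fact k * exp (1 + x) \<le> fact k * exp (1 + 1 / (4 * a) + a * x\<^sup>2)" by simp
  finally show "(1 + x) ^ k \<le> fact k * exp (1 + 1 / (4 * a)) * exp (a * x\<^sup>2)"
    by (simp add: exp_add mult.assoc)
qed simp

text \<open>Half of the Gaussian exponent absorbs the polynomial growth; the other half remains as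
  an integrable majorant.\<close>

lemma slow_gden_bound:
  assumes "slow f"
  shows "\<exists>K. \<forall>z. cmod (gden z *\<^sub>R f z) \<le> K * exp (- (1/4 * (cmod z)\<^sup>2))"
proof -
  obtain C k where C: "C > 0" "\<And>z. cmod (f z) \<le> C * (1 + cmod z) ^ k" using slowE[OF assms] by blast
  obtain K :: real where K: "K > 0" "\<And>x. x \<ge> 0 \<Longrightarrow> (1 + x) ^ k \<le> K * exp (1/4 * x\<^sup>2)"
    using poly_le_exp_square[of "1/4" k] by (metis divide_pos_pos zero_less_numeral zero_less_one)
  have "cmod (gden z *\<^sub>R f z) \<le> (1 / (2 * pi) * C * K) * exp (- (1/4 * (cmod z)\<^sup>2))" for z
  proof -
    have "cmod (gden z *\<^sub>R f z) = gden z * cmod (f z)" by simp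
    also have "\<dots> \<le> gden z * (C * (K * exp (1/4 * (cmod z)\<^sup>2)))"
      by (intro mult_left_mono order_trans[OF C(2)] K) (use C in auto)
    also have "\<dots> = (1 / (2 * pi) * C * K) * (exp (- (cmod z)\<^sup>2 / 2) * exp (1/4 * (cmod z)\<^sup>2))"
      by (simp add: gden_def)
    also have "exp (- (cmod z)\<^sup>2 / 2) * exp (1/4 * (cmod z)\<^sup>2) = exp (- (1/4 * (cmod z)\<^sup>2))"
      unfolding exp_add[symmetric] by simp
    finally show ?thesis .
  qed
  then show ?thesis by blast
qed

lemma slow_integrable:
  assumes "slow f" shows "integrable gauss f"
proof -
  note [measurable] = slow_measurable[OF assms]
  obtain K where K: "\<And>z. cmod (gden z *\<^sub>R f z) \<le> K * exp (- (1/4 * (cmod z)\<^sup>2))"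
    using slow_gden_bound[OF assms] by blast
  have "integrable lborel (\<lambda>z. gden z *\<^sub>R f z)"
  proof (rule Bochner_Integration.integrable_bound)
    show "integrable lborel (\<lambda>z::complex. K * exp (- (1/4 * (cmod z)\<^sup>2)))"
      by (intro integrable_mult_right integrable_gaussian_complex) auto
    show "AE z in lborel. norm (gden z *\<^sub>R f z) \<le> norm (K * exp (- (1/4 * (cmod z)\<^sup>2)))"
      by (rule AE_I2) (use K order_trans abs_ge_self in \<open>fastforce simp del: norm_scaleR\<close>)
  qed measurable
  then show ?thesis by (subst integrable_gauss_iff) auto
qed

lemma slow_Lp:
  assumes "slow f" shows "Lp p f"
proof -
  have "integrable gauss (\<lambda>z. cmod (f z ^ p))"
    by (intro integrable_norm slow_integrable slow_power assms)
  then show ?thesis using slow_measurable[OF assms] by (simp add: Lp_iff norm_power)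
qed

section \<open>Integration by parts for the Gaussian measure\<close>

lemma has_vector_derivative_quotient:
  fixes f :: "real \<Rightarrow> 'a::real_normed_vector"
  assumes "(f has_vector_derivative D) (at 0)"
  shows "((\<lambda>t. (f t - f 0) /\<^sub>R t) \<longlongrightarrow> D) (at 0)"
proof -
  have "((\<lambda>h. norm (f h - f 0 - h *\<^sub>R D) / norm h) \<longlongrightarrow> 0) (at 0)"
    using assms by (simp add: has_vector_derivative_def has_derivative_at)
  moreover have "norm (f h - f 0 - h *\<^sub>R D) / norm h = norm ((f h - f 0) /\<^sub>R h - D)" if "h \<noteq> 0" for h
  proof -
    have "(f h - f 0) /\<^sub>R h - D = (f h - f 0 - h *\<^sub>R D) /\<^sub>R h"
      using that by (simp add: scaleR_right_diff_distrib)
    then show ?thesis by (simp add: divide_inverse_commute)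
  qed
  ultimately have "((\<lambda>h. norm ((f h - f 0) /\<^sub>R h - D)) \<longlongrightarrow> 0) (at 0)"
    by (elim Lim_transform_eventually) (auto simp: eventually_at_filter)
  then show ?thesis by (rule LIM_zero_cancel[OF tendsto_norm_zero_cancel])
qed

text \<open>Translation invariance makes the integral of every difference quotient vanish.\<close>
lemma integral_directional_derivative_eq_0:
  assumes v: "hasd c v v'" and c: "cmod c = 1" and a: "a > 0"
    and [measurable]: "v \<in> borel_measurable borel" "v' \<in> borel_measurable borel"
    and b: "\<And>z. cmod (v z) \<le> K * exp (- (a * (cmod z)\<^sup>2))" and b': "\<And>z. cmod (v' z) \<le> K * exp (- (a * (cmod z)\<^sup>2))"
  shows "(\<integral>z. v' z \<partial>lborel) = 0"
proof -
  have int: "integrable lborel v"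
  proof (rule Bochner_Integration.integrable_bound)
    show "integrable lborel (\<lambda>z::complex. K * exp (- (a * (cmod z)\<^sup>2)))"
      by (intro integrable_mult_right integrable_gaussian_complex a)
    show "AE z in lborel. norm (v z) \<le> norm (K * exp (- (a * (cmod z)\<^sup>2)))"
      by (rule AE_I2) (use b order_trans abs_ge_self in fastforce)
  qed simp
  \<comment> \<open>Steps of size at most 1, so that all shifted Gaussian bounds share one
    majorant.\<close>
  define h where "h n = 1 / real (Suc n)" for n
  have h: "0 < h n" "h n \<le> 1" for n by (auto simp: h_def)
  have h0: "h \<longlonglongrightarrow> 0" unfolding h_def by (rule lim_1_over_n[THEN LIMSEQ_Suc])
  define q where "q n z = (v (z + of_real (h n) * c) - v z) /\<^sub>R h n" for n z
  have K: "K \<ge> 0" using order_trans[OF norm_ge_zero b[of 0]] by simp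
  have shift: "integrable lborel (\<lambda>z. v (z + s))" "(\<integral>z. v (z + s) \<partial>lborel) = (\<integral>z. v z \<partial>lborel)" for s
  proof -
    have "integrable (distr lborel borel ((+) s)) v" using int by (simp add: lborel_distr_plus)
    then show "integrable lborel (\<lambda>z. v (z + s))"
      by (subst (asm) integrable_distr_eq) (auto simp: add.commute)
    have "(\<integral>z. v z \<partial>lborel) = (\<integral>z. v z \<partial>(distr lborel borel ((+) s)))" by (simp add: lborel_distr_plus)
    also have "\<dots> = (\<integral>z. v (z + s) \<partial>lborel)" by (subst integral_distr) (auto simp: add.commute)
    finally show "(\<integral>z. v (z + s) \<partial>lborel) = (\<integral>z. v z \<partial>lborel)" by simp
  qed
  have q0: "(\<integral>z. q n z \<partial>lborel) = 0" for n
    unfolding q_def using int shift by (subst integral_scaleR_right) simp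
  have "(\<lambda>n. \<integral>z. q n z \<partial>lborel) \<longlonglongrightarrow> (\<integral>z. v' z \<partial>lborel)"
  proof (rule integral_dominated_convergence)
    show "integrable lborel (\<lambda>z::complex. K * exp a * exp (- (a / 2 * (cmod z)\<^sup>2)))"
      using a by (intro integrable_mult_right integrable_gaussian_complex) auto
    show "q n \<in> borel_measurable lborel" for n unfolding q_def by measurable
    show "AE z in lborel. (\<lambda>n. q n z) \<longlonglongrightarrow> v' z"
    proof (rule AE_I2)
      fix z
      have "((\<lambda>t. (v (z + of_real t * c) - v z) /\<^sub>R t) \<longlongrightarrow> v' z) (at 0)"
        using has_vector_derivative_quotient[of "\<lambda>t. v (z + of_real t * c)" "v' z"] v by (simp add: hasd_def)
      then show "(\<lambda>n. q n z) \<longlonglongrightarrow> v' z"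
        unfolding q_def
        by (rule filterlim_compose) (use h0 h in \<open>auto simp: filterlim_at less_imp_neq[symmetric] intro!: always_eventually\<close>)
    qed
    show "AE z in lborel. norm (q n z) \<le> K * exp a * exp (- (a / 2 * (cmod z)\<^sup>2))" for n
    proof (rule AE_I2)
      fix z
      have der: "((\<lambda>t. v (z + of_real t * c)) has_vector_derivative v' (z + of_real s * c)) (at s)" for s
        by (rule hasd_line[OF v])
      have "continuous_on {0..h n} (\<lambda>t. v (z + of_real t * c))"
        using der by (meson continuous_at_imp_continuous_on has_vector_derivative_continuous)
      then obtain s where s: "0 < s" "s < h n"
        "cmod (v (z + of_real (h n) * c) - v z) \<le> cmod ((h n - 0) *\<^sub>R v' (z + of_real s * c))"
        using mvt_general[of 0 "h n" "\<lambda>t. v (z + of_real t * c)" "\<lambda>s x. x *\<^sub>R v' (z + of_real s * c)"]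
          der h[of n] unfolding has_vector_derivative_def by auto
      have "norm (q n z) = inverse (h n) * cmod (v (z + of_real (h n) * c) - v z)"
        using h[of n] by (simp add: q_def)
      also have "\<dots> \<le> inverse (h n) * (h n * cmod (v' (z + of_real s * c)))"
        using s h[of n] by (intro mult_left_mono) auto
      also have "\<dots> = cmod (v' (z + of_real s * c))" using h[of n] by simp
      also have "\<dots> \<le> K * exp (- (a * (cmod (z + of_real s * c))\<^sup>2))" by (rule b')
      \<comment> \<open>A shift of length at most 1 gives
        \<open>|z|^2 \<le> 2 |z + s c|^2 + 2\<close>: the decay rate is halved and a constant factor
        is lost.\<close>
      also have "\<dots> \<le> K * exp (a - (a / 2 * (cmod z)\<^sup>2))"
      proof (intro mult_left_mono K iffD2[OF exp_le_cancel_iff])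
        have "cmod z \<le> cmod (z + of_real s * c) + cmod (of_real s * c)"
          using norm_triangle_ineq4[of "z + of_real s * c" "of_real s * c"] by simp
        also have "cmod (of_real s * c) \<le> 1" using c s h(2)[of n] by (simp add: norm_mult)
        finally have "(cmod z)\<^sup>2 \<le> (cmod (z + of_real s * c) + 1)\<^sup>2" by (intro power_mono) auto
        also have "\<dots> \<le> 2 * (cmod (z + of_real s * c))\<^sup>2 + 2"
          using sum_squares_bound[of "cmod (z + of_real s * c)" 1] by (simp add: power2_sum)
        finally have "a * (cmod z)\<^sup>2 \<le> a * (2 * (cmod (z + of_real s * c))\<^sup>2 + 2)" using a by (intro mult_left_mono) auto
        then show "- (a * (cmod (z + of_real s * c))\<^sup>2) \<le> a - a / 2 * (cmod z)\<^sup>2" by (simp add: algebra_simps)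
      qed
      also have "\<dots> = K * exp a * exp (- (a / 2 * (cmod z)\<^sup>2))"
        by (simp only: exp_diff exp_minus divide_inverse mult.assoc)
      finally show "norm (q n z) \<le> K * exp a * exp (- (a / 2 * (cmod z)\<^sup>2))" .
    qed
  qed measurable
  then show ?thesis by (simp add: q0 LIMSEQ_const_iff)
qed

text \<open>The derivative of density times \<open>u\<close> is the density times \<open>u'\<close>
  minus the coordinate along \<open>c\<close> times \<open>u\<close>; its Lebesgue integral
  vanishes.\<close>

lemma gauss_integration_by_parts:
  assumes u: "hasd c u u'" and c: "cmod c = 1" and s: "slow u" "slow u'"
  shows "(\<integral>z. u' z \<partial>gauss) = (\<integral>z. complex_of_real (Re (z * cnj c)) * u z \<partial>gauss)"
proof -
  note sx = slow_Re_cnj[of c]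
  define w where "w z = u' z - complex_of_real (Re (z * cnj c)) * u z" for z
  have w: "slow w" unfolding w_def by (intro slow_diff slow_mult sx s)
  have "hasd c (\<lambda>z. gden z *\<^sub>R u z) (\<lambda>z. gden z *\<^sub>R w z)"
  proof -
    have "hasd c (\<lambda>z. complex_of_real (1 / (2 * pi)) * (complex_of_real (exp (- (1/2 * (cmod z)\<^sup>2))) * u z))
       (\<lambda>z. complex_of_real (1 / (2 * pi)) * (complex_of_real (- 2 * (1/2) * Re (z * cnj c)) * complex_of_real (exp (- (1/2 * (cmod z)\<^sup>2))) * u z
         + complex_of_real (exp (- (1/2 * (cmod z)\<^sup>2))) * u' z))"
      by (intro hasd_cmult hasd_mult hasd_gaussian u)
    then show ?thesis by (simp add: gden_def w_def scaleR_conv_of_real algebra_simps)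
  qed
  moreover obtain K1 where "\<And>z. cmod (gden z *\<^sub>R u z) \<le> K1 * exp (- (1/4 * (cmod z)\<^sup>2))"
    using slow_gden_bound[OF s(1)] by blast
  \<comment> \<open>Stated for every \<open>K2\<close>, because the second constant is obtained only
    afterwards and both bounds have to share their maximum.\<close>
  then have "cmod (gden z *\<^sub>R u z) \<le> max K1 K2 * exp (- (1/4 * (cmod z)\<^sup>2))" for z K2
    by (rule order_trans) (auto intro: mult_right_mono)
  moreover obtain K2 where "\<And>z. cmod (gden z *\<^sub>R w z) \<le> K2 * exp (- (1/4 * (cmod z)\<^sup>2))"
    using slow_gden_bound[OF w] by blast
  then have "cmod (gden z *\<^sub>R w z) \<le> max K1 K2 * exp (- (1/4 * (cmod z)\<^sup>2))" for z
    by (rule order_trans) (auto intro: mult_right_mono)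
  moreover note [measurable] = slow_measurable[OF s(1)] slow_measurable[OF w]
  ultimately have "(\<integral>z. gden z *\<^sub>R w z \<partial>lborel) = 0"
    by (intro integral_directional_derivative_eq_0[where a="1/4" and K="max K1 K2", OF _ c]) auto
  then have "(\<integral>z. w z \<partial>gauss) = 0" by (subst integral_gauss_eq) auto
  then show ?thesis unfolding w_def using s sx
    by (subst (asm) Bochner_Integration.integral_diff) (auto intro!: slow_integrable slow_mult)
qed

section \<open>Polynomials and complex Hermite polynomials\<close>

text \<open>Polynomials in \<open>z\<close> and its conjugate, given by closure rules instead of
  coefficients, so that every closure property is a rule induction.\<close>

inductive zpoly :: "(complex \<Rightarrow> complex) \<Rightarrow> bool" where
  zpoly_const: "zpoly (\<lambda>_. a)"
| zpoly_id: "zpoly (\<lambda>z. z)"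
| zpoly_cnj_id: "zpoly (\<lambda>z. cnj z)"
| zpoly_add: "zpoly f \<Longrightarrow> zpoly g \<Longrightarrow> zpoly (\<lambda>z. f z + g z)"
| zpoly_mult: "zpoly f \<Longrightarrow> zpoly g \<Longrightarrow> zpoly (\<lambda>z. f z * g z)"

lemma zpoly_cmult: "zpoly f \<Longrightarrow> zpoly (\<lambda>z. a * f z)"
  by (intro zpoly_mult zpoly_const)

lemma zpoly_diff: "zpoly f \<Longrightarrow> zpoly g \<Longrightarrow> zpoly (\<lambda>z. f z - g z)"
  using zpoly_add[of f "\<lambda>z. (-1) * g z"] zpoly_cmult[of g "-1"] by simp

lemma zpoly_sum: "finite A \<Longrightarrow> (\<And>i. i \<in> A \<Longrightarrow> zpoly (f i)) \<Longrightarrow> zpoly (\<lambda>z. \<Sum>i\<in>A. f i z)"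
  by (induct A rule: finite_induct) (auto intro: zpoly_const zpoly_add)

lemma zpoly_power: "zpoly f \<Longrightarrow> zpoly (\<lambda>z. f z ^ n)"
  by (induct n) (auto intro: zpoly_const zpoly_mult)

lemma zpoly_cnj: "zpoly f \<Longrightarrow> zpoly (\<lambda>z. cnj (f z))"
  by (induct rule: zpoly.induct) (auto intro: zpoly.intros)

lemma zpoly_Re: "zpoly (\<lambda>z. complex_of_real (Re z))"
proof -
  have "zpoly (\<lambda>z. (1/2) * (z + cnj z))" by (intro zpoly_cmult zpoly_add zpoly_id zpoly_cnj_id)
  then show ?thesis by (simp add: complex_add_cnj)
qed

lemma zpoly_Im: "zpoly (\<lambda>z. complex_of_real (Im z))"
proof -
  have "zpoly (\<lambda>z. (-\<i>/2) * (z - cnj z))" by (intro zpoly_cmult zpoly_diff zpoly_id zpoly_cnj_id)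
  moreover have "(\<lambda>z. (-\<i>/2) * (z - cnj z)) = (\<lambda>z. complex_of_real (Im z))"
    by (auto simp: complex_eq_iff)
  ultimately show ?thesis by simp
qed

lemma slow_zpoly: "zpoly f \<Longrightarrow> slow f"
  by (induct rule: zpoly.induct) (auto intro: slow_const slow_id slow_cnj slow_add slow_mult)

text \<open>\<open>dd\<close> does not recurse along \<open>zpoly\<close>, so a polynomial
  derivative is first exhibited and only then identified with \<open>dd\<close>.\<close>

lemma zpoly_hasd_ex: "zpoly f \<Longrightarrow> \<exists>f'. zpoly f' \<and> hasd c f f'"
proof (induct rule: zpoly.induct)
  case (zpoly_const a)
  then show ?case using hasd_const zpoly.zpoly_const by blast
next
  case zpoly_id
  then show ?case using hasd_id zpoly.zpoly_const by blast
next
  case zpoly_cnj_id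
  then show ?case using hasd_cnj[OF hasd_id] zpoly.zpoly_const by blast
next
  case (zpoly_add f g)
  then show ?case using hasd_add zpoly.zpoly_add by blast
next
  case (zpoly_mult f g)
  then obtain f' g' where "zpoly f'" "hasd c f f'" "zpoly g'" "hasd c g g'" by blast
  then show ?case using zpoly_mult hasd_mult[of c f f' g g']
    by (intro exI[of _ "\<lambda>z. f' z * g z + f z * g' z"]) (auto intro: zpoly.intros)
qed

lemma zpoly_hasd: assumes "zpoly f" shows "hasd c f (dd c f)" "zpoly (dd c f)"
  using zpoly_hasd_ex[OF assms, of c] hasd_imp_dd by auto

text \<open>The regularity that \<open>Ldiff\<close> consumes: unmixed second derivatives along the
  two real axes, everything with polynomial growth.\<close>

definition C2s :: "(complex \<Rightarrow> complex) \<Rightarrow> bool" where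
  "C2s u \<longleftrightarrow> slow u \<and> (\<forall>c\<in>{1, \<i>}. hasd c u (dd c u) \<and> slow (dd c u) \<and>
      hasd c (dd c u) (dd c (dd c u)) \<and> slow (dd c (dd c u)))"

lemma C2s_D:
  assumes "C2s u"
  shows "slow u" "hasd 1 u (dd 1 u)" "hasd \<i> u (dd \<i> u)" "slow (dd 1 u)" "slow (dd \<i> u)"
    "hasd 1 (dd 1 u) (dd 1 (dd 1 u))" "hasd \<i> (dd \<i> u) (dd \<i> (dd \<i> u))"
    "slow (dd 1 (dd 1 u))" "slow (dd \<i> (dd \<i> u))"
  using assms by (auto simp: C2s_def)

lemma C2s_zpoly: "zpoly u \<Longrightarrow> C2s u"
  unfolding C2s_def by (auto intro: zpoly_hasd slow_zpoly)

text \<open>The operator \<open>4 cos \<theta> \<partial>\<^sub>z \<partial>\<^sub>w - e\<^bsup>\<i>\<theta>\<^esup> z \<partial>\<^sub>z - e\<^bsup>-\<i>\<theta>\<^esup> w \<partial>\<^sub>w\<close>, where \<open>w\<close> is the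
  conjugate of \<open>z\<close>, written in real coordinates.\<close>
definition Ldiff :: "real \<Rightarrow> (complex \<Rightarrow> complex) \<Rightarrow> complex \<Rightarrow> complex" where
  "Ldiff \<theta> u z = of_real (cos \<theta>) * (dd 1 (dd 1 u) z + dd \<i> (dd \<i> u) z - of_real (Re z) * dd 1 u z - of_real (Im z) * dd \<i> u z)
     + of_real (sin \<theta>) * (of_real (Im z) * dd 1 u z - of_real (Re z) * dd \<i> u z)"

lemma slow_Ldiff: "C2s u \<Longrightarrow> slow (Ldiff \<theta> u)"
  unfolding Ldiff_def by (auto dest: C2s_D intro!: slow_add slow_diff slow_mult slow_const slow_Re slow_Im)

lemma zpoly_Ldiff: "zpoly u \<Longrightarrow> zpoly (Ldiff \<theta> u)"
  unfolding Ldiff_def by (auto intro!: zpoly_add zpoly_diff zpoly_mult zpoly_const zpoly_Re zpoly_Im zpoly_hasd)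

text \<open>Integration by parts applied to \<open>u1 * w\<close>. The right-hand side is symmetric
  in the two functions, which is how self-adjointness of each second-order part is read off.\<close>

lemma gauss_integral_dd2_symmetric:
  assumes u: "hasd c u u1" "hasd c u1 u2" "slow u" "slow u1" "slow u2"
    and w: "hasd c w w1" "slow w" "slow w1" and c: "cmod c = 1"
  shows "(\<integral>z. (u2 z - of_real (Re (z * cnj c)) * u1 z) * w z \<partial>gauss) = - (\<integral>z. u1 z * w1 z \<partial>gauss)"
proof -
  note sx = slow_Re_cnj[of c]
  have "hasd c (\<lambda>z. u1 z * w z) (\<lambda>z. u2 z * w z + u1 z * w1 z)"
    by (rule hasd_mult[OF u(2) w(1)])
  then have "(\<integral>z. u2 z * w z + u1 z * w1 z \<partial>gauss) = (\<integral>z. of_real (Re (z * cnj c)) * (u1 z * w z) \<partial>gauss)"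
    using c u w by (intro gauss_integration_by_parts) (auto intro: slow_add slow_mult)
  moreover have "(\<integral>z. u2 z * w z + u1 z * w1 z \<partial>gauss) = (\<integral>z. u2 z * w z \<partial>gauss) + (\<integral>z. u1 z * w1 z \<partial>gauss)"
    by (rule Bochner_Integration.integral_add) (use u w in \<open>auto intro!: slow_integrable slow_mult\<close>)
  moreover have "(\<integral>z. (u2 z - of_real (Re (z * cnj c)) * u1 z) * w z \<partial>gauss)
      = (\<integral>z. u2 z * w z \<partial>gauss) - (\<integral>z. of_real (Re (z * cnj c)) * (u1 z * w z) \<partial>gauss)"
    unfolding left_diff_distrib mult.assoc
    by (rule Bochner_Integration.integral_diff) (use u w sx in \<open>auto intro!: slow_integrable slow_mult\<close>)
  ultimately show ?thesis by (simp add: algebra_simps)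
qed

text \<open>The rotation field preserves the Gaussian. Integrating \<open>u * y * w\<close> by parts
  along x and \<open>u * x * w\<close> along y produces the same boundary term
  \<open>x y u w\<close>, which cancels.\<close>

lemma gauss_integral_rotation:
  assumes u: "C2s u" and w: "C2s w"
  shows "(\<integral>z. (of_real (Im z) * dd 1 u z - of_real (Re z) * dd \<i> u z) * w z \<partial>gauss)
    = - (\<integral>z. u z * (of_real (Im z) * dd 1 w z - of_real (Re z) * dd \<i> w z) \<partial>gauss)"
proof -
  note U = C2s_D[OF u] and W = C2s_D[OF w]
  note S = U W slow_Re slow_Im slow_mult slow_add slow_diff
  have 1: "hasd 1 (\<lambda>z. u z * (of_real (Im z) * w z))
      (\<lambda>z. dd 1 u z * (of_real (Im z) * w z) + u z * (of_real (Im 1) * w z + of_real (Im z) * dd 1 w z))"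
    by (intro hasd_mult hasd_Im U W)
  have 2: "hasd \<i> (\<lambda>z. u z * (of_real (Re z) * w z))
      (\<lambda>z. dd \<i> u z * (of_real (Re z) * w z) + u z * (of_real (Re \<i>) * w z + of_real (Re z) * dd \<i> w z))"
    by (intro hasd_mult hasd_Re U W)
  have "(\<integral>z. dd 1 u z * (of_real (Im z) * w z) + u z * (of_real (Im z) * dd 1 w z) \<partial>gauss)
      = (\<integral>z. of_real (Re z) * (u z * (of_real (Im z) * w z)) \<partial>gauss)"
    using gauss_integration_by_parts[OF 1] by (simp add: S)
  also have "\<dots> = (\<integral>z. of_real (Im z) * (u z * (of_real (Re z) * w z)) \<partial>gauss)"
    by (simp add: algebra_simps)
  also have "\<dots> = (\<integral>z. dd \<i> u z * (of_real (Re z) * w z) + u z * (of_real (Re z) * dd \<i> w z) \<partial>gauss)"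
    using gauss_integration_by_parts[OF 2] by (simp add: S)
  finally have e0: "(\<integral>z. dd 1 u z * (of_real (Im z) * w z) \<partial>gauss) + (\<integral>z. u z * (of_real (Im z) * dd 1 w z) \<partial>gauss)
     = (\<integral>z. dd \<i> u z * (of_real (Re z) * w z) \<partial>gauss) + (\<integral>z. u z * (of_real (Re z) * dd \<i> w z) \<partial>gauss)"
    by (subst (asm) (1 2) Bochner_Integration.integral_add) (auto intro!: slow_integrable S)
  have e1: "(\<integral>z. (of_real (Im z) * dd 1 u z - of_real (Re z) * dd \<i> u z) * w z \<partial>gauss)
     = (\<integral>z. dd 1 u z * (of_real (Im z) * w z) \<partial>gauss) - (\<integral>z. dd \<i> u z * (of_real (Re z) * w z) \<partial>gauss)"
    by (subst Bochner_Integration.integral_diff[symmetric])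
      (auto intro!: slow_integrable S Bochner_Integration.integral_cong simp: algebra_simps)
  have e2: "(\<integral>z. u z * (of_real (Im z) * dd 1 w z - of_real (Re z) * dd \<i> w z) \<partial>gauss)
     = (\<integral>z. u z * (of_real (Im z) * dd 1 w z) \<partial>gauss) - (\<integral>z. u z * (of_real (Re z) * dd \<i> w z) \<partial>gauss)"
    by (subst Bochner_Integration.integral_diff[symmetric])
      (auto intro!: slow_integrable S Bochner_Integration.integral_cong simp: algebra_simps)
  have "A + B = C + D \<Longrightarrow> A - C = - (B - D)" for A B C D :: complex
    by (simp add: algebra_simps)
  from this[OF e0] show ?thesis unfolding e1 e2 .
qed

text \<open>The pairing is bilinear, without conjugate. The second-order parts are symmetric and the
  rotation is skew, so only the sign of \<open>sin \<theta>\<close> changes, that is,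
  \<open>\<theta>\<close> becomes \<open>-\<theta>\<close>.\<close>

lemma Ldiff_transpose:
  assumes u: "C2s u" and w: "C2s w"
  shows "(\<integral>z. Ldiff \<theta> u z * w z \<partial>gauss) = (\<integral>z. u z * Ldiff (-\<theta>) w z \<partial>gauss)"
proof -
  note U = C2s_D[OF u] and W = C2s_D[OF w]
  note S = U W slow_Re slow_Im slow_mult slow_add slow_diff slow_const
  define A where "A c u z = dd c (dd c u) z - of_real (Re (z * cnj c)) * dd c u z" for c u z
  define R where "R u z = of_real (Im z) * dd 1 u z - of_real (Re z) * dd \<i> u z" for u z
  have eq: "Ldiff t v z = of_real (cos t) * A 1 v z + of_real (cos t) * A \<i> v z + of_real (sin t) * R v z" for t v z
    by (simp add: Ldiff_def A_def R_def algebra_simps)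
  have sl: "slow (A 1 u)" "slow (A \<i> u)" "slow (R u)" "slow (A 1 w)" "slow (A \<i> w)" "slow (R w)"
    unfolding A_def R_def by (auto intro!: S)
  have A: "(\<integral>z. A c u z * w z \<partial>gauss) = (\<integral>z. u z * A c w z \<partial>gauss)" if "c \<in> {1, \<i>}" for c
  proof -
    have "(\<integral>z. A c u z * w z \<partial>gauss) = - (\<integral>z. dd c u z * dd c w z \<partial>gauss)" unfolding A_def
      using u w that by (intro gauss_integral_dd2_symmetric) (auto dest: C2s_D)
    moreover have "(\<integral>z. A c w z * u z \<partial>gauss) = - (\<integral>z. dd c w z * dd c u z \<partial>gauss)" unfolding A_def
      using u w that by (intro gauss_integral_dd2_symmetric) (auto dest: C2s_D)
    ultimately show ?thesis by (simp add: mult.commute)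
  qed
  have B: "(\<integral>z. R u z * w z \<partial>gauss) = - (\<integral>z. u z * R w z \<partial>gauss)"
    unfolding R_def by (rule gauss_integral_rotation[OF u w])
  have "(\<integral>z. Ldiff \<theta> u z * w z \<partial>gauss) = (\<integral>z. of_real (cos \<theta>) * (A 1 u z * w z) + of_real (cos \<theta>) * (A \<i> u z * w z) + of_real (sin \<theta>) * (R u z * w z) \<partial>gauss)"
    by (simp add: eq algebra_simps)
  also have "\<dots> = of_real (cos \<theta>) * (\<integral>z. A 1 u z * w z \<partial>gauss) + of_real (cos \<theta>) * (\<integral>z. A \<i> u z * w z \<partial>gauss)
      + of_real (sin \<theta>) * (\<integral>z. R u z * w z \<partial>gauss)"
    using sl by (simp add: slow_integrable slow_mult S)
  also have "\<dots> = of_real (cos \<theta>) * (\<integral>z. u z * A 1 w z \<partial>gauss) + of_real (cos \<theta>) * (\<integral>z. u z * A \<i> w z \<partial>gauss)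
      - of_real (sin \<theta>) * (\<integral>z. u z * R w z \<partial>gauss)"
    using A B by simp
  also have "\<dots> = (\<integral>z. of_real (cos \<theta>) * (u z * A 1 w z) + of_real (cos \<theta>) * (u z * A \<i> w z) - of_real (sin \<theta>) * (u z * R w z) \<partial>gauss)"
    using sl by (simp add: slow_integrable slow_mult S)
  also have "\<dots> = (\<integral>z. u z * Ldiff (-\<theta>) w z \<partial>gauss)"
    by (simp add: eq algebra_simps)
  finally show ?thesis .
qed

section \<open>Complex Hermite polynomials: recurrences, eigenvalues, orthogonality\<close>

definition Herm :: "nat \<Rightarrow> nat \<Rightarrow> complex \<Rightarrow> complex" where
  "Herm m n z = (\<Sum>r = 0..min m n. complex_of_real ((-1) ^ r * fact r * 2 ^ r * real (m choose r) * real (n choose r))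
        * z ^ (m - r) * (cnj z) ^ (n - r))"

text \<open>Beyond the minimum one of the binomials vanishes, so the truncated exponents there are
  harmless. A freely chosen range lets sums with different indices be compared termwise.\<close>

lemma Herm_extend:
  assumes "min m n \<le> N"
  shows "Herm m n z = (\<Sum>r\<le>N. complex_of_real ((-1) ^ r * fact r * 2 ^ r * real (m choose r) * real (n choose r))
        * z ^ (m - r) * (cnj z) ^ (n - r))"
  unfolding Herm_def using assms by (intro sum.mono_neutral_left) (auto simp: not_le min_less_iff_disj)

lemma Herm_cnj: "cnj (Herm m n z) = Herm n m z"
  by (simp add: Herm_def min.commute algebra_simps)

lemma Herm_0_left: "Herm 0 n z = cnj z ^ n"
  by (simp add: Herm_def)

text \<open>Pascal's rule splits the sum: one half is \<open>z * Herm m n z\<close>, the other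
  becomes the lower polynomial by absorption of the factor \<open>Suc r\<close>. For
  \<open>n = 0\<close> the truncated \<open>n - 1\<close> is multiplied by 0.\<close>

lemma Herm_Suc_left: "Herm (Suc m) n z = z * Herm m n z - 2 * of_nat n * Herm m (n - 1) z"
proof -
  let ?c = "\<lambda>r. complex_of_real ((-1) ^ r * fact r * 2 ^ r)"
  have *: "of_nat (Suc r) * of_nat (n choose Suc r) = (of_nat n * of_nat ((n - 1) choose r) :: complex)" for r
  proof (cases n)
    case (Suc k)
    then show ?thesis using Suc_times_binomial_eq[of k r] by (metis diff_Suc_1 of_nat_mult mult.commute)
  qed simp
  have "Herm (Suc m) n z = (\<Sum>r\<le>Suc m. ?c r * of_nat (Suc m choose r) * of_nat (n choose r) * z ^ (Suc m - r) * cnj z ^ (n - r))"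
    by (subst Herm_extend[of _ _ "Suc m"]) auto
  also have "\<dots> = z ^ Suc m * cnj z ^ n + (\<Sum>r\<le>m. ?c (Suc r) * of_nat (Suc m choose Suc r) * of_nat (n choose Suc r) * z ^ (m - r) * cnj z ^ (n - Suc r))"
    by (subst sum.atMost_Suc_shift) simp
  also have "\<dots> = (z ^ Suc m * cnj z ^ n + (\<Sum>r\<le>m. ?c (Suc r) * of_nat (m choose Suc r) * of_nat (n choose Suc r) * z ^ (m - r) * cnj z ^ (n - Suc r)))
     + (\<Sum>r\<le>m. ?c (Suc r) * of_nat (m choose r) * of_nat (n choose Suc r) * z ^ (m - r) * cnj z ^ (n - Suc r))"
    unfolding add.assoc sum.distrib[symmetric]
    by (intro arg_cong2[of _ _ _ _ "(+)"] sum.cong refl)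
      (simp only: binomial_Suc_Suc of_nat_add distrib_left distrib_right add.commute)
  also have "(z ^ Suc m * cnj z ^ n + (\<Sum>r\<le>m. ?c (Suc r) * of_nat (m choose Suc r) * of_nat (n choose Suc r) * z ^ (m - r) * cnj z ^ (n - Suc r)))
     = (\<Sum>r\<le>Suc m. ?c r * of_nat (m choose r) * of_nat (n choose r) * z ^ (Suc m - r) * cnj z ^ (n - r))"
    by (subst sum.atMost_Suc_shift) simp
  also have "\<dots> = z * Herm m n z"
  proof -
    \<comment> \<open>The term \<open>r = Suc m\<close> satisfies the identity because its binomial
      is 0 on both sides.\<close>
    have e: "?c r * of_nat (m choose r) * of_nat (n choose r) * z ^ (Suc m - r) * cnj z ^ (n - r)
      = z * (?c r * of_nat (m choose r) * of_nat (n choose r) * z ^ (m - r) * cnj z ^ (n - r))" for r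
      by (cases "r \<le> m") (auto simp: Suc_diff_le)
    have "Herm m n z = (\<Sum>r\<le>Suc m. ?c r * of_nat (m choose r) * of_nat (n choose r) * z ^ (m - r) * cnj z ^ (n - r))"
      by (subst Herm_extend[of _ _ "Suc m"]) auto
    then show ?thesis by (simp only: e sum_distrib_left)
  qed
  also have "(\<Sum>r\<le>m. ?c (Suc r) * of_nat (m choose r) * of_nat (n choose Suc r) * z ^ (m - r) * cnj z ^ (n - Suc r))
     = - (2 * of_nat n * Herm m (n - 1) z)"
  proof -
    have e: "?c (Suc r) * of_nat (m choose r) * of_nat (n choose Suc r) * z ^ (m - r) * cnj z ^ (n - Suc r)
      = - (2 * of_nat n * (?c r * of_nat (m choose r) * of_nat ((n - 1) choose r) * z ^ (m - r) * cnj z ^ (n - 1 - r)))" for r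
    proof -
      have "?c (Suc r) = - 2 * ?c r * of_nat (Suc r)" by simp
      then have "?c (Suc r) * of_nat (m choose r) * of_nat (n choose Suc r) * z ^ (m - r) * cnj z ^ (n - Suc r)
        = - 2 * ?c r * of_nat (m choose r) * (of_nat (Suc r) * of_nat (n choose Suc r)) * z ^ (m - r) * cnj z ^ (n - Suc r)"
        by (simp only: mult_ac)
      then show ?thesis unfolding * by (simp add: mult_ac)
    qed
    have "Herm m (n - 1) z = (\<Sum>r\<le>m. ?c r * of_nat (m choose r) * of_nat ((n - 1) choose r) * z ^ (m - r) * cnj z ^ (n - 1 - r))"
      by (subst Herm_extend[of _ _ m]) auto
    then show ?thesis by (simp only: e sum_distrib_left sum_negf)
  qed
  finally show ?thesis by simp
qed

lemma Herm_Suc_right: "Herm m (Suc n) z = cnj z * Herm m n z - 2 * of_nat m * Herm (m - 1) n z"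
proof -
  have "cnj (Herm (Suc n) m z) = cnj (z * Herm n m z - 2 * of_nat m * Herm n (m - 1) z)"
    by (simp only: Herm_Suc_left)
  then show ?thesis by (simp add: Herm_cnj)
qed

lemma zpoly_Herm: "zpoly (Herm m n)"
  unfolding Herm_def by (intro zpoly_sum zpoly_mult zpoly_power zpoly_const zpoly_id zpoly_cnj_id) auto

lemma hasd_cnj_power: "hasd c (\<lambda>z. cnj z ^ n) (\<lambda>z. cnj c * of_nat n * cnj z ^ (n - 1))"
proof (induct n)
  case 0 then show ?case by (simp add: hasd_const)
next
  case (Suc n)
  have "hasd c (\<lambda>z. cnj z * cnj z ^ n) (\<lambda>z. cnj c * cnj z ^ n + cnj z * (cnj c * of_nat n * cnj z ^ (n - 1)))"
    by (intro hasd_mult hasd_cnj hasd_id Suc)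
  then have "hasd c (\<lambda>z. cnj z * cnj z ^ n) (\<lambda>z. cnj c * of_nat (Suc n) * cnj z ^ (Suc n - 1))"
    by (rule hasd_cong) (cases n; simp add: algebra_simps)
  then show ?case by simp
qed

text \<open>Both Wirtinger derivatives are lowering operators: the one in \<open>z\<close>
  contributes \<open>m\<close> times the polynomial at \<open>m - 1\<close>, the one in the
  conjugate contributes \<open>n\<close> times that at \<open>n - 1\<close>. Direction
  \<open>c\<close> weights them by \<open>c\<close> and \<open>cnj c\<close>.\<close>

lemma hasd_Herm: "hasd c (Herm m n) (\<lambda>z. c * of_nat m * Herm (m - 1) n z + cnj c * of_nat n * Herm m (n - 1) z)"
proof (induct m arbitrary: n)
  case 0
  show ?case using hasd_cnj_power[of c n] by (simp add: Herm_0_left[abs_def] Herm_0_left)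
next
  case (Suc m)
  have eq: "Herm (Suc m) n = (\<lambda>z. z * Herm m n z - (2 * of_nat n) * Herm m (n - 1) z)" for n
    by (rule ext) (simp add: Herm_Suc_left)
  have d: "hasd c (Herm (Suc m) n) (\<lambda>z. (c * Herm m n z + z * (c * of_nat m * Herm (m - 1) n z + cnj c * of_nat n * Herm m (n - 1) z))
    - (2 * of_nat n) * (c * of_nat m * Herm (m - 1) (n - 1) z + cnj c * of_nat (n - 1) * Herm m (n - 1 - 1) z))"
    unfolding eq by (intro hasd_diff hasd_mult hasd_cmult hasd_id Suc)
  show ?case
  proof (rule hasd_cong[OF d])
    fix z
    \<comment> \<open>The recurrence at index \<open>m - 1\<close>; when \<open>m = 0\<close> the
      truncated subtraction is neutralised by the factor \<open>m\<close>.\<close>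
    have 1: "of_nat m * (z * Herm (m - 1) n z - 2 * of_nat n * Herm (m - 1) (n - 1) z) = of_nat m * Herm m n z"
      by (cases m) (auto simp: Herm_Suc_left)
    have 2: "Herm (Suc m) (n - 1) z = z * Herm m (n - 1) z - 2 * of_nat (n - 1) * Herm m (n - 1 - 1) z"
      by (simp add: Herm_Suc_left)
    have "(c * Herm m n z + z * (c * of_nat m * Herm (m - 1) n z + cnj c * of_nat n * Herm m (n - 1) z))
       - (2 * of_nat n) * (c * of_nat m * Herm (m - 1) (n - 1) z + cnj c * of_nat (n - 1) * Herm m (n - 1 - 1) z)
      = c * Herm m n z + c * (of_nat m * (z * Herm (m - 1) n z - 2 * of_nat n * Herm (m - 1) (n - 1) z))
        + cnj c * of_nat n * Herm (Suc m) (n - 1) z"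
      unfolding 2 by (simp add: algebra_simps)
    also have "\<dots> = c * of_nat (Suc m) * Herm (Suc m - 1) n z + cnj c * of_nat n * Herm (Suc m) (n - 1) z"
      unfolding 1 by (simp add: algebra_simps)
    finally show "(c * Herm m n z + z * (c * of_nat m * Herm (m - 1) n z + cnj c * of_nat n * Herm m (n - 1) z))
       - (2 * of_nat n) * (c * of_nat m * Herm (m - 1) (n - 1) z + cnj c * of_nat (n - 1) * Herm m (n - 1 - 1) z)
      = c * of_nat (Suc m) * Herm (Suc m - 1) n z + cnj c * of_nat n * Herm (Suc m) (n - 1) z" .
  qed
qed

text \<open>The Laplacian leaves a multiple of \<open>Herm (m - 1) (n - 1)\<close>, and the
  recurrences rewrite the first-order terms as multiples of \<open>Herm m n\<close> plus the same
  lower polynomial, which cancels.\<close>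

lemma Ldiff_Herm: "Ldiff \<theta> (Herm m n) z = - eig \<theta> m n * Herm m n z"
proof -
  define a where "a c = (\<lambda>z. c * of_nat m * Herm (m - 1) n z + cnj c * of_nat n * Herm m (n - 1) z)" for c
  have d1: "dd c (Herm m n) = a c" for c unfolding a_def by (rule hasd_imp_dd[OF hasd_Herm])
  have d2: "dd c (dd c (Herm m n)) z = (c * of_nat m) * (c * of_nat (m - 1) * Herm (m - 1 - 1) n z + cnj c * of_nat n * Herm (m - 1) (n - 1) z)
      + (cnj c * of_nat n) * (c * of_nat m * Herm (m - 1) (n - 1) z + cnj c * of_nat (n - 1) * Herm m (n - 1 - 1) z)" for c
  proof -
    have "hasd c (a c) (\<lambda>z. (c * of_nat m) * (c * of_nat (m - 1) * Herm (m - 1 - 1) n z + cnj c * of_nat n * Herm (m - 1) (n - 1) z)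
      + (cnj c * of_nat n) * (c * of_nat m * Herm (m - 1) (n - 1) z + cnj c * of_nat (n - 1) * Herm m (n - 1 - 1) z))"
      unfolding a_def by (intro hasd_add hasd_cmult hasd_Herm)
    from hasd_imp_dd[OF this] show ?thesis by (simp add: d1)
  qed
  define h where "h = Herm m n z"
  define h1 where "h1 = Herm (m - 1) n z"
  define h2 where "h2 = Herm m (n - 1) z"
  define h12 where "h12 = Herm (m - 1) (n - 1) z"
  have z1: "of_nat m * (z * h1) = of_nat m * (h + 2 * of_nat n * h12)"
    by (cases m) (auto simp: Herm_Suc_left h1_def h_def h12_def)
  have z2: "of_nat n * (cnj z * h2) = of_nat n * (h + 2 * of_nat m * h12)"
    by (cases n) (auto simp: Herm_Suc_right h2_def h_def h12_def)
  \<comment> \<open>Over the directions 1 and \<open>\<i>\<close> the terms with \<open>c^2\<close>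
    cancel and those with \<open>c * cnj c\<close> add up.\<close>
  have lap: "dd 1 (dd 1 (Herm m n)) z + dd \<i> (dd \<i> (Herm m n)) z = 4 * of_nat m * of_nat n * h12"
    unfolding d2 h12_def by (simp add: algebra_simps)
  have zz: "z = of_real (Re z) + \<i> * of_real (Im z)" "cnj z = of_real (Re z) - \<i> * of_real (Im z)"
    by (auto simp: complex_eq_iff)
  have e1: "of_real (Re z) * a 1 z + of_real (Im z) * a \<i> z = of_nat m * (z * h1) + of_nat n * (cnj z * h2)"
    unfolding a_def h1_def[symmetric] h2_def[symmetric] by (subst (3) zz(1), subst zz(2)) (simp add: algebra_simps)
  have e2: "of_real (Im z) * a 1 z - of_real (Re z) * a \<i> z = - \<i> * (of_nat m * (z * h1) - of_nat n * (cnj z * h2))"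
    unfolding a_def h1_def[symmetric] h2_def[symmetric] by (subst (3) zz(1), subst zz(2)) (simp add: algebra_simps)
  have "Ldiff \<theta> (Herm m n) z = of_real (cos \<theta>) * (4 * of_nat m * of_nat n * h12 - (of_real (Re z) * a 1 z + of_real (Im z) * a \<i> z))
      + of_real (sin \<theta>) * (of_real (Im z) * a 1 z - of_real (Re z) * a \<i> z)"
    unfolding Ldiff_def lap by (simp add: d1 algebra_simps)
  also have "\<dots> = - eig \<theta> m n * h"
    unfolding e1 e2 z1 z2 eig_def by (simp add: algebra_simps)
  finally show ?thesis by (simp add: h_def)
qed

text \<open>Under the Gaussian, multiplication by \<open>z\<close> is transposed to
  \<open>\<partial>x + i \<partial>y\<close>, twice the derivative in the conjugate
  variable.\<close>

lemma gauss_integral_times_z: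
  assumes f: "hasd 1 f f1" "hasd \<i> f f2" and s: "slow f" "slow f1" "slow f2"
  shows "(\<integral>z. z * f z \<partial>gauss) = (\<integral>z. f1 z + \<i> * f2 z \<partial>gauss)"
proof -
  have eq: "z * f z = complex_of_real (Re z) * f z + \<i> * (complex_of_real (Im z) * f z)" for z
    by (subst (1) complex_eq[of z]) (simp add: algebra_simps)
  have "(\<integral>z. z * f z \<partial>gauss) = (\<integral>z. complex_of_real (Re z) * f z \<partial>gauss) + \<i> * (\<integral>z. complex_of_real (Im z) * f z \<partial>gauss)"
    unfolding eq by (simp add: slow_integrable slow_mult slow_Re slow_Im s)
  also have "(\<integral>z. complex_of_real (Re z) * f z \<partial>gauss) = (\<integral>z. f1 z \<partial>gauss)"
    using gauss_integration_by_parts[OF f(1)] s by simp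
  also have "(\<integral>z. complex_of_real (Im z) * f z \<partial>gauss) = (\<integral>z. f2 z \<partial>gauss)"
    using gauss_integration_by_parts[OF f(2)] s by simp
  finally show ?thesis by (simp add: slow_integrable s)
qed

text \<open>Raise the first factor by the recurrence and transpose \<open>z\<close>. The derivative
  falling on the first factor cancels the correction term, so only the lowering of the second factor
  survives.\<close>

lemma integral_Herm_Suc:
  "(\<integral>z. Herm (Suc m) n z * Herm l k z \<partial>gauss) = 2 * of_nat k * (\<integral>z. Herm m n z * Herm l (k - 1) z \<partial>gauss)"
proof -
  note S = slow_zpoly[OF zpoly_Herm] slow_mult slow_add slow_cmult
  let ?d = "\<lambda>c z. (c * of_nat m * Herm (m - 1) n z + cnj c * of_nat n * Herm m (n - 1) z) * Herm l k z
     + Herm m n z * (c * of_nat l * Herm (l - 1) k z + cnj c * of_nat k * Herm l (k - 1) z)"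
  have d: "hasd c (\<lambda>z. Herm m n z * Herm l k z) (?d c)" for c
    by (intro hasd_mult hasd_Herm)
  have s: "slow (?d c)" for c by (intro S)
  have "(\<integral>z. Herm (Suc m) n z * Herm l k z \<partial>gauss)
      = (\<integral>z. z * (Herm m n z * Herm l k z) - 2 * of_nat n * (Herm m (n - 1) z * Herm l k z) \<partial>gauss)"
    by (simp add: Herm_Suc_left algebra_simps)
  also have "\<dots> = (\<integral>z. z * (Herm m n z * Herm l k z) \<partial>gauss) - (\<integral>z. 2 * of_nat n * (Herm m (n - 1) z * Herm l k z) \<partial>gauss)"
    by (intro Bochner_Integration.integral_diff slow_integrable S slow_id)
  also have "(\<integral>z. z * (Herm m n z * Herm l k z) \<partial>gauss) = (\<integral>z. ?d 1 z + \<i> * ?d \<i> z \<partial>gauss)"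
    by (rule gauss_integral_times_z[OF d d]) (intro S s)+
  also have "\<dots> = (\<integral>z. 2 * of_nat n * (Herm m (n - 1) z * Herm l k z) + 2 * of_nat k * (Herm m n z * Herm l (k - 1) z) \<partial>gauss)"
    by (rule Bochner_Integration.integral_cong) (auto simp: algebra_simps)
  also have "\<dots> = (\<integral>z. 2 * of_nat n * (Herm m (n - 1) z * Herm l k z) \<partial>gauss) + (\<integral>z. 2 * of_nat k * (Herm m n z * Herm l (k - 1) z) \<partial>gauss)"
    by (intro Bochner_Integration.integral_add slow_integrable S)
  finally show ?thesis by simp
qed

lemma integral_Herm_Suc':
  "(\<integral>z. Herm m (Suc n) z * Herm l k z \<partial>gauss) = 2 * of_nat l * (\<integral>z. Herm m n z * Herm (l - 1) k z \<partial>gauss)"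
proof -
  have "cnj (\<integral>z. Herm (Suc n) m z * Herm k l z \<partial>gauss) = cnj (2 * of_nat l * (\<integral>z. Herm n m z * Herm k (l - 1) z \<partial>gauss))"
    by (simp only: integral_Herm_Suc)
  then show ?thesis
    unfolding complex_cnj_mult Bochner_Integration.integral_cnj[symmetric] by (simp add: Herm_cnj)
qed

text \<open>Lowering an index on the left lowers the opposite index on the right, until the left
  factor is 1; then the factors exchange roles. The pairing has no conjugate, hence the crossed
  index conditions.\<close>

lemma integral_Herm:
  "(\<integral>z. Herm m n z * Herm l k z \<partial>gauss) = (if m = k \<and> n = l then of_real (fact m * fact n * 2 ^ (m + n)) else 0)"
proof (induct m arbitrary: n l k)
  case 0
  show ?case
  proof (induct n arbitrary: l k)
    case 0
    show ?case
    proof (cases "l = 0 \<and> k = 0")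
      case True
      then show ?thesis by (simp add: Herm_0_left gauss.prob_space[simplified])
    next
      case False
      then have "(\<integral>z. Herm l k z * Herm 0 0 z \<partial>gauss) = 0"
        by (cases l; cases k) (auto simp: integral_Herm_Suc integral_Herm_Suc')
      then show ?thesis using False by (auto simp: mult.commute)
    qed
  next
    case (Suc n)
    show ?case
      unfolding integral_Herm_Suc' by (subst Suc) (cases l; auto)
  qed
next
  case (Suc m)
  show ?case
    unfolding integral_Herm_Suc by (subst Suc) (cases k; auto)
qed

lemma J_eq_Herm: "J m n z = complex_of_real (1 / sqrt (real (fact m * fact n * 2 ^ (m + n)))) * Herm m n z"
  by (simp add: J_def Herm_def)

lemma zpoly_J: "zpoly (J m n)"
  unfolding J_eq_Herm[abs_def] by (intro zpoly_cmult zpoly_Herm)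

lemma J_cnj: "cnj (J m n z) = J n m z"
  by (simp add: J_eq_Herm Herm_cnj add.commute mult.commute)

lemma J_L2: "Lp 2 (J m n)"
  by (intro slow_Lp slow_zpoly zpoly_J)

lemma inner_g_J: "inner_g (J m n) (J k l) = (if m = k \<and> n = l then 1 else 0)"
proof -
  let ?a = "\<lambda>m n. real (fact m * fact n * 2 ^ (m + n))"
  have pos: "?a m n > 0" for m n by simp
  have "inner_g (J m n) (J k l) = (\<integral>z. complex_of_real (1 / sqrt (?a m n) * (1 / sqrt (?a l k))) * (Herm m n z * Herm l k z) \<partial>gauss)"
    unfolding inner_g_def J_cnj by (simp add: J_eq_Herm mult_ac)
  also have "\<dots> = complex_of_real (1 / sqrt (?a m n) * (1 / sqrt (?a l k))) * (\<integral>z. Herm m n z * Herm l k z \<partial>gauss)"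
    by (rule Bochner_Integration.integral_mult_right_zero)
  also have "\<dots> = (if m = k \<and> n = l then 1 else 0)"
  proof (cases "m = k \<and> n = l")
    case True
    then have "complex_of_real (1 / sqrt (?a m n) * (1 / sqrt (?a l k))) * (\<integral>z. Herm m n z * Herm l k z \<partial>gauss)
      = complex_of_real (1 / sqrt (?a m n) * (1 / sqrt (?a m n)) * ?a m n)"
      unfolding integral_Herm of_real_mult by (simp add: mult.commute add.commute)
    also have "1 / sqrt (?a m n) * (1 / sqrt (?a m n)) * ?a m n = 1"
      using pos[of m n] real_sqrt_mult_self[of "?a m n"] by (simp add: field_simps del: real_sqrt_mult_self of_nat_mult)
    finally show ?thesis using True by simp
  next
    case False
    then have "(\<integral>z. Herm m n z * Herm l k z \<partial>gauss) = 0" by (simp only: integral_Herm if_False)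
    with False show ?thesis by (simp only: mult_zero_right if_False)
  qed
  finally show ?thesis .
qed

lemma Ldiff_J: "Ldiff \<theta> (J m n) z = - eig \<theta> m n * J m n z"
proof -
  define a where "a = complex_of_real (1 / sqrt (real (fact m * fact n * 2 ^ (m + n))))"
  have d: "dd c (\<lambda>z. a * f z) = (\<lambda>z. a * dd c f z)" if "zpoly f" for c f
    by (intro hasd_imp_dd hasd_cmult zpoly_hasd that)
  have J: "J m n = (\<lambda>z. a * Herm m n z)" by (rule ext) (simp only: J_eq_Herm a_def)
  have "Ldiff \<theta> (J m n) z = a * Ldiff \<theta> (Herm m n) z"
    unfolding J Ldiff_def by (simp add: d zpoly_Herm zpoly_hasd) (simp add: algebra_simps)
  then show ?thesis by (simp add: Ldiff_Herm J)
qed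

lemma eig_swap: "eig (-\<theta>) n m = eig \<theta> m n"
  by (simp add: eig_def algebra_simps)

text \<open>Conjugation swaps the indices of \<open>J\<close> and transposition negates
  \<open>\<theta>\<close>; \<open>eig_swap\<close> shows that the two effects on the eigenvalue
  cancel.\<close>

lemma inner_g_Ldiff_J:
  assumes "C2s u"
  shows "inner_g (Ldiff \<theta> u) (J m n) = - eig \<theta> m n * inner_g u (J m n)"
proof -
  have "inner_g (Ldiff \<theta> u) (J m n) = (\<integral>z. u z * Ldiff (-\<theta>) (J n m) z \<partial>gauss)"
    unfolding inner_g_def J_cnj by (rule Ldiff_transpose) (auto intro: assms C2s_zpoly zpoly_J)
  also have "\<dots> = (\<integral>z. - eig \<theta> m n * (u z * cnj (J m n z)) \<partial>gauss)"
    by (simp add: Ldiff_J eig_swap J_cnj algebra_simps)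
  also have "\<dots> = - eig \<theta> m n * inner_g u (J m n)"
    unfolding inner_g_def by (rule Bochner_Integration.integral_mult_right_zero)
  finally show ?thesis .
qed

text \<open>Serves to pass from the Hermite polynomials to all polynomials: read backwards, the
  recurrences show that multiplication by \<open>z\<close> or \<open>cnj z\<close> stays in the
  span, which contains \<open>Herm 0 0 = 1\<close>.\<close>

inductive Hspan :: "(complex \<Rightarrow> complex) \<Rightarrow> bool" where
  Hspan_Herm: "Hspan (Herm m n)"
| Hspan_add: "Hspan f \<Longrightarrow> Hspan g \<Longrightarrow> Hspan (\<lambda>z. f z + g z)"
| Hspan_cmult: "Hspan f \<Longrightarrow> Hspan (\<lambda>z. a * f z)"

lemma Hspan_times_z: "Hspan f \<Longrightarrow> Hspan (\<lambda>z. z * f z)"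
proof (induct rule: Hspan.induct)
  case (Hspan_Herm m n)
  have "Hspan (\<lambda>z. Herm (Suc m) n z + (2 * of_nat n) * Herm m (n - 1) z)" by (intro Hspan.intros)
  then show ?case by (simp add: Herm_Suc_left)
next
  case (Hspan_add f g)
  have "Hspan (\<lambda>z. z * f z + z * g z)" by (intro Hspan.intros Hspan_add)
  then show ?case by (simp add: algebra_simps)
next
  case (Hspan_cmult f a)
  have "Hspan (\<lambda>z. a * (z * f z))" by (intro Hspan.intros Hspan_cmult)
  then show ?case by (simp add: mult.left_commute)
qed

lemma Hspan_times_cnj: "Hspan f \<Longrightarrow> Hspan (\<lambda>z. cnj z * f z)"
proof (induct rule: Hspan.induct)
  case (Hspan_Herm m n)
  have "Hspan (\<lambda>z. Herm m (Suc n) z + (2 * of_nat m) * Herm (m - 1) n z)" by (intro Hspan.intros)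
  then show ?case by (simp add: Herm_Suc_right)
next
  case (Hspan_add f g)
  have "Hspan (\<lambda>z. cnj z * f z + cnj z * g z)" by (intro Hspan.intros Hspan_add)
  then show ?case by (simp add: algebra_simps)
next
  case (Hspan_cmult f a)
  have "Hspan (\<lambda>z. a * (cnj z * f z))" by (intro Hspan.intros Hspan_cmult)
  then show ?case by (simp add: mult.left_commute)
qed

text \<open>Phrased with an arbitrary second factor \<open>f\<close>, the form in which the
  induction passes through products.\<close>

lemma Hspan_times_zpoly: "zpoly p \<Longrightarrow> Hspan f \<Longrightarrow> Hspan (\<lambda>z. p z * f z)"
proof (induct arbitrary: f rule: zpoly.induct)
  case (zpoly_add p q)
  have "Hspan (\<lambda>z. p z * f z + q z * f z)" by (intro Hspan.intros zpoly_add)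
  then show ?case by (simp add: algebra_simps)
next
  case (zpoly_mult p q)
  have "Hspan (\<lambda>z. p z * (q z * f z))" by (intro zpoly_mult)
  then show ?case by (simp add: algebra_simps)
qed (auto intro: Hspan.intros Hspan_times_z Hspan_times_cnj)

lemma Hspan_zpoly: "zpoly p \<Longrightarrow> Hspan p"
  using Hspan_times_zpoly[of p "Herm 0 0"] by (simp add: Hspan_Herm Herm_0_left)

lemma zpoly_Hspan: "Hspan p \<Longrightarrow> zpoly p"
  by (induct rule: Hspan.induct) (auto intro: zpoly_Herm zpoly_add zpoly_cmult)

lemma orthogonal_zpoly:
  assumes f: "Lp 2 f" and o: "\<And>m n. inner_g f (J m n) = 0" and p: "zpoly p"
  shows "(\<integral>z. f z * p z \<partial>gauss) = 0"
proof -
  have H: "(\<integral>z. f z * Herm m n z \<partial>gauss) = 0" for m n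
  proof -
    define a where "a = complex_of_real (1 / sqrt (real (fact m * fact n * 2 ^ (m + n))))"
    have "inner_g f (J n m) = (\<integral>z. f z * J m n z \<partial>gauss)" by (simp only: inner_g_def J_cnj)
    also have "\<dots> = (\<integral>z. a * (f z * Herm m n z) \<partial>gauss)" by (simp only: J_eq_Herm a_def mult_ac)
    also have "\<dots> = a * (\<integral>z. f z * Herm m n z \<partial>gauss)" by simp
    finally have "inner_g f (J n m) = a * (\<integral>z. f z * Herm m n z \<partial>gauss)" .
    moreover have "a \<noteq> 0" by (simp add: a_def)
    ultimately show ?thesis using o[of n m] by (metis mult_eq_0_iff)
  qed
  from Hspan_zpoly[OF p] show ?thesis
  proof (induct rule: Hspan.induct)
    case (Hspan_Herm m n)
    then show ?case by (rule H)
  next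
    case (Hspan_add p q)
    have "(\<integral>z. f z * p z + f z * q z \<partial>gauss) = (\<integral>z. f z * p z \<partial>gauss) + (\<integral>z. f z * q z \<partial>gauss)"
      using Hspan_add
      by (intro Bochner_Integration.integral_add L2_integrable_mult f slow_Lp slow_zpoly zpoly_Hspan)
    then show ?case using Hspan_add by (simp add: algebra_simps)
  next
    case (Hspan_cmult p a)
    have "(\<integral>z. a * (f z * p z) \<partial>gauss) = 0" using Hspan_cmult by simp
    then show ?case by (simp only: mult.left_commute)
  qed
qed

section \<open>Completeness of the Hermite basis\<close>

definition gw :: "real \<Rightarrow> complex \<Rightarrow> real" where
  "gw e z = exp (- (e * (cmod z)\<^sup>2))"

lemma gw_pos [simp]: "gw e z > 0" "gw e z \<ge> 0" "gw e z \<noteq> 0"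
  by (auto simp: gw_def)

lemma gw_le_1: "e \<ge> 0 \<Longrightarrow> gw e z \<le> 1"
  by (simp add: gw_def)

lemma gw_measurable [measurable]: "gw e \<in> borel_measurable borel"
  unfolding gw_def by measurable

lemma continuous_gw: "continuous_on S (gw e)"
  unfolding gw_def by (intro continuous_intros)

lemma gw_power: "gw e z ^ k = gw (real k * e) z"
  by (simp add: gw_def exp_of_nat_mult[symmetric] algebra_simps)

lemma slow_gw_bounded:
  assumes "slow q" "e > 0"
  shows "\<exists>B. \<forall>z. cmod (q z * of_real (gw e z)) \<le> B"
proof -
  obtain C k where C: "C > 0" "\<And>z. cmod (q z) \<le> C * (1 + cmod z) ^ k" using slowE[OF assms(1)] by blast
  obtain K :: real where K: "K > 0" "\<And>x. x \<ge> 0 \<Longrightarrow> (1 + x) ^ k \<le> K * exp (e * x\<^sup>2)"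
    using poly_le_exp_square[OF assms(2), of k] by metis
  have "cmod (q z * of_real (gw e z)) \<le> C * K" for z
  proof -
    have "cmod (q z * of_real (gw e z)) = cmod (q z) * gw e z" by (simp add: norm_mult)
    also have "\<dots> \<le> C * (K * exp (e * (cmod z)\<^sup>2)) * gw e z"
      by (intro mult_right_mono order_trans[OF C(2)] mult_left_mono K) (use C in auto)
    also have "\<dots> = C * K" by (simp add: gw_def exp_minus)
    finally show ?thesis .
  qed
  then show ?thesis by blast
qed

lemma slow_gw: "e \<ge> 0 \<Longrightarrow> slow (\<lambda>z. of_real (gw e z))"
  by (rule slow_bounded[where C=1]) (auto intro!: continuous_intros continuous_gw simp: gw_le_1)

text \<open>An algebra without unit: \<open>Suc k\<close> guarantees at least one factor of the
  weight, which keeps every member bounded when \<open>e > 0\<close>.\<close>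

inductive wspan :: "real \<Rightarrow> (complex \<Rightarrow> complex) \<Rightarrow> bool" for e where
  wspan_base: "zpoly p \<Longrightarrow> wspan e (\<lambda>z. p z * of_real (gw e z) ^ Suc k)"
| wspan_add: "wspan e f \<Longrightarrow> wspan e g \<Longrightarrow> wspan e (\<lambda>z. f z + g z)"

lemma wspan_0: "wspan e (\<lambda>_. 0)"
  using wspan_base[OF zpoly_const[of 0], of e 0] by simp

lemma wspan_cmult: "wspan e f \<Longrightarrow> wspan e (\<lambda>z. a * f z)"
proof (induct rule: wspan.induct)
  case (wspan_base p k)
  then show ?case using wspan.wspan_base[OF zpoly_cmult[of p a], of e k] by (simp add: mult.assoc)
next
  case (wspan_add f g)
  then have "wspan e (\<lambda>z. a * f z + a * g z)" by (intro wspan.wspan_add)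
  then show ?case by (simp only: distrib_left)
qed

lemma wspan_mult_base: "wspan e g \<Longrightarrow> zpoly p \<Longrightarrow> wspan e (\<lambda>z. p z * of_real (gw e z) ^ Suc k * g z)"
proof (induct rule: wspan.induct)
  case (wspan_base q l)
  have "wspan e (\<lambda>z. (p z * q z) * of_real (gw e z) ^ Suc (Suc k + l))"
    by (intro wspan.wspan_base zpoly_mult wspan_base)
  then show ?case by (simp add: power_add mult_ac)
next
  case (wspan_add f g)
  then have "wspan e (\<lambda>z. p z * of_real (gw e z) ^ Suc k * f z + p z * of_real (gw e z) ^ Suc k * g z)"
    by (intro wspan.wspan_add) auto
  then show ?case by (simp only: distrib_left)
qed

lemma wspan_mult: "wspan e f \<Longrightarrow> wspan e g \<Longrightarrow> wspan e (\<lambda>z. f z * g z)"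
proof (induct rule: wspan.induct)
  case (wspan_base p k)
  then show ?case using wspan_mult_base by blast
next
  case (wspan_add f1 f2)
  then have "wspan e (\<lambda>z. f1 z * g z + f2 z * g z)"
    by (intro wspan.wspan_add) auto
  then show ?case by (simp only: distrib_right)
qed

text \<open>The plane is embedded into \<open>\<real>\<^sup>3\<close> so that polynomials without constant term pull back to
  polynomials times positive powers of the Gaussian weight.\<close>
definition emb :: "real \<Rightarrow> complex \<Rightarrow> real \<times> real \<times> real" where
  "emb e z = (gw e z, Re z * gw e z, Im z * gw e z)"

text \<open>Subtracting \<open>P 0\<close> removes the constant term, the only part whose pullback
  carries no weight.\<close>

lemma wspan_real_polynomial:
  "real_polynomial_function P \<Longrightarrow> wspan e (\<lambda>z. of_real (P (emb e z) - P 0))"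
proof (induct rule: real_polynomial_function.induct)
  case (linear f)
  interpret f: bounded_linear f by fact
  have "f (emb e z) = gw e z * f (1, 0, 0) + Re z * gw e z * f (0, 1, 0) + Im z * gw e z * f (0, 0, 1)" for z
  proof -
    have "emb e z = gw e z *\<^sub>R (1, 0, 0) + (Re z * gw e z) *\<^sub>R (0, 1, 0) + (Im z * gw e z) *\<^sub>R (0, 0, 1)"
      by (simp add: emb_def)
    then show ?thesis by (simp only: f.add f.scaleR real_scaleR_def)
  qed
  moreover have "zpoly (\<lambda>z. of_real (f (1, 0, 0)) + of_real (f (0, 1, 0)) * of_real (Re z) + of_real (f (0, 0, 1)) * of_real (Im z))"
    by (intro zpoly_add zpoly_cmult zpoly_const zpoly_Re zpoly_Im)
  from wspan_base[OF this, of e 0]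
  have "wspan e (\<lambda>z. of_real (gw e z * f (1, 0, 0) + Re z * gw e z * f (0, 1, 0) + Im z * gw e z * f (0, 0, 1)))"
    by (simp add: algebra_simps)
  ultimately show ?case by (simp add: f.zero)
next
  case (const c)
  then show ?case by (simp add: wspan_0)
next
  case (add f g)
  then have "wspan e (\<lambda>z. of_real (f (emb e z) - f 0) + of_real (g (emb e z) - g 0))"
    by (intro wspan_add)
  then show ?case by (simp add: algebra_simps)
next
  case (mult f g)
  \<comment> \<open>Expansion of a product around the values at 0:
    \<open>F G - f g = (F - f) (G - g) + g (F - f) + f (G - g)\<close>.\<close>
  then have "wspan e (\<lambda>z. of_real (f (emb e z) - f 0) * of_real (g (emb e z) - g 0)
      + (of_real (g 0) * of_real (f (emb e z) - f 0) + of_real (f 0) * of_real (g (emb e z) - g 0)))"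
    by (intro wspan_add wspan_mult wspan_cmult)
  then show ?case by (simp add: algebra_simps)
qed

lemma emb_bounded:
  assumes "e > 0" shows "\<exists>R. \<forall>z. emb e z \<in> cball 0 R"
proof -
  obtain B where B: "\<And>z. cmod (z * of_real (gw e z)) \<le> B" using slow_gw_bounded[OF slow_id assms] by blast
  have "norm (emb e z) \<le> 1 + B + B" for z
  proof -
    have zB: "cmod z * gw e z \<le> B" using B[of z] by (simp add: norm_mult)
    have "norm (emb e z) \<le> norm (gw e z) + (norm (Re z * gw e z) + norm (Im z * gw e z))"
      unfolding emb_def by (rule order_trans[OF norm_Pair_le add_left_mono[OF norm_Pair_le]])
    moreover have "norm (Re z * gw e z) \<le> cmod z * gw e z" "norm (Im z * gw e z) \<le> cmod z * gw e z"
      using abs_Re_le_cmod[of z] abs_Im_le_cmod[of z] by (auto simp: abs_mult intro!: mult_right_mono)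
    ultimately show ?thesis using zB gw_le_1[of e z] assms by simp
  qed
  then show ?thesis by (intro exI[of _ "1 + B + B"]) simp
qed

text \<open>Uniform approximation of \<open>\<psi>\<close> by a polynomial on a ball containing the
  image of the embedding; orthogonality kills the polynomial part and the error is paid by the L^1
  norm of \<open>g\<close>.\<close>

lemma integral_eq_0_if_orthogonal_wspan:
  assumes g: "integrable gauss g" and e: "e > 0"
    and o: "\<And>p k. zpoly p \<Longrightarrow> (\<integral>z. g z * (p z * of_real (gw e z) ^ Suc k) \<partial>gauss) = 0"
    and \<psi>: "continuous_on UNIV \<psi>" "\<psi> 0 = 0"
  shows "(\<integral>z. g z * of_real (\<psi> (emb e z)) \<partial>gauss) = 0"
proof -
  have [measurable]: "g \<in> borel_measurable borel"
    using g by (simp add: integrable_iff_bounded cong: measurable_cong_sets)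
  obtain R where R: "\<And>z. emb e z \<in> cball 0 R" using emb_bounded[OF e] by blast
  have R0: "0 \<in> cball (0::real\<times>real\<times>real) R" using R[of 0] order_trans[OF norm_ge_zero] by auto
  have embc: "continuous_on UNIV (emb e)" unfolding emb_def by (intro continuous_intros continuous_gw)
  have int_mult: "integrable gauss (\<lambda>z. g z * q z)" if "slow q" "\<And>z. cmod (q z) \<le> B" for q B
    by (rule integrable_mult_bounded[OF g slow_measurable[OF that(1)] that(2)])
  have wb: "slow q \<and> (\<exists>B. \<forall>z. cmod (q z) \<le> B)" if "wspan e q" for q
    using that
  proof (induct rule: wspan.induct)
    case (wspan_base p k)
    have "slow (\<lambda>z. p z * of_real (gw (real (Suc k) * e) z))"
      using wspan_base e by (intro slow_mult slow_zpoly slow_gw) auto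
    moreover have "\<exists>B. \<forall>z. cmod (p z * of_real (gw (real (Suc k) * e) z)) \<le> B"
      using wspan_base e by (intro slow_gw_bounded slow_zpoly) auto
    ultimately show ?case by (simp only: gw_power of_real_power[symmetric] simp_thms)
  next
    case (wspan_add f g)
    then obtain B1 B2 where "\<And>z. cmod (f z) \<le> B1" "\<And>z. cmod (g z) \<le> B2" by blast
    then have "cmod (f z + g z) \<le> B1 + B2" for z by (meson norm_triangle_mono)
    with wspan_add show ?case by (blast intro: slow_add)
  qed
  have wz: "(\<integral>z. g z * q z \<partial>gauss) = 0" if "wspan e q" for q
    using that
  proof (induct rule: wspan.induct)
    case (wspan_base p k)
    then show ?case by (rule o)
  next
    case (wspan_add q1 q2)
    obtain B1 B2 where "slow q1" "slow q2" "\<And>z. cmod (q1 z) \<le> B1" "\<And>z. cmod (q2 z) \<le> B2"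
      using wb wspan_add(1,3) by blast
    then have "(\<integral>z. g z * q1 z + g z * q2 z \<partial>gauss) = 0"
      using wspan_add by (subst Bochner_Integration.integral_add) (auto intro: int_mult)
    then show ?case by (simp only: distrib_left)
  qed
  have "cmod (\<integral>z. g z * of_real (\<psi> (emb e z)) \<partial>gauss) \<le> d * (\<integral>z. cmod (g z) \<partial>gauss)" if d: "d > 0" for d
  proof -
    \<comment> \<open>Half of \<open>d\<close>, since replacing \<open>P\<close> by
      \<open>P - P 0\<close> adds the error at 0 to the error at the point.\<close>
    obtain P where P: "real_polynomial_function P" "\<And>x. x \<in> cball 0 R \<Longrightarrow> \<bar>\<psi> x - P x\<bar> < d / 2"
      using Stone_Weierstrass_real_polynomial_function[OF compact_cball continuous_on_subset[OF \<psi>(1)], of 0 R "d/2"] d by auto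
    define q where "q z = complex_of_real (P (emb e z) - P 0)" for z
    have q: "wspan e q" unfolding q_def by (rule wspan_real_polynomial[OF P(1)])
    obtain B where qb: "slow q" "\<And>z. cmod (q z) \<le> B" using wb[OF q] by blast
    have close: "cmod (of_real (\<psi> (emb e z)) - q z) \<le> d" for z
    proof -
      have "\<bar>\<psi> (emb e z) - P (emb e z)\<bar> < d / 2" "\<bar>\<psi> 0 - P 0\<bar> < d / 2" using P(2) R R0 by auto
      then have "\<bar>\<psi> (emb e z) - (P (emb e z) - P 0)\<bar> \<le> d" using \<psi>(2) by linarith
      then show ?thesis unfolding q_def of_real_diff[symmetric] norm_of_real .
    qed
    have cpsi: "continuous_on UNIV (\<lambda>z. complex_of_real (\<psi> (emb e z)))"
      by (intro continuous_intros continuous_on_compose2[OF \<psi>(1) embc]) auto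
    have psi_b: "cmod (of_real (\<psi> (emb e z))) \<le> d + B" for z
      using norm_triangle_sub[of "of_real (\<psi> (emb e z))" "q z"] close[of z] qb(2)[of z] by linarith
    have psi_s: "slow (\<lambda>z. of_real (\<psi> (emb e z)))" by (rule slow_bounded[OF cpsi psi_b])
    have "(\<integral>z. g z * of_real (\<psi> (emb e z)) \<partial>gauss) = (\<integral>z. g z * of_real (\<psi> (emb e z)) \<partial>gauss) - (\<integral>z. g z * q z \<partial>gauss)"
      using wz[OF q] by simp
    also have "\<dots> = (\<integral>z. g z * of_real (\<psi> (emb e z)) - g z * q z \<partial>gauss)"
      by (rule Bochner_Integration.integral_diff[symmetric]) (rule int_mult[OF psi_s psi_b] int_mult[OF qb])+
    also have "\<dots> = (\<integral>z. g z * (of_real (\<psi> (emb e z)) - q z) \<partial>gauss)" by (simp only: right_diff_distrib)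
    also have "cmod \<dots> \<le> (\<integral>z. cmod (g z * (of_real (\<psi> (emb e z)) - q z)) \<partial>gauss)" by (rule integral_norm_bound)
    also have "\<dots> \<le> (\<integral>z. d * cmod (g z) \<partial>gauss)"
    proof (rule integral_mono)
      show "integrable gauss (\<lambda>z. cmod (g z * (of_real (\<psi> (emb e z)) - q z)))"
        by (intro integrable_norm int_mult[OF slow_diff[OF psi_s qb(1)] close])
      show "cmod (g z * (of_real (\<psi> (emb e z)) - q z)) \<le> d * cmod (g z)" for z
        unfolding norm_mult mult.commute[of d] by (intro mult_left_mono close) auto
    qed (use g in auto)
    also have "\<dots> = d * (\<integral>z. cmod (g z) \<partial>gauss)" by simp
    finally show ?thesis .
  qed
  note bound = this
  define N where "N = (\<integral>z. cmod (g z) \<partial>gauss)"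
  have N: "N \<ge> 0" unfolding N_def by simp
  have "cmod (\<integral>z. g z * of_real (\<psi> (emb e z)) \<partial>gauss) \<le> 0 + d" if "d > 0" for d
  proof -
    \<comment> \<open>Dividing by \<open>N + 1\<close> avoids the case of a vanishing L^1
      norm.\<close>
    have "cmod (\<integral>z. g z * of_real (\<psi> (emb e z)) \<partial>gauss) \<le> d / (N + 1) * N"
    proof -
      have "d / (N + 1) > 0" using N that by (intro divide_pos_pos) auto
      from bound[OF this] show ?thesis by (simp only: N_def)
    qed
    also have "\<dots> \<le> d" using N that by (simp add: field_simps)
    finally show ?thesis by simp
  qed
  then have "cmod (\<integral>z. g z * of_real (\<psi> (emb e z)) \<partial>gauss) \<le> 0" by (rule field_le_epsilon)
  then show ?thesis by simp
qed

text \<open>The point \<open>z\<close> is recovered from the embedding by dividing by its first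
  coordinate, which is singular at 0. Cutting the weight off below \<open>d n\<close> yields a
  continuous function there, and \<open>d n\<close> tends to 0.\<close>

lemma integral_eq_0_against_continuous:
  assumes g: "integrable gauss g" and e: "e > 0"
    and o: "\<And>p k. zpoly p \<Longrightarrow> (\<integral>z. g z * (p z * of_real (gw e z) ^ Suc k) \<partial>gauss) = 0"
    and \<phi>: "continuous_on UNIV \<phi>" "\<And>z. \<bar>\<phi> z\<bar> \<le> (1::real)"
  shows "(\<integral>z. g z * of_real (gw e z * \<phi> z) \<partial>gauss) = 0"
proof -
  have [measurable]: "g \<in> borel_measurable borel" "\<phi> \<in> borel_measurable borel"
    using g by (simp_all add: integrable_iff_bounded borel_measurable_continuous_onI \<phi> cong: measurable_cong_sets)
  define d where "d n = 1 / real (Suc n)" for n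
  have d: "d n > 0" for n by (simp add: d_def)
  have d0: "d \<longlonglongrightarrow> 0" unfolding d_def by (rule lim_1_over_n[THEN LIMSEQ_Suc])
  have z: "(\<integral>z. g z * of_real (max 0 (gw e z - d n) * \<phi> z) \<partial>gauss) = 0" for n
  proof -
    \<comment> \<open>The first factor vanishes when \<open>s \<le> d n\<close>; elsewhere
      \<open>max s (d n) = s\<close>, so the quotients are exactly the coordinates of
      \<open>z\<close>.\<close>
    define \<psi> where "\<psi> = (\<lambda>(s, t, u). max 0 (s - d n) * \<phi> (Complex (t / max s (d n)) (u / max s (d n))))"
    have nz: "max s (d n) \<noteq> 0" for s using d[of n] by (simp add: max_def)
    have "continuous_on UNIV \<psi>"
      unfolding \<psi>_def case_prod_unfold
      by (intro continuous_intros continuous_on_compose2[OF \<phi>(1)]) (auto simp: nz)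
    moreover have "\<psi> 0 = 0" using d[of n] by (simp add: \<psi>_def zero_prod_def)
    ultimately have "(\<integral>z. g z * of_real (\<psi> (emb e z)) \<partial>gauss) = 0"
      by (intro integral_eq_0_if_orthogonal_wspan[OF g e o])
    moreover have "\<psi> (emb e z) = max 0 (gw e z - d n) * \<phi> z" for z
    proof (cases "gw e z \<le> d n")
      case False
      have "gw e z \<noteq> 0" using gw_pos(1)[of e z] by linarith
      then show ?thesis using False by (simp add: \<psi>_def emb_def max_def)
    qed (simp add: \<psi>_def emb_def)
    ultimately show ?thesis by simp
  qed
  have "(\<lambda>n. \<integral>z. g z * of_real (max 0 (gw e z - d n) * \<phi> z) \<partial>gauss) \<longlonglongrightarrow> (\<integral>z. g z * of_real (gw e z * \<phi> z) \<partial>gauss)"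
  proof (rule integral_dominated_convergence)
    show "integrable gauss (\<lambda>z. cmod (g z))" using g by simp
    show "AE z in gauss. (\<lambda>n. g z * of_real (max 0 (gw e z - d n) * \<phi> z)) \<longlonglongrightarrow> g z * of_real (gw e z * \<phi> z)"
    proof (rule AE_I2)
      fix z
      have "(\<lambda>n. max 0 (gw e z - d n)) \<longlonglongrightarrow> max 0 (gw e z - 0)" by (intro tendsto_intros d0)
      then show "(\<lambda>n. g z * of_real (max 0 (gw e z - d n) * \<phi> z)) \<longlonglongrightarrow> g z * of_real (gw e z * \<phi> z)"
        by (intro tendsto_intros) (simp add: max_def)
    qed
    show "AE z in gauss. norm (g z * of_real (max 0 (gw e z - d n) * \<phi> z)) \<le> cmod (g z)" for n
    proof (rule AE_I2)
      fix z
      have "\<bar>max 0 (gw e z - d n)\<bar> \<le> 1" using gw_le_1[of e z] d[of n] e by auto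
      then have "\<bar>max 0 (gw e z - d n) * \<phi> z\<bar> \<le> 1 * 1"
        unfolding abs_mult by (intro mult_mono \<phi>) auto
      then show "norm (g z * of_real (max 0 (gw e z - d n) * \<phi> z)) \<le> cmod (g z)"
        unfolding norm_mult norm_of_real by (simp add: mult_left_le)
    qed
  qed measurable
  then show ?thesis unfolding z by (simp add: LIMSEQ_const_iff)
qed

text \<open>Continuous test functions approximate indicators of open sets, a Dynkin argument extends
  this to Borel sets, and a function with zero integral over every Borel set vanishes a.e. The
  weight is then divided out.\<close>

lemma AE_eq_0_if_orthogonal_wspan:
  assumes g: "integrable gauss g" and e: "e > 0"
    and o: "\<And>p k. zpoly p \<Longrightarrow> (\<integral>z. g z * (p z * of_real (gw e z) ^ Suc k) \<partial>gauss) = 0"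
  shows "ae_eq g (\<lambda>_. 0)"
proof -
  have gm [measurable]: "g \<in> borel_measurable borel"
    using g by (simp_all add: integrable_iff_bounded cong: measurable_cong_sets)
  define h where "h z = g z * of_real (gw e z)" for z
  have [measurable]: "h \<in> borel_measurable borel" unfolding h_def by measurable
  have h: "integrable gauss h"
  proof (rule Bochner_Integration.integrable_bound[OF g])
    show "AE z in gauss. norm (h z) \<le> norm (g z)"
      using gw_le_1 e by (intro AE_I2) (simp add: h_def norm_mult mult_left_le)
  qed measurable
  have all: "(\<integral>z. h z \<partial>gauss) = 0"
    using integral_eq_0_against_continuous[OF g e o, of "\<lambda>_. 1"] by (simp add: h_def)
  have open_set: "(LINT z:U|gauss. h z) = 0" if U: "open U" for U
  \<comment> \<open>The distance to an empty set is 0 by convention, so the whole plane is treated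
    apart.\<close>
  proof (cases "U = UNIV")
    case True then show ?thesis using all by (simp add: set_lebesgue_integral_def)
  next
    case False
    then have ne: "- U \<noteq> {}" by auto
    \<comment> \<open>These truncated distances to the complement increase to the indicator of
      \<open>U\<close>.\<close>
    define \<phi> where "\<phi> n z = min 1 (real n * infdist z (- U))" for n z
    have c: "continuous_on UNIV (\<phi> n)" for n unfolding \<phi>_def by (intro continuous_intros)
    have [measurable]: "\<phi> n \<in> borel_measurable borel" for n by (intro borel_measurable_continuous_onI c)
    have b: "\<bar>\<phi> n z\<bar> \<le> 1" for n z by (simp add: \<phi>_def infdist_nonneg)
    have [measurable]: "U \<in> sets borel" using U by auto
    have "(\<lambda>n. \<integral>z. h z * of_real (\<phi> n z) \<partial>gauss) \<longlonglongrightarrow> (\<integral>z. indicator U z *\<^sub>R h z \<partial>gauss)"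
    proof (rule integral_dominated_convergence)
      show "integrable gauss (\<lambda>z. cmod (h z))" using h by simp
      show "AE z in gauss. (\<lambda>n. h z * of_real (\<phi> n z)) \<longlonglongrightarrow> indicator U z *\<^sub>R h z"
      proof (rule AE_I2)
        fix z
        have "(\<lambda>n. \<phi> n z) \<longlonglongrightarrow> indicator U z"
        proof (cases "z \<in> U")
          case True
          have "infdist z (- U) > 0"
            using True U ne infdist_pos_not_in_closed[of "- U" z] by auto
          then obtain N where N: "1 < real N * infdist z (- U)" using reals_Archimedean3 by blast
          have "eventually (\<lambda>n. real n * infdist z (- U) \<ge> 1) sequentially"
          proof (rule eventually_sequentiallyI[of N])
            fix n assume "N \<le> n"
            then have "real N * infdist z (- U) \<le> real n * infdist z (- U)"
              by (intro mult_right_mono) (auto simp: infdist_nonneg)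
            with N show "1 \<le> real n * infdist z (- U)" by linarith
          qed
          then have "eventually (\<lambda>n. \<phi> n z = 1) sequentially" by eventually_elim (simp add: \<phi>_def)
          then show ?thesis using True by (simp add: tendsto_eventually)
        next
          case False
          then have "infdist z (- U) = 0" by (intro infdist_zero) auto
          then show ?thesis using False by (simp add: \<phi>_def)
        qed
        then have "(\<lambda>n. h z * of_real (\<phi> n z)) \<longlonglongrightarrow> h z * of_real (indicator U z)" by (intro tendsto_intros)
        then show "(\<lambda>n. h z * of_real (\<phi> n z)) \<longlonglongrightarrow> indicator U z *\<^sub>R h z"
          by (simp add: scaleR_conv_of_real mult.commute)
      qed
      show "AE z in gauss. norm (h z * of_real (\<phi> n z)) \<le> cmod (h z)" for n
        using b[of n] by (intro AE_I2) (simp add: norm_mult mult_left_le)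
    qed measurable
    moreover have "(\<integral>z. h z * of_real (\<phi> n z) \<partial>gauss) = 0" for n
      using integral_eq_0_against_continuous[OF g e o c b, of n] by (simp add: h_def mult.assoc)
    ultimately show ?thesis by (simp add: set_lebesgue_integral_def LIMSEQ_const_iff)
  qed
  have si: "set_integrable gauss A h" if "A \<in> sets gauss" for A
    unfolding set_integrable_def by (rule integrable_mult_indicator[OF that h])
  have zero: "(LINT z:A|gauss. h z) = 0" if "A \<in> sets gauss" for A
  proof -
    have A: "A \<in> sigma_sets UNIV {S. open S}" using that by (simp add: borel_def)
    have sets: "B \<in> sets gauss" if "B \<in> sigma_sets UNIV {S. open S}" for B
      using that by (simp add: borel_def)
    have "Int_stable {S::complex set. open S}" "{S::complex set. open S} \<subseteq> Pow UNIV"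
      by (auto simp: Int_stable_def)
    then show ?thesis using A
    proof (induct A rule: sigma_sets_induct_disjoint)
      case (basic A) then show ?case using open_set by simp
    next
      case empty then show ?case by (simp add: set_lebesgue_integral_def)
    next
      case (compl A)
      have "(LINT z:(UNIV - A) \<union> A|gauss. h z) = (LINT z:UNIV - A|gauss. h z) + (LINT z:A|gauss. h z)"
        using sets[OF compl(1)] by (intro set_integral_Un si) auto
      then show ?case using compl all by (simp add: set_lebesgue_integral_def)
    next
      case (union A)
      then have m: "A i \<in> sets gauss" for i using sets by blast
      have "(LINT z:(\<Union>i. A i)|gauss. h z) = (\<Sum>i. (LINT z:(A i)|gauss. h z))"
        using union(1) m by (intro lebesgue_integral_countable_add si) (auto simp: disjoint_family_on_def)
      then show ?case using union(3) by simp
    qed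
  qed
  have "AE z in gauss. h z = 0" by (rule gauss.density_zero[OF h zero])
  then show ?thesis
    unfolding ae_eq_def by eventually_elim (auto simp: h_def)
qed

text \<open>Squaring the growing weight costs \<open>|z|^2 / 4\<close> and the polynomial another
  \<open>|z|^2 / 8\<close>; the Gaussian exponent \<open>|z|^2 / 2\<close> still leaves
  \<open>|z|^2 / 8\<close>.\<close>

lemma L2_zpoly_exp:
  assumes "zpoly p"
  shows "Lp 2 (\<lambda>z. p z * of_real (gw (-1/8) z))"
proof -
  have s: "slow (\<lambda>z. p z ^ 2)" by (intro slow_power slow_zpoly assms)
  note [measurable] = slow_measurable[OF slow_zpoly[OF assms]]
  obtain C k where C: "C > 0" "\<And>z. cmod (p z ^ 2) \<le> C * (1 + cmod z) ^ k" using slowE[OF s] by blast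
  obtain K :: real where K: "K > 0" "\<And>x. x \<ge> 0 \<Longrightarrow> (1 + x) ^ k \<le> K * exp (1/8 * x\<^sup>2)"
    using poly_le_exp_square[of "1/8" k] by (metis divide_pos_pos zero_less_numeral zero_less_one)
  have "integrable lborel (\<lambda>z. gden z *\<^sub>R (cmod (p z * of_real (gw (-1/8) z)))\<^sup>2)"
  proof (rule Bochner_Integration.integrable_bound)
    show "integrable lborel (\<lambda>z::complex. 1 / (2 * pi) * C * K * exp (- (1/8 * (cmod z)\<^sup>2)))"
      by (intro integrable_mult_right integrable_gaussian_complex) auto
    show "AE z in lborel. norm (gden z *\<^sub>R (cmod (p z * of_real (gw (-1/8) z)))\<^sup>2) \<le> norm (1 / (2 * pi) * C * K * exp (- (1/8 * (cmod z)\<^sup>2)))"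
    proof (rule AE_I2)
      fix z
      have "norm (gden z *\<^sub>R (cmod (p z * of_real (gw (-1/8) z)))\<^sup>2) = gden z * (gw (-1/8) z)\<^sup>2 * cmod (p z ^ 2)"
        by (simp add: norm_mult norm_power power_mult_distrib)
      also have "\<dots> \<le> gden z * (gw (-1/8) z)\<^sup>2 * (C * (K * exp (1/8 * (cmod z)\<^sup>2)))"
        by (intro mult_left_mono order_trans[OF C(2)] K) (use C in auto)
      also have "\<dots> = 1 / (2 * pi) * C * K * (exp (- (cmod z)\<^sup>2 / 2) * exp (1/4 * (cmod z)\<^sup>2) * exp (1/8 * (cmod z)\<^sup>2))"
        by (simp add: gden_def gw_def power2_eq_square exp_add[symmetric])
      also have "exp (- (cmod z)\<^sup>2 / 2) * exp (1/4 * (cmod z)\<^sup>2) * exp (1/8 * (cmod z)\<^sup>2) = exp (- (1/8 * (cmod z)\<^sup>2))"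
        unfolding exp_add[symmetric] by simp
      finally show "norm (gden z *\<^sub>R (cmod (p z * of_real (gw (-1/8) z)))\<^sup>2) \<le> norm (1 / (2 * pi) * C * K * exp (- (1/8 * (cmod z)\<^sup>2)))"
        using C K by simp
    qed
  qed measurable
  then have "integrable gauss (\<lambda>z. (cmod (p z * of_real (gw (-1/8) z)))\<^sup>2)"
    by (subst integrable_gauss_iff) auto
  then show ?thesis by (simp add: Lp_iff)
qed

text \<open>The Taylor partial sums of the weight are polynomials, so each integral is 0. They are
  dominated by the same series with positive signs, and \<open>L2_zpoly_exp\<close> makes this an
  integrable majorant.\<close>

lemma orthogonal_times_gw:
  assumes h: "Lp 2 h" and o: "\<And>p. zpoly p \<Longrightarrow> (\<integral>z. h z * p z \<partial>gauss) = 0" and p: "zpoly p"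
  shows "(\<integral>z. h z * of_real (gw (1/8) z) * p z \<partial>gauss) = 0"
proof -
  define s where "s N z = (\<Sum>n<N. (complex_of_real (1/fact n)) * (-1/8 * (z * cnj z)) ^ n)" for N z
  have sr: "s N z = of_real (\<Sum>n<N. (- (1/8 * (cmod z)\<^sup>2)) ^ n /\<^sub>R fact n)" for N z
  proof -
    have "-1/8 * (z * cnj z) = -1/8 * of_real ((cmod z)\<^sup>2)" by (simp only: complex_norm_square)
    also have "\<dots> = of_real (- (1/8 * (cmod z)\<^sup>2))" by simp
    finally have zz: "-1/8 * (z * cnj z) = of_real (- (1/8 * (cmod z)\<^sup>2))" .
    have "1 / fact n * y ^ n = y ^ n /\<^sub>R fact n" for y :: real and n by (simp add: divide_inverse)
    then show ?thesis
      unfolding s_def zz of_real_power[symmetric] of_real_mult[symmetric] of_real_sum[symmetric]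
      by (simp only:)
  qed
  have sp: "zpoly (s N)" for N
    unfolding s_def by (intro zpoly_sum zpoly_cmult zpoly_power zpoly_mult zpoly_id zpoly_cnj_id) auto
  note [measurable] = Lp_measurable[OF h] slow_measurable[OF slow_zpoly[OF sp]] slow_measurable[OF slow_zpoly[OF p]]
  have "(\<lambda>N. \<integral>z. h z * s N z * p z \<partial>gauss) \<longlonglongrightarrow> (\<integral>z. h z * of_real (gw (1/8) z) * p z \<partial>gauss)"
  proof (rule integral_dominated_convergence)
    show "integrable gauss (\<lambda>z. cmod (h z) * cmod (p z * of_real (gw (-1/8) z)))"
      by (intro L2_integrable_norm_mult h L2_zpoly_exp p)
    show "AE z in gauss. (\<lambda>N. h z * s N z * p z) \<longlonglongrightarrow> h z * of_real (gw (1/8) z) * p z"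
    proof (rule AE_I2)
      fix z
      have "(\<lambda>N. \<Sum>n<N. (- (1/8 * (cmod z)\<^sup>2)) ^ n /\<^sub>R fact n) \<longlonglongrightarrow> exp (- (1/8 * (cmod z)\<^sup>2))"
        using exp_converges[of "- (1/8 * (cmod z)\<^sup>2)"] by (simp only: sums_def)
      then show "(\<lambda>N. h z * s N z * p z) \<longlonglongrightarrow> h z * of_real (gw (1/8) z) * p z"
        unfolding sr gw_def by (intro tendsto_intros)
    qed
    show "AE z in gauss. norm (h z * s N z * p z) \<le> cmod (h z) * cmod (p z * of_real (gw (-1/8) z))" for N
    proof (rule AE_I2)
      fix z
      let ?x = "1/8 * (cmod z)\<^sup>2"
      have "cmod (s N z) = \<bar>\<Sum>n<N. (- ?x) ^ n /\<^sub>R fact n\<bar>" by (simp only: sr norm_of_real)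
      also have "\<dots> \<le> (\<Sum>n<N. ?x ^ n /\<^sub>R fact n)"
        by (rule order_trans[OF sum_abs]) (simp add: abs_mult power_abs)
      also have "\<dots> \<le> (\<Sum>n. ?x ^ n /\<^sub>R fact n)"
        by (rule sum_le_suminf[OF summable_exp_generic]) auto
      also have "\<dots> = gw (-1/8) z" by (simp add: gw_def exp_def)
      finally have "cmod (s N z) \<le> gw (-1/8) z" .
      then have "cmod (h z) * cmod (p z) * cmod (s N z) \<le> cmod (h z) * cmod (p z) * gw (-1/8) z"
        by (intro mult_left_mono) auto
      then show "norm (h z * s N z * p z) \<le> cmod (h z) * cmod (p z * of_real (gw (-1/8) z))"
        by (simp add: norm_mult mult_ac)
    qed
  qed measurable
  moreover have "(\<integral>z. h z * s N z * p z \<partial>gauss) = 0" for N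
    unfolding mult.assoc by (rule o) (intro zpoly_mult sp p)
  ultimately show ?thesis by (simp add: LIMSEQ_const_iff)
qed

lemma Lp_times_gw:
  assumes "Lp q f" "e \<ge> 0" shows "Lp q (\<lambda>z. f z * of_real (gw e z))"
proof -
  note [measurable] = Lp_measurable[OF assms(1)]
  have "integrable gauss (\<lambda>z. cmod (f z * of_real (gw e z)) ^ q)"
  proof (rule Bochner_Integration.integrable_bound[OF Lp_integrable[OF assms(1)]])
    show "AE z in gauss. norm (cmod (f z * of_real (gw e z)) ^ q) \<le> norm (cmod (f z) ^ q)"
      using gw_le_1[OF assms(2)] by (intro AE_I2) (auto simp: norm_mult mult_left_le intro!: power_mono)
  qed measurable
  then show ?thesis by (simp add: Lp_iff)
qed

lemma L2_complete_J:
  assumes f: "Lp 2 f" and o: "\<And>m n. inner_g f (J m n) = 0"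
  shows "ae_eq f (\<lambda>_. 0)"
proof (rule AE_eq_0_if_orthogonal_wspan[where e="1/8"])
  show "integrable gauss f" using Lp_2_imp_1[OF f] Lp_1_iff by blast
  have step: "(\<integral>z. f z * of_real (gw (1/8) z) ^ k * p z \<partial>gauss) = 0" if "zpoly p" for p k
    using that
  proof (induct k arbitrary: p)
    case 0
    then show ?case using orthogonal_zpoly[OF f o] by simp
  next
    case (Suc k)
    \<comment> \<open>The damped function is again in L^2 and, by induction hypothesis, orthogonal
      to polynomials, so one more factor can be attached.\<close>
    have "Lp 2 (\<lambda>z. f z * of_real (gw (real k * (1/8)) z))" by (rule Lp_times_gw[OF f]) simp
    then have "Lp 2 (\<lambda>z. f z * of_real (gw (1/8) z) ^ k)" by (simp only: gw_power of_real_power[symmetric])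
    from orthogonal_times_gw[OF this Suc(1) Suc(2)] show ?case by (simp only: power_Suc mult_ac)
  qed
  show "(\<integral>z. f z * (p z * of_real (gw (1/8) z) ^ Suc k) \<partial>gauss) = 0" if "zpoly p" for p k
    using step[OF that, of "Suc k"] by (simp only: mult_ac)
qed simp

interpretation J: L2_basis "\<lambda>(m, n). J m n"
proof
  show "Lp 2 (case i of (m, n) \<Rightarrow> J m n)" for i by (cases i) (simp add: J_L2)
  show "inner_g (case i of (m, n) \<Rightarrow> J m n) (case j of (m, n) \<Rightarrow> J m n) = (if i = j then 1 else 0)" for i j
    by (cases i, cases j) (simp add: inner_g_J)
  show "ae_eq f (\<lambda>_. 0)" if "Lp 2 f" "\<And>i. inner_g f (case i of (m, n) \<Rightarrow> J m n) = 0" for f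
    using that(2)[of "(_, _)"] by (intro L2_complete_J that(1)) simp
qed

section \<open>The operator and its closure\<close>

text \<open>Recognises the weight in \<open>domL\<close> as the squared modulus of the eigenvalue:
  the domain consists of those \<open>f\<close> whose formal image has square summable
  coefficients.\<close>

lemma eig_sq: "(cmod (eig \<theta> m n))\<^sup>2 = (real m)\<^sup>2 + (real n)\<^sup>2 + 2 * real m * real n * cos (2 * \<theta>)"
proof -
  have gen: "((a + b) * c)\<^sup>2 + ((a - b) * s)\<^sup>2 = (a\<^sup>2 + b\<^sup>2) * (s\<^sup>2 + c\<^sup>2) + 2 * a * b * (c\<^sup>2 - s\<^sup>2)" for a b c s :: real
    by (simp add: power2_eq_square algebra_simps)
  have "(cmod (eig \<theta> m n))\<^sup>2 = (real (m + n) * cos \<theta>)\<^sup>2 + ((real m - real n) * sin \<theta>)\<^sup>2"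
    unfolding cmod_power2 by (simp add: eig_def)
  also have "\<dots> = ((real m)\<^sup>2 + (real n)\<^sup>2) * ((sin \<theta>)\<^sup>2 + (cos \<theta>)\<^sup>2) + 2 * real m * real n * ((cos \<theta>)\<^sup>2 - (sin \<theta>)\<^sup>2)"
    unfolding of_nat_add by (rule gen)
  finally show ?thesis by (simp add: cos_double)
qed

lemma cnj_eig: "cnj (eig \<theta> m n) = eig (-\<theta>) m n"
  by (simp add: eig_def)

lemma domL_iff:
  "f \<in> domL \<theta> \<longleftrightarrow> Lp 2 f \<and> (\<lambda>(m, n). (cmod (- eig \<theta> m n * inner_g f (J m n)))\<^sup>2) summable_on UNIV"
  by (simp add: domL_def norm_mult power_mult_distrib eig_sq)

text \<open>The weight depends on \<open>\<theta>\<close> only through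
  \<open>cos (2 * \<theta>)\<close>, so the operator and its adjoint have the same domain.\<close>

lemma domL_uminus: "domL (-\<theta>) = domL \<theta>"
  by (simp add: domL_def)

lemma domL_L2: "f \<in> domL \<theta> \<Longrightarrow> Lp 2 f"
  by (simp add: domL_def)

lemma Lrel_iff_series:
  "Lrel \<theta> f g \<longleftrightarrow> f \<in> domL \<theta> \<and> Lp 2 g \<and>
     L2_series (\<lambda>(m, n). J m n) (\<lambda>(m, n). - eig \<theta> m n * inner_g f (J m n)) g"
proof -
  have "(\<lambda>z. g z + (\<Sum>(m, n)\<in>F. eig \<theta> m n * inner_g f (J m n) * J m n z))
    = (\<lambda>z. g z - (\<Sum>i\<in>F. (case i of (m, n) \<Rightarrow> - eig \<theta> m n * inner_g f (J m n)) * (case i of (m, n) \<Rightarrow> J m n) z))" for F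
    by (simp add: case_prod_unfold sum_negf)
  then show ?thesis unfolding Lrel_def L2_series_def by simp
qed

text \<open>Membership in the domain is implied by Bessel for \<open>g\<close>, so the graph is cut
  out by linear conditions on coefficients. Most later facts about the operator are read off from
  this form.\<close>

lemma Lrel_iff:
  "Lrel \<theta> f g \<longleftrightarrow> Lp 2 f \<and> Lp 2 g \<and> (\<forall>m n. inner_g g (J m n) = - eig \<theta> m n * inner_g f (J m n))"
proof safe
  assume L: "Lrel \<theta> f g"
  then show "Lp 2 f" "Lp 2 g" by (auto simp: Lrel_def domL_def)
  show "inner_g g (J m n) = - eig \<theta> m n * inner_g f (J m n)" for m n
    using L J.L2_series_coeff[of g "\<lambda>(m, n). - eig \<theta> m n * inner_g f (J m n)" "(m, n)"]
    unfolding Lrel_iff_series by simp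
next
  assume f: "Lp 2 f" and g: "Lp 2 g" and c: "\<forall>m n. inner_g g (J m n) = - eig \<theta> m n * inner_g f (J m n)"
  have "(\<lambda>(m, n). (cmod (- eig \<theta> m n * inner_g f (J m n)))\<^sup>2) summable_on UNIV"
    using J.Bessel_summable[OF g] c by (simp add: case_prod_unfold)
  then have "f \<in> domL \<theta>" using f by (simp add: domL_iff)
  moreover have "L2_series (\<lambda>(m, n). J m n) (\<lambda>(m, n). - eig \<theta> m n * inner_g f (J m n)) g"
    by (rule J.L2_series_of_coeff[OF g]) (use c in auto)
  ultimately show "Lrel \<theta> f g" using g by (simp add: Lrel_iff_series)
qed

lemma Lrel_L2: "Lrel \<theta> f g \<Longrightarrow> Lp 2 f" "Lrel \<theta> f g \<Longrightarrow> Lp 2 g"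
  by (auto simp: Lrel_iff)

lemma Lrel_domL: "Lrel \<theta> f g \<Longrightarrow> f \<in> domL \<theta>"
  by (simp add: Lrel_def)

lemma Lrel_ex:
  assumes "f \<in> domL \<theta>" shows "\<exists>g. Lrel \<theta> f g"
proof -
  have "(\<lambda>i. (cmod (case i of (m, n) \<Rightarrow> - eig \<theta> m n * inner_g f (J m n)))\<^sup>2) summable_on UNIV"
    using assms by (simp add: domL_iff case_prod_unfold)
  from J.L2_series_exists[OF this] show ?thesis using assms by (auto simp: Lrel_iff_series)
qed

lemma Lrel_Lop: "f \<in> domL \<theta> \<Longrightarrow> Lrel \<theta> f (Lop \<theta> f)"
  unfolding Lop_def by (rule someI_ex[OF Lrel_ex])

lemma Lop_L2: "f \<in> domL \<theta> \<Longrightarrow> Lp 2 (Lop \<theta> f)"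
  by (rule Lrel_L2(2)[OF Lrel_Lop])

lemma Lop_coeff: "f \<in> domL \<theta> \<Longrightarrow> inner_g (Lop \<theta> f) (J m n) = - eig \<theta> m n * inner_g f (J m n)"
  using Lrel_Lop Lrel_iff by blast

lemma coeff_eq_imp_ae_eq:
  "Lp 2 f \<Longrightarrow> Lp 2 g \<Longrightarrow> (\<And>m n. inner_g f (J m n) = inner_g g (J m n)) \<Longrightarrow> ae_eq f g"
  by (rule J.coeff_eq_imp_ae_eq) auto

text \<open>\<open>Lop\<close> is some representative; this says that every other one agrees with it
  a.e.\<close>

lemma Lrel_imp_Lop: assumes "Lrel \<theta> f g" shows "ae_eq (Lop \<theta> f) g"
proof -
  have "f \<in> domL \<theta>" using assms by (rule Lrel_domL)
  then show ?thesis using assms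
    by (intro coeff_eq_imp_ae_eq) (auto simp: Lop_L2 Lop_coeff Lrel_iff)
qed

lemma Lrel_linear:
  assumes "Lrel \<theta> f g" "Lrel \<theta> f' g'"
  shows "Lrel \<theta> (\<lambda>z. a * f z + b * f' z) (\<lambda>z. a * g z + b * g' z)"
  using assms unfolding Lrel_iff
  by (auto simp: inner_g_add_left inner_g_cmult_left Lp_cmult J_L2 algebra_simps intro!: Lp_add Lp_cmult)

lemma Lrel_cong:
  assumes "Lrel \<theta> f g" "ae_eq f f'" "Lp 2 f'"
  shows "Lrel \<theta> f' g"
  using assms inner_g_cong_AE_left[OF assms(2) Lp_measurable Lp_measurable Lp_measurable[OF J_L2]]
  unfolding Lrel_iff by metis

lemma Lrel_C2s: "C2s u \<Longrightarrow> Lrel \<theta> u (Ldiff \<theta> u)"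
  unfolding Lrel_iff by (auto simp: inner_g_Ldiff_J intro: slow_Lp slow_Ldiff C2s_D)

lemma domL_C2s: "C2s u \<Longrightarrow> u \<in> domL \<theta>"
  by (rule Lrel_domL[OF Lrel_C2s])

lemma Lop_C2s: "C2s u \<Longrightarrow> ae_eq (Lop \<theta> u) (Ldiff \<theta> u)"
  by (rule Lrel_imp_Lop[OF Lrel_C2s])

section \<open>Linearity, closedness, density, adjoint and normality\<close>

lemma lin_op_L: "lin_op (domL \<theta>) (Lop \<theta>)"
  unfolding lin_op_def
proof (intro conjI ballI allI impI)
  show "domL \<theta> \<subseteq> Collect (Lp 2)" by (auto simp: domL_L2)
  show "Lp 2 (Lop \<theta> f)" if "f \<in> domL \<theta>" for f by (rule Lop_L2[OF that])
  fix f assume f: "f \<in> domL \<theta>"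
  {
    fix g a b assume g: "g \<in> domL \<theta>"
    have R: "Lrel \<theta> (\<lambda>z. a * f z + b * g z) (\<lambda>z. a * Lop \<theta> f z + b * Lop \<theta> g z)"
      by (intro Lrel_linear Lrel_Lop f g)
    show "(\<lambda>z. a * f z + b * g z) \<in> domL \<theta>" by (rule Lrel_domL[OF R])
    show "ae_eq (Lop \<theta> (\<lambda>z. a * f z + b * g z)) (\<lambda>z. a * Lop \<theta> f z + b * Lop \<theta> g z)" by (rule Lrel_imp_Lop[OF R])
  }
  fix g assume "ae_eq f g" "Lp 2 g"
  then have R: "Lrel \<theta> g (Lop \<theta> f)" by (intro Lrel_cong[OF Lrel_Lop[OF f]])
  show "g \<in> domL \<theta>" by (rule Lrel_domL[OF R])
  show "ae_eq (Lop \<theta> f) (Lop \<theta> g)" by (rule ae_eq_sym[OF Lrel_imp_Lop[OF R]])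
qed

lemma inner_g_tendsto:
  assumes fs: "\<And>k. Lp 2 (fs k)" and f: "Lp 2 f" and h: "Lp 2 h"
    and lim: "(\<lambda>k. Lpnorm 2 (\<lambda>z. fs k z - f z)) \<longlonglongrightarrow> 0"
  shows "(\<lambda>k. inner_g (fs k) h) \<longlonglongrightarrow> inner_g f h"
proof (rule LIM_zero_cancel, rule Lim_null_comparison)
  show "eventually (\<lambda>k. norm (inner_g (fs k) h - inner_g f h) \<le> Lpnorm 2 (\<lambda>z. fs k z - f z) * Lpnorm 2 h) sequentially"
    using inner_g_Cauchy_Schwarz[OF Lp_diff[OF fs f] h]
    by (intro always_eventually allI) (simp add: inner_g_diff_left[OF fs f h])
  show "(\<lambda>k. Lpnorm 2 (\<lambda>z. fs k z - f z) * Lpnorm 2 h) \<longlonglongrightarrow> 0"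
    using tendsto_mult_right[OF lim, of "Lpnorm 2 h"] by simp
qed

text \<open>Each coefficient is L^2 continuous, so the relation between the coefficients of
  \<open>f\<close> and of its image passes to the limit.\<close>

lemma closed_op_L: "closed_op (domL \<theta>) (Lop \<theta>)"
  unfolding closed_op_def
proof (intro allI impI)
  fix fs f g
  assume fs: "\<forall>k. fs k \<in> domL \<theta>" and f: "Lp 2 f" and g: "Lp 2 g"
    and l1: "(\<lambda>k. Lpnorm 2 (\<lambda>z. fs k z - f z)) \<longlonglongrightarrow> 0"
    and l2: "(\<lambda>k. Lpnorm 2 (\<lambda>z. Lop \<theta> (fs k) z - g z)) \<longlonglongrightarrow> 0"
  have "inner_g g (J m n) = - eig \<theta> m n * inner_g f (J m n)" for m n
  proof (rule LIMSEQ_unique)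
    show "(\<lambda>k. inner_g (Lop \<theta> (fs k)) (J m n)) \<longlonglongrightarrow> inner_g g (J m n)"
      by (rule inner_g_tendsto[OF Lop_L2 g J_L2 l2]) (use fs in auto)
    have "(\<lambda>k. inner_g (fs k) (J m n)) \<longlonglongrightarrow> inner_g f (J m n)"
      by (rule inner_g_tendsto[OF domL_L2 f J_L2 l1]) (use fs in auto)
    then show "(\<lambda>k. inner_g (Lop \<theta> (fs k)) (J m n)) \<longlonglongrightarrow> - eig \<theta> m n * inner_g f (J m n)"
      using fs by (simp only: Lop_coeff) (intro tendsto_intros)
  qed
  with f g have R: "Lrel \<theta> f g" by (simp add: Lrel_iff)
  then show "f \<in> domL \<theta> \<and> ae_eq (Lop \<theta> f) g" using Lrel_domL Lrel_imp_Lop by blast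
qed

text \<open>The Hermite series of \<open>\<phi>\<close> and of its image are truncated on one common
  finite index set; the second truncation is then the image of the first.\<close>

lemma graph_core:
  assumes \<phi>: "\<phi> \<in> domL \<theta>" and e: "e > 0"
  shows "\<exists>\<psi>. zpoly \<psi> \<and> Lpnorm 2 (\<lambda>z. \<phi> z - \<psi> z) + Lpnorm 2 (\<lambda>z. Lop \<theta> \<phi> z - Lop \<theta> \<psi> z) < e"
proof -
  let ?E = "\<lambda>(m, n). J m n"
  define c where "c = (\<lambda>(m, n). inner_g \<phi> (J m n))"
  define d where "d = (\<lambda>(m, n). - eig \<theta> m n * inner_g \<phi> (J m n))"
  have \<phi>2: "Lp 2 \<phi>" by (rule domL_L2[OF \<phi>])
  have e2: "e / 2 > 0" using e by simp
  have s1: "L2_series ?E c \<phi>" by (rule J.L2_series_of_coeff[OF \<phi>2]) (auto simp: c_def)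
  have s2: "L2_series ?E d (Lop \<theta> \<phi>)" by (rule J.L2_series_of_coeff[OF Lop_L2[OF \<phi>]]) (auto simp: d_def Lop_coeff[OF \<phi>])
  obtain F1 where F1: "finite F1" "\<And>F. finite F \<Longrightarrow> F1 \<subseteq> F \<Longrightarrow> Lpnorm 2 (\<lambda>z. \<phi> z - (\<Sum>i\<in>F. c i * ?E i z)) < e / 2"
    using s1[unfolded L2_series_def, rule_format, OF e2] by auto
  obtain F2 where F2: "finite F2" "\<And>F. finite F \<Longrightarrow> F2 \<subseteq> F \<Longrightarrow> Lpnorm 2 (\<lambda>z. Lop \<theta> \<phi> z - (\<Sum>i\<in>F. d i * ?E i z)) < e / 2"
    using s2[unfolded L2_series_def, rule_format, OF e2] by auto
  define F where "F = F1 \<union> F2"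
  have F: "finite F" "F1 \<subseteq> F" "F2 \<subseteq> F" using F1 F2 by (auto simp: F_def)
  define \<psi> where "\<psi> z = (\<Sum>i\<in>F. c i * ?E i z)" for z
  define \<eta> where "\<eta> z = (\<Sum>i\<in>F. d i * ?E i z)" for z
  have p: "zpoly \<psi>" unfolding \<psi>_def using F(1) by (intro zpoly_sum zpoly_cmult) (auto intro: zpoly_J)
  have L2: "Lp 2 \<psi>" "Lp 2 \<eta>" unfolding \<psi>_def \<eta>_def by (rule J.sum_L2[OF F(1)])+
  have "inner_g \<psi> (J m n) = (if (m, n) \<in> F then c (m, n) else 0)" "inner_g \<eta> (J m n) = (if (m, n) \<in> F then d (m, n) else 0)" for m n
    unfolding \<psi>_def \<eta>_def using J.inner_sum_E[OF F(1), of c "(m, n)"] J.inner_sum_E[OF F(1), of d "(m, n)"] by auto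
  then have "Lrel \<theta> \<psi> \<eta>" unfolding Lrel_iff using L2 by (simp add: c_def d_def)
  then have ae: "ae_eq (Lop \<theta> \<psi>) \<eta>" and dom: "\<psi> \<in> domL \<theta>" by (auto intro: Lrel_imp_Lop Lrel_domL)
  have "Lpnorm 2 (\<lambda>z. Lop \<theta> \<phi> z - Lop \<theta> \<psi> z) = Lpnorm 2 (\<lambda>z. Lop \<theta> \<phi> z - \<eta> z)"
  proof (rule Lpnorm_cong_AE)
    show "ae_eq (\<lambda>z. Lop \<theta> \<phi> z - Lop \<theta> \<psi> z) (\<lambda>z. Lop \<theta> \<phi> z - \<eta> z)" using ae by (auto simp: ae_eq_def elim: eventually_mono)
  qed (intro Lp_measurable[of 2] Lp_diff Lop_L2 \<phi> dom L2)+
  moreover have "Lpnorm 2 (\<lambda>z. \<phi> z - \<psi> z) < e / 2" unfolding \<psi>_def by (rule F1(2)[OF F(1,2)])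
  moreover have "Lpnorm 2 (\<lambda>z. Lop \<theta> \<phi> z - \<eta> z) < e / 2" unfolding \<eta>_def by (rule F2(2)[OF F(1,3)])
  ultimately show ?thesis using p by (intro exI[of _ \<psi>]) auto
qed

lemma densely_defined_L: "densely_defined (domL \<theta>)"
  unfolding densely_defined_def
proof (intro allI impI)
  fix f and e :: real assume f: "Lp 2 f" and e: "e > 0"
  let ?E = "\<lambda>(m, n). J m n"
  define c where "c = (\<lambda>(m, n). inner_g f (J m n))"
  have s: "L2_series ?E c f" by (rule J.L2_series_of_coeff[OF f]) (auto simp: c_def)
  obtain F where F: "finite F" "Lpnorm 2 (\<lambda>z. f z - (\<Sum>i\<in>F. c i * ?E i z)) < e"
    using s[unfolded L2_series_def, rule_format, OF e] by auto
  have "zpoly (\<lambda>z. \<Sum>i\<in>F. c i * ?E i z)" using F(1) by (intro zpoly_sum zpoly_cmult) (auto intro: zpoly_J)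
  then show "\<exists>g\<in>domL \<theta>. Lpnorm 2 (\<lambda>z. f z - g z) < e"
    using F(2) by (intro bexI[of _ "\<lambda>z. \<Sum>i\<in>F. c i * ?E i z"] domL_C2s C2s_zpoly)
qed

text \<open>Parseval on both sides: the eigenvalue moves to the other factor as its conjugate, which
  is the eigenvalue at \<open>-\<theta>\<close>.\<close>

lemma inner_Lop_eq:
  assumes f: "f \<in> domL \<theta>" and R: "Lrel (-\<theta>) g h"
  shows "inner_g (Lop \<theta> f) g = inner_g f h"
proof -
  let ?E = "\<lambda>(m, n). J m n"
  have s1: "((\<lambda>i. inner_g (Lop \<theta> f) (?E i) * cnj (inner_g g (?E i))) has_sum inner_g (Lop \<theta> f) g) UNIV"
    by (rule J.has_sum_inner[OF Lop_L2[OF f] Lrel_L2(1)[OF R]])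
  have s2: "((\<lambda>i. inner_g f (?E i) * cnj (inner_g h (?E i))) has_sum inner_g f h) UNIV"
    by (rule J.has_sum_inner[OF domL_L2[OF f] Lrel_L2(2)[OF R]])
  have eq: "(\<lambda>i. inner_g (Lop \<theta> f) (?E i) * cnj (inner_g g (?E i))) = (\<lambda>i. inner_g f (?E i) * cnj (inner_g h (?E i)))"
    using R by (auto simp: Lrel_iff Lop_coeff[OF f] cnj_eig)
  show ?thesis by (rule has_sum_unique[OF s1[unfolded eq] s2])
qed

text \<open>Testing the adjoint identity on the eigenfunctions \<open>J m n\<close> alone already
  determines all coefficients of \<open>h\<close>.\<close>

lemma adjoint_iff:
  assumes g: "Lp 2 g" and h: "Lp 2 h"
  shows "(\<forall>f\<in>domL \<theta>. inner_g (Lop \<theta> f) g = inner_g f h) \<longleftrightarrow> Lrel (-\<theta>) g h"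
proof
  assume A: "\<forall>f\<in>domL \<theta>. inner_g (Lop \<theta> f) g = inner_g f h"
  have "inner_g h (J m n) = - eig (-\<theta>) m n * inner_g g (J m n)" for m n
  proof -
    have C: "C2s (J m n)" by (rule C2s_zpoly[OF zpoly_J])
    have "inner_g (J m n) h = inner_g (Lop \<theta> (J m n)) g" using A domL_C2s[OF C] by simp
    also have "\<dots> = inner_g (Ldiff \<theta> (J m n)) g"
      using C by (intro inner_g_cong_AE_left Lop_C2s Lp_measurable[OF g] Lp_measurable[OF Lop_L2[OF domL_C2s]]
        slow_measurable slow_Ldiff)
    also have "\<dots> = - eig \<theta> m n * inner_g (J m n) g"
      by (simp add: Ldiff_J[abs_def] inner_g_cmult_left[of "- eig \<theta> m n", simplified])
    finally have "cnj (inner_g (J m n) h) = cnj (- eig \<theta> m n * inner_g (J m n) g)" by simp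
    then show ?thesis by (simp add: inner_g_cnj cnj_eig)
  qed
  then show "Lrel (-\<theta>) g h" using g h by (simp add: Lrel_iff)
next
  assume "Lrel (-\<theta>) g h"
  then show "\<forall>f\<in>domL \<theta>. inner_g (Lop \<theta> f) g = inner_g f h" using inner_Lop_eq by simp
qed

lemma adj_dom_L: "adj_dom (domL \<theta>) (Lop \<theta>) = domL \<theta>"
proof -
  have "g \<in> adj_dom (domL \<theta>) (Lop \<theta>) \<longleftrightarrow> (\<exists>h. Lrel (-\<theta>) g h)" for g
  proof
    assume "g \<in> adj_dom (domL \<theta>) (Lop \<theta>)"
    then obtain h where "Lp 2 g" "Lp 2 h" "\<forall>f\<in>domL \<theta>. inner_g (Lop \<theta> f) g = inner_g f h"
      unfolding adj_dom_def by blast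
    then have "Lrel (-\<theta>) g h" using adjoint_iff by simp
    then show "\<exists>h. Lrel (-\<theta>) g h" by blast
  next
    assume "\<exists>h. Lrel (-\<theta>) g h"
    then obtain h where h: "Lrel (-\<theta>) g h" ..
    then have "Lp 2 g" "Lp 2 h" "\<forall>f\<in>domL \<theta>. inner_g (Lop \<theta> f) g = inner_g f h"
      using inner_Lop_eq[OF _ h] by (auto dest: Lrel_L2)
    then show "g \<in> adj_dom (domL \<theta>) (Lop \<theta>)" unfolding adj_dom_def by blast
  qed
  moreover have "(\<exists>h. Lrel (-\<theta>) g h) \<longleftrightarrow> g \<in> domL \<theta>" for g
    using Lrel_ex[of g "-\<theta>"] Lrel_domL[of "-\<theta>" g] by (auto simp: domL_uminus)
  ultimately show ?thesis by blast
qed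

lemma adj_op_L:
  assumes "g \<in> domL \<theta>"
  shows "Lrel (-\<theta>) g (adj_op (domL \<theta>) (Lop \<theta>) g)"
proof -
  have g: "Lp 2 g" by (rule domL_L2[OF assms])
  have "\<exists>h. Lp 2 h \<and> (\<forall>f\<in>domL \<theta>. inner_g (Lop \<theta> f) g = inner_g f h)"
    using assms adj_dom_L[of \<theta>] unfolding adj_dom_def by blast
  from someI_ex[OF this] have "Lp 2 (adj_op (domL \<theta>) (Lop \<theta>) g)"
    "\<forall>f\<in>domL \<theta>. inner_g (Lop \<theta> f) g = inner_g f (adj_op (domL \<theta>) (Lop \<theta>) g)"
    unfolding adj_op_def by auto
  then show ?thesis using adjoint_iff[OF g] by blast
qed

text \<open>Eigenvalue and conjugate have equal modulus, so the domains of both compositions agree;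
  on coefficients the two factors commute.\<close>

lemma normal_op_L: "normal_op (domL \<theta>) (Lop \<theta>)"
proof -
  define B where "B = adj_op (domL \<theta>) (Lop \<theta>)"
  have B: "Lrel (-\<theta>) g (B g)" if "g \<in> domL \<theta>" for g unfolding B_def by (rule adj_op_L[OF that])
  have Bc: "inner_g (B g) (J m n) = - cnj (eig \<theta> m n) * inner_g g (J m n)" if "g \<in> domL \<theta>" for g m n
    using B[OF that] by (simp add: Lrel_iff cnj_eig)
  have B2: "Lp 2 (B g)" if "g \<in> domL \<theta>" for g by (rule Lrel_L2(2)[OF B[OF that]])
  have eq: "B f \<in> domL \<theta> \<longleftrightarrow> Lop \<theta> f \<in> domL \<theta>" if "f \<in> domL \<theta>" for f
    unfolding domL_iff using that by (simp add: Bc Lop_coeff B2 Lop_L2 norm_mult)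
  have "ae_eq (Lop \<theta> (B f)) (B (Lop \<theta> f))" if "f \<in> domL \<theta>" "B f \<in> domL \<theta>" for f
    using that eq[OF that(1)] by (intro coeff_eq_imp_ae_eq) (auto simp: Lop_L2 B2 Lop_coeff Bc)
  then show ?thesis unfolding normal_op_def adj_dom_L B_def[symmetric] using eq by blast
qed

lemma one_L: "(\<lambda>_. 1) \<in> domL \<theta>" "ae_eq (Lop \<theta> (\<lambda>_. 1)) (\<lambda>_. 0)"
proof -
  have C: "C2s (\<lambda>_. 1)" by (rule C2s_zpoly[OF zpoly_const])
  show "(\<lambda>_. 1) \<in> domL \<theta>" by (rule domL_C2s[OF C])
  have d: "dd c (\<lambda>_. a) = (\<lambda>_. 0)" for c a by (rule hasd_imp_dd[OF hasd_const])
  have "Ldiff \<theta> (\<lambda>_. 1) = (\<lambda>_. 0)" by (rule ext) (simp add: Ldiff_def d)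
  then show "ae_eq (Lop \<theta> (\<lambda>_. 1)) (\<lambda>_. 0)" using Lop_C2s[OF C, of \<theta>] by simp
qed

section \<open>Damped polynomials and closability in L^1\<close>

lemma hasd_gw: "hasd c (\<lambda>z. of_real (gw e z)) (\<lambda>z. of_real (- 2 * e * Re (z * cnj c)) * of_real (gw e z))"
  unfolding gw_def by (rule hasd_gaussian)

lemma dd_zpoly_gw:
  assumes "zpoly p"
  shows "hasd c (\<lambda>z. p z * of_real (gw e z)) (\<lambda>z. (dd c p z - 2 * of_real e * of_real (Re (z * cnj c)) * p z) * of_real (gw e z))"
  by (rule hasd_cong[OF hasd_mult[OF zpoly_hasd(1)[OF assms] hasd_gw]]) (simp add: algebra_simps)

lemma zpoly_Re_cnj: "zpoly (\<lambda>z. of_real (Re (z * cnj c)))"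
proof -
  have "zpoly (\<lambda>z. of_real (Re c) * of_real (Re z) + of_real (Im c) * of_real (Im z))"
    by (intro zpoly_add zpoly_cmult zpoly_Re zpoly_Im)
  then show ?thesis by (simp add: algebra_simps)
qed

lemma C2s_zpoly_gw:
  assumes p: "zpoly p" and e: "e \<ge> 0"
  shows "C2s (\<lambda>z. p z * of_real (gw e z))"
proof -
  define q where "q c z = dd c p z - 2 * of_real e * of_real (Re (z * cnj c)) * p z" for c z
  have q: "zpoly (q c)" for c unfolding q_def
    by (intro zpoly_diff zpoly_mult zpoly_const zpoly_Re_cnj zpoly_hasd p)
  have d: "hasd c (\<lambda>z. p z * of_real (gw e z)) (\<lambda>z. q c z * of_real (gw e z))" for c
    unfolding q_def by (rule dd_zpoly_gw[OF p])
  have d2: "hasd c (\<lambda>z. q c z * of_real (gw e z)) (dd c (\<lambda>z. q c z * of_real (gw e z)))" for c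
    unfolding hasd_imp_dd[OF dd_zpoly_gw[OF q]] by (rule dd_zpoly_gw[OF q])
  have s: "slow (\<lambda>z. r z * of_real (gw e z))" if "zpoly r" for r
    by (intro slow_mult slow_zpoly that slow_gw e)
  have s2: "slow (dd c (\<lambda>z. q c z * of_real (gw e z)))" for c
    unfolding hasd_imp_dd[OF dd_zpoly_gw[OF q]]
    by (intro s zpoly_diff zpoly_mult zpoly_const zpoly_Re_cnj zpoly_hasd q)
  show ?thesis unfolding C2s_def
    using d d2 s2 s[OF p] s[OF q] by (simp add: hasd_imp_dd[OF d])
qed

text \<open>The polynomials \<open>r\<close> and \<open>s\<close> do not depend on \<open>e\<close>,
  which permits the limit \<open>e \<rightarrow> 0\<close>. The rotation annihilates the radial
  weight, so both carry only the factor \<open>cos \<theta>\<close>.\<close>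

lemma Ldiff_zpoly_gw:
  assumes p: "zpoly p"
  shows "\<exists>r s. zpoly r \<and> zpoly s \<and>
    (\<forall>e z. Ldiff \<theta> (\<lambda>z. p z * of_real (gw e z)) z = (Ldiff \<theta> p z + of_real e * r z + of_real (e\<^sup>2) * s z) * of_real (gw e z))"
proof (intro exI conjI allI)
  let ?n = "\<lambda>z. of_real (Re z) * of_real (Re z) + of_real (Im z) * of_real (Im z) :: complex"
  show "zpoly (\<lambda>z. of_real (cos \<theta>) * (- 4 * (of_real (Re z) * dd 1 p z + of_real (Im z) * dd \<i> p z) - 4 * p z + 2 * (?n z * p z)))"
    by (intro zpoly_mult zpoly_add zpoly_diff zpoly_const zpoly_Re zpoly_Im zpoly_hasd p)
  show "zpoly (\<lambda>z. of_real (cos \<theta>) * (4 * (?n z * p z)))"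
    by (intro zpoly_mult zpoly_add zpoly_const zpoly_Re zpoly_Im p)
  fix e z
  let ?x = "\<lambda>c z. complex_of_real (Re (z * cnj c))"
  define q where "q c z = dd c p z - 2 * of_real e * ?x c z * p z" for c z
  have q: "zpoly (q c)" for c unfolding q_def
    by (intro zpoly_diff zpoly_mult zpoly_const zpoly_Re_cnj zpoly_hasd p)
  have d1: "dd c (\<lambda>z. p z * of_real (gw e z)) = (\<lambda>z. q c z * of_real (gw e z))" for c
    unfolding q_def by (rule hasd_imp_dd[OF dd_zpoly_gw[OF p]])
  have dq: "dd c (q c) z = dd c (dd c p) z - 2 * of_real e * (of_real ((cmod c)\<^sup>2) * p z + ?x c z * dd c p z)" for c z
  proof -
    have "hasd c (\<lambda>z. of_real (Re (z * cnj c))) (\<lambda>_. of_real (Re (c * cnj c)))"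
      by (rule hasd_of_real_linear) (auto simp: linear_iff algebra_simps)
    then have h: "hasd c (\<lambda>z. dd c p z - 2 * of_real e * (?x c z * p z))
       (\<lambda>z. dd c (dd c p) z - 2 * of_real e * (of_real (Re (c * cnj c)) * p z + ?x c z * dd c p z))"
      by (intro hasd_diff hasd_cmult hasd_mult zpoly_hasd p)
    have c2: "Re (c * cnj c) = (cmod c)\<^sup>2" unfolding cmod_power2 by (simp add: power2_eq_square)
    have q': "q c = (\<lambda>z. dd c p z - 2 * of_real e * (?x c z * p z))" by (simp only: q_def[abs_def] mult.assoc)
    show ?thesis unfolding q' hasd_imp_dd[OF h] c2 ..
  qed
  have d2: "dd c (dd c (\<lambda>z. p z * of_real (gw e z))) z
     = (dd c (dd c p) z - 2 * of_real e * (of_real ((cmod c)\<^sup>2) * p z + ?x c z * dd c p z) - 2 * of_real e * ?x c z * q c z) * of_real (gw e z)" for c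
    unfolding d1 hasd_imp_dd[OF dd_zpoly_gw[OF q]] dq ..
  show "Ldiff \<theta> (\<lambda>z. p z * of_real (gw e z)) z = (Ldiff \<theta> p z + of_real e * (of_real (cos \<theta>) * (- 4 * (of_real (Re z) * dd 1 p z + of_real (Im z) * dd \<i> p z) - 4 * p z + 2 * (?n z * p z)))
      + of_real (e\<^sup>2) * (of_real (cos \<theta>) * (4 * (?n z * p z)))) * of_real (gw e z)"
    unfolding Ldiff_def d2 unfolding d1 q_def by (simp add: power2_eq_square) (simp add: algebra_simps)
qed

text \<open>The L^1 counterpart of \<open>inner_g_tendsto\<close>: a bounded test function takes the
  place of Cauchy-Schwarz.\<close>

lemma inner_bounded_tendsto:
  assumes fs: "\<And>k. Lp 1 (fs k)" and f: "Lp 1 f" and b: "b \<in> borel_measurable borel" "\<And>z. cmod (b z) \<le> B"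
    and lim: "(\<lambda>k. Lpnorm 1 (\<lambda>z. fs k z - f z)) \<longlonglongrightarrow> 0"
  shows "(\<lambda>k. inner_g (fs k) b) \<longlonglongrightarrow> inner_g f b"
proof (rule LIM_zero_cancel, rule Lim_null_comparison)
  have int: "integrable gauss (\<lambda>z. h z * cnj (b z))" if "Lp 1 h" for h
    using that b unfolding Lp_1_iff by (intro integrable_mult_bounded[where B=B] borel_measurable_cnj) auto
  show "eventually (\<lambda>k. norm (inner_g (fs k) b - inner_g f b) \<le> B * Lpnorm 1 (\<lambda>z. fs k z - f z)) sequentially"
  proof (intro always_eventually allI)
    fix k
    have "inner_g (fs k) b - inner_g f b = (\<integral>z. (fs k z - f z) * cnj (b z) \<partial>gauss)"
      unfolding inner_g_def left_diff_distrib by (rule Bochner_Integration.integral_diff[symmetric]) (intro int fs f)+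
    also have "cmod \<dots> \<le> (\<integral>z. cmod ((fs k z - f z) * cnj (b z)) \<partial>gauss)" by (rule integral_norm_bound)
    also have "\<dots> \<le> (\<integral>z. B * cmod (fs k z - f z) \<partial>gauss)"
    proof (rule integral_mono)
      show "integrable gauss (\<lambda>z. cmod ((fs k z - f z) * cnj (b z)))"
        by (intro integrable_norm int Lp_diff fs f)
      show "integrable gauss (\<lambda>z. B * cmod (fs k z - f z))"
        using Lp_diff[OF fs f, of k] by (simp only: Lp_1_iff) simp
      show "cmod ((fs k z - f z) * cnj (b z)) \<le> B * cmod (fs k z - f z)" for z
        using mult_right_mono[OF b(2)[of z], of "cmod (fs k z - f z)"] by (simp add: norm_mult mult.commute)
    qed
    also have "\<dots> = B * Lpnorm 1 (\<lambda>z. fs k z - f z)" unfolding Lpnorm_1_eq by simp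
    finally show "norm (inner_g (fs k) b - inner_g f b) \<le> B * Lpnorm 1 (\<lambda>z. fs k z - f z)" .
  qed
  show "(\<lambda>k. B * Lpnorm 1 (\<lambda>z. fs k z - f z)) \<longlonglongrightarrow> 0" using tendsto_mult_left[OF lim, of B] by simp
qed

text \<open>The adjoint identity holds along the approximating sequence. The damped polynomial and
  its image are both bounded, so both sides converge.\<close>

lemma A1rel_weak:
  assumes A: "A1rel \<theta> f g" and p: "zpoly p" and e: "e > 0"
  shows "inner_g g (\<lambda>z. p z * of_real (gw e z)) = inner_g f (Ldiff (-\<theta>) (\<lambda>z. p z * of_real (gw e z)))"
proof -
  let ?v = "\<lambda>z. p z * of_real (gw e z)"
  obtain fs where f: "Lp 1 f" and g: "Lp 1 g" and fs: "\<And>k. fs k \<in> domL \<theta>"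
    and l1: "(\<lambda>k. Lpnorm 1 (\<lambda>z. fs k z - f z)) \<longlonglongrightarrow> 0"
    and l2: "(\<lambda>k. Lpnorm 1 (\<lambda>z. Lop \<theta> (fs k) z - g z)) \<longlonglongrightarrow> 0"
    using A unfolding A1rel_def by blast
  have C: "C2s ?v" using p e by (intro C2s_zpoly_gw) auto
  obtain r s where rs: "zpoly r" "zpoly s"
    "\<And>z. Ldiff (-\<theta>) ?v z = (Ldiff (-\<theta>) p z + of_real e * r z + of_real (e\<^sup>2) * s z) * of_real (gw e z)"
    using Ldiff_zpoly_gw[OF p] by blast
  have q: "zpoly (\<lambda>z. Ldiff (-\<theta>) p z + of_real e * r z + of_real (e\<^sup>2) * s z)"
    by (intro zpoly_add zpoly_cmult zpoly_Ldiff p rs)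
  obtain B1 where B1: "\<And>z. cmod (?v z) \<le> B1" using slow_gw_bounded[OF slow_zpoly[OF p] e] by blast
  obtain B2 where B2: "\<And>z. cmod (Ldiff (-\<theta>) ?v z) \<le> B2"
    using slow_gw_bounded[OF slow_zpoly[OF q] e] unfolding rs(3) by blast
  have t1: "(\<lambda>k. inner_g (Lop \<theta> (fs k)) ?v) \<longlonglongrightarrow> inner_g g ?v"
    by (rule inner_bounded_tendsto[OF Lp_2_imp_1[OF Lop_L2[OF fs]] g slow_measurable[OF C2s_D(1)[OF C]] B1 l2])
  have t2: "(\<lambda>k. inner_g (fs k) (Ldiff (-\<theta>) ?v)) \<longlonglongrightarrow> inner_g f (Ldiff (-\<theta>) ?v)"
    by (rule inner_bounded_tendsto[OF Lp_2_imp_1[OF domL_L2[OF fs]] f slow_measurable[OF slow_Ldiff[OF C]] B2 l1])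
  have eq: "inner_g (Lop \<theta> (fs k)) ?v = inner_g (fs k) (Ldiff (-\<theta>) ?v)" for k
    by (rule inner_Lop_eq[OF fs Lrel_C2s[OF C]])
  show ?thesis by (rule LIMSEQ_unique[OF t1[unfolded eq] t2])
qed

text \<open>The weak identity fixes all pairings of the image with damped polynomials, and these
  separate L^1.\<close>

lemma A1rel_unique:
  assumes A1: "A1rel \<theta> f g1" and A2: "A1rel \<theta> f g2"
  shows "ae_eq g1 g2"
proof -
  have g: "Lp 1 g1" "Lp 1 g2" using A1 A2 by (auto simp: A1rel_def)
  then have gi: "integrable gauss g1" "integrable gauss g2" by (simp_all only: Lp_1_iff)
  have "ae_eq (\<lambda>z. g1 z - g2 z) (\<lambda>_. 0)"
  proof (rule AE_eq_0_if_orthogonal_wspan[where e=1])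
    show "integrable gauss (\<lambda>z. g1 z - g2 z)" using gi by simp
    fix p k assume p: "zpoly p"
    \<comment> \<open>Conjugating \<open>p\<close> undoes the conjugate in \<open>inner_g\<close>,
      and the power of the weight is merged into a single weight, the shape
      \<open>A1rel_weak\<close> expects.\<close>
    let ?v = "\<lambda>z. cnj (p z) * of_real (gw (real (Suc k)) z)"
    have vb: "\<exists>B. \<forall>z. cmod (?v z) \<le> B" by (intro slow_gw_bounded slow_zpoly zpoly_cnj p) simp
    then obtain B where B: "\<And>z. cmod (?v z) \<le> B" by blast
    have vm: "?v \<in> borel_measurable borel"
      by (intro slow_measurable slow_mult slow_zpoly zpoly_cnj p slow_gw) simp
    have int: "integrable gauss (\<lambda>z. h z * cnj (?v z))" if "integrable gauss h" for h
      using B by (intro integrable_mult_bounded[OF that borel_measurable_cnj[OF vm], of B])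
        (simp only: complex_mod_cnj)
    have "(\<integral>z. (g1 z - g2 z) * (p z * of_real (gw 1 z) ^ Suc k) \<partial>gauss) = (\<integral>z. g1 z * cnj (?v z) - g2 z * cnj (?v z) \<partial>gauss)"
      unfolding of_real_power[symmetric] gw_power by (simp add: algebra_simps)
    also have "\<dots> = inner_g g1 ?v - inner_g g2 ?v"
      unfolding inner_g_def by (intro Bochner_Integration.integral_diff int gi)
    also have "\<dots> = 0"
      using A1rel_weak[OF A1 zpoly_cnj[OF p], of "real (Suc k)"] A1rel_weak[OF A2 zpoly_cnj[OF p], of "real (Suc k)"] by simp
    finally show "(\<integral>z. (g1 z - g2 z) * (p z * of_real (gw 1 z) ^ Suc k) \<partial>gauss) = 0" .
  qed simp
  then show ?thesis by (simp add: ae_eq_def)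
qed

lemma inner_g_dominated_tendsto:
  assumes f: "Lp 2 f" and b: "\<And>k. slow (b k)" "slow b'" and B: "slow B"
    and le: "\<And>k z. cmod (b k z) \<le> cmod (B z)" and lim: "\<And>z. (\<lambda>k. b k z) \<longlonglongrightarrow> b' z"
  shows "(\<lambda>k. inner_g f (b k)) \<longlonglongrightarrow> inner_g f b'"
  unfolding inner_g_def
proof (rule integral_dominated_convergence)
  note [measurable] = Lp_measurable[OF f] slow_measurable[OF b(1)] slow_measurable[OF b(2)]
  show "(\<lambda>z. f z * cnj (b' z)) \<in> borel_measurable gauss" by measurable
  show "(\<lambda>z. f z * cnj (b k z)) \<in> borel_measurable gauss" for k by measurable
  show "integrable gauss (\<lambda>z. cmod (f z) * cmod (B z))" by (intro L2_integrable_norm_mult f slow_Lp B)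
  show "AE z in gauss. (\<lambda>k. f z * cnj (b k z)) \<longlonglongrightarrow> f z * cnj (b' z)"
    by (intro AE_I2 tendsto_intros lim)
  show "AE z in gauss. norm (f z * cnj (b k z)) \<le> cmod (f z) * cmod (B z)" for k
    using le by (intro AE_I2) (simp add: norm_mult mult_left_mono)
qed

text \<open>With \<open>f\<close> and \<open>g\<close> in L^2 the damping can be removed by
  dominated convergence; the weak identity at \<open>J m n\<close> is then the coefficient relation
  of \<open>Lrel_iff\<close>.\<close>

lemma A1rel_L2_imp_Lrel:
  assumes A: "A1rel \<theta> f g" and f: "Lp 2 f" and g: "Lp 2 g"
  shows "Lrel \<theta> f g"
proof -
  have weak: "inner_g g p = inner_g f (Ldiff (-\<theta>) p)" if p: "zpoly p" for p
  proof -
    obtain r s where rs: "zpoly r" "zpoly s"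
      "\<And>e z. Ldiff (-\<theta>) (\<lambda>z. p z * of_real (gw e z)) z = (Ldiff (-\<theta>) p z + of_real e * r z + of_real (e\<^sup>2) * s z) * of_real (gw e z)"
      using Ldiff_zpoly_gw[OF p] by blast
    \<comment> \<open>Values at most 1 bound the terms with \<open>r\<close> and \<open>s\<close> by
      a majorant independent of \<open>n\<close>.\<close>
    define e where "e n = 1 / real (Suc n)" for n
    have e: "e n > 0" "e n \<le> 1" for n by (auto simp: e_def)
    have e0: "e \<longlonglongrightarrow> 0" unfolding e_def by (rule lim_1_over_n[THEN LIMSEQ_Suc])
    have w1: "(\<lambda>n. complex_of_real (gw (e n) z)) \<longlonglongrightarrow> 1" for z
    proof -
      have "(\<lambda>n. complex_of_real (gw (e n) z)) \<longlonglongrightarrow> of_real (exp (- (0 * (cmod z)\<^sup>2)))"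
        unfolding gw_def by (intro tendsto_intros e0)
      then show ?thesis by simp
    qed
    have sg: "slow (\<lambda>z. complex_of_real (gw (e n) z))" for n using e by (intro slow_gw) (simp add: less_imp_le)
    have gle: "cmod (complex_of_real (gw (e n) z)) \<le> 1" for n z using gw_le_1[of "e n" z] e(1)[of n] by simp
    note sp = slow_zpoly[OF p] slow_zpoly[OF zpoly_Ldiff[OF p]] slow_zpoly[OF rs(1)] slow_zpoly[OF rs(2)]
    have t1: "(\<lambda>n. inner_g g (\<lambda>z. p z * of_real (gw (e n) z))) \<longlonglongrightarrow> inner_g g p"
    proof (rule inner_g_dominated_tendsto[OF g _ sp(1) sp(1)])
      show "slow (\<lambda>z. p z * of_real (gw (e k) z))" for k by (intro slow_mult sp sg)
      show "cmod (p z * of_real (gw (e k) z)) \<le> cmod (p z)" for k z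
        unfolding norm_mult using gle by (rule mult_left_le) simp
      show "(\<lambda>k. p z * of_real (gw (e k) z)) \<longlonglongrightarrow> p z" for z
        using tendsto_mult[OF tendsto_const w1, of "p z" z] by simp
    qed
    have t2: "(\<lambda>n. inner_g f (Ldiff (-\<theta>) (\<lambda>z. p z * of_real (gw (e n) z)))) \<longlonglongrightarrow> inner_g f (Ldiff (-\<theta>) p)"
    proof (rule inner_g_dominated_tendsto[OF f])
      let ?B = "\<lambda>z. of_real (cmod (Ldiff (-\<theta>) p z)) + of_real (cmod (r z)) + of_real (cmod (s z)) :: complex"
      show "slow (Ldiff (-\<theta>) p)" by (rule sp)
      show "slow ?B" by (intro slow_add slow_of_real_norm sp)
      show "slow (Ldiff (-\<theta>) (\<lambda>z. p z * of_real (gw (e k) z)))" for k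
        using e(1)[of k] by (intro slow_Ldiff C2s_zpoly_gw p) simp
      show "cmod (Ldiff (-\<theta>) (\<lambda>z. p z * of_real (gw (e k) z)) z) \<le> cmod (?B z)" for k z
      proof -
        have "cmod (Ldiff (-\<theta>) (\<lambda>z. p z * of_real (gw (e k) z)) z)
          \<le> cmod (Ldiff (-\<theta>) p z + of_real (e k) * r z + of_real ((e k)\<^sup>2) * s z)"
          unfolding rs(3) norm_mult using gle by (rule mult_left_le) simp
        also have "\<dots> \<le> cmod (Ldiff (-\<theta>) p z) + cmod (of_real (e k) * r z) + cmod (of_real ((e k)\<^sup>2) * s z)"
          by (rule order_trans[OF norm_triangle_ineq add_right_mono[OF norm_triangle_ineq]])
        also have "cmod (of_real (e k) * r z) \<le> cmod (r z)"
          unfolding norm_mult norm_of_real using e[of k] by (intro mult_left_le_one_le) auto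
        also have "cmod (of_real ((e k)\<^sup>2) * s z) \<le> cmod (s z)"
          unfolding norm_mult norm_of_real using e[of k] by (intro mult_left_le_one_le) (auto simp: power_le_one)
        also have "cmod (Ldiff (-\<theta>) p z) + cmod (r z) + cmod (s z) = cmod (?B z)"
          unfolding of_real_add[symmetric] norm_of_real by simp
        finally show ?thesis by simp
      qed
      show "(\<lambda>k. Ldiff (-\<theta>) (\<lambda>z. p z * of_real (gw (e k) z)) z) \<longlonglongrightarrow> Ldiff (-\<theta>) p z" for z
      proof -
        have "(\<lambda>k. (Ldiff (-\<theta>) p z + of_real (e k) * r z + of_real ((e k)\<^sup>2) * s z) * of_real (gw (e k) z))
            \<longlonglongrightarrow> (Ldiff (-\<theta>) p z + of_real 0 * r z + of_real (0\<^sup>2) * s z) * 1"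
          by (intro tendsto_intros e0 w1)
        then show ?thesis unfolding rs(3) by simp
      qed
    qed
    have eq: "inner_g g (\<lambda>z. p z * of_real (gw (e n) z)) = inner_g f (Ldiff (-\<theta>) (\<lambda>z. p z * of_real (gw (e n) z)))" for n
      by (rule A1rel_weak[OF A p e(1)])
    show ?thesis by (rule LIMSEQ_unique[OF t1[unfolded eq] t2])
  qed
  have "inner_g g (J m n) = - eig \<theta> m n * inner_g f (J m n)" for m n
  proof -
    have "Ldiff (-\<theta>) (J m n) = (\<lambda>z. - eig (-\<theta>) m n * J m n z)" by (rule ext) (rule Ldiff_J)
    then have "inner_g g (J m n) = inner_g f (\<lambda>z. - eig (-\<theta>) m n * J m n z)" using weak[OF zpoly_J, of m n] by (simp only:)
    then show ?thesis unfolding inner_g_cmult_right by (simp add: cnj_eig)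
  qed
  with f g show ?thesis by (simp add: Lrel_iff)
qed

text \<open>Constant approximating sequences show that the L^1 closure extends the operator; the
  converse is \<open>A1rel_L2_imp_Lrel\<close>.\<close>

lemma domL_eq_A1: "domL \<theta> = {f. Lp 2 f \<and> (\<exists>g. A1rel \<theta> f g \<and> Lp 2 g)}"
proof safe
  fix f assume f: "f \<in> domL \<theta>"
  then show "Lp 2 f" by (rule domL_L2)
  have "A1rel \<theta> f (Lop \<theta> f)" unfolding A1rel_def
    using f by (intro conjI exI[of _ "\<lambda>_. f"]) (auto simp: Lpnorm_def intro!: Lp_2_imp_1[simplified] domL_L2 Lop_L2)
  then show "\<exists>g. A1rel \<theta> f g \<and> Lp 2 g" using Lop_L2[OF f] by blast
next
  fix f g assume "Lp 2 f" "A1rel \<theta> f g" "Lp 2 g"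
  then show "f \<in> domL \<theta>" using A1rel_L2_imp_Lrel Lrel_domL by blast
qed

section \<open>Chain rule and symmetry of mixed partial derivatives\<close>

text \<open>\<open>nat \<Rightarrow> complex\<close> carries the product topology, so continuity on
  \<open>Cn n\<close> is met by coordinatewise limits.\<close>

lemma tendsto_fun_componentwise:
  fixes f :: "'a \<Rightarrow> 'i \<Rightarrow> 'b::topological_space"
  assumes "\<And>i. ((\<lambda>x. f x i) \<longlongrightarrow> l i) F"
  shows "(f \<longlongrightarrow> l) F"
proof -
  have "limitin (product_topology (\<lambda>_. euclidean) UNIV) f l F"
    unfolding limitin_componentwise using assms by simp
  then show ?thesis by (simp add: euclidean_product_topology)
qed

text \<open>The mean value theorem needs an ordered interval; splitting on the sign of
  \<open>b\<close> admits increments of either sign.\<close>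

lemma vector_mvt_bound:
  fixes f :: "real \<Rightarrow> complex"
  assumes d: "\<And>x. (f has_vector_derivative f' x) (at x)" and b: "\<And>x. \<bar>x\<bar> \<le> \<bar>b\<bar> \<Longrightarrow> cmod (f' x) \<le> B"
  shows "cmod (f b - f 0) \<le> B * \<bar>b\<bar>"
proof -
  have c: "continuous_on S f" for S
    using d by (meson continuous_at_imp_continuous_on has_vector_derivative_continuous)
  have dd: "(f has_derivative (\<lambda>h. h *\<^sub>R f' x)) (at x)" for x using d by (simp add: has_vector_derivative_def)
  consider "b > 0" | "b < 0" | "b = 0" by linarith
  then show ?thesis
  proof cases
    case 1
    from mvt_general[OF this c dd] obtain x where x: "x \<in> {0<..<b}" "cmod (f b - f 0) \<le> cmod ((b - 0) *\<^sub>R f' x)" by blast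
    then have "cmod (f b - f 0) \<le> b * cmod (f' x)" using 1 by simp
    also have "\<dots> \<le> b * B" using x 1 by (intro mult_left_mono b) auto
    finally show ?thesis using 1 by (simp add: mult.commute)
  next
    case 2
    from mvt_general[OF this c dd] obtain x where x: "x \<in> {b<..<0}" "cmod (f 0 - f b) \<le> cmod ((0 - b) *\<^sub>R f' x)" by blast
    then have "cmod (f b - f 0) \<le> - b * cmod (f' x)" using 2 by (simp add: norm_minus_commute)
    also have "\<dots> \<le> - b * B" using x 2 by (intro mult_left_mono b) auto
    finally show ?thesis using 2 by (simp add: mult.commute)
  qed simp
qed

text \<open>Two mean value estimates, first in \<open>t\<close> for \<open>f1\<close> and then in
  \<open>s\<close>, compare the second difference with \<open>h^2\<close> times the mixed
  derivative; only continuity of \<open>f12\<close> at the origin is used.\<close>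

lemma mixed_difference_tendsto:
  fixes f :: "real \<Rightarrow> real \<Rightarrow> complex"
  assumes d1: "\<And>s t. ((\<lambda>s. f s t) has_vector_derivative f1 s t) (at s)"
    and d12: "\<And>s t. ((\<lambda>t. f1 s t) has_vector_derivative f12 s t) (at t)"
    and c: "isCont (\<lambda>p. f12 (fst p) (snd p)) (0, 0)"
  shows "((\<lambda>h. (f h h - f h 0 - f 0 h + f 0 0) /\<^sub>R h\<^sup>2) \<longlongrightarrow> f12 0 0) (at_right 0)"
proof (rule tendstoI)
  fix e :: real assume e: "e > 0"
  define P where "P = f12 0 0"
  obtain d where d: "d > 0" "\<And>p. dist p (0, 0) < d \<Longrightarrow> dist (f12 (fst p) (snd p)) P < e / 2"
    using c e unfolding continuous_at_eps_delta P_def by (metis fst_conv snd_conv half_gt_zero)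
  have near: "cmod (f12 s t - P) \<le> e / 2" if "\<bar>s\<bar> < d / 2" "\<bar>t\<bar> < d / 2" for s t
  proof -
    have "dist (s, t) (0, 0) \<le> \<bar>s\<bar> + \<bar>t\<bar>"
      by (simp add: dist_Pair_Pair sqrt_sum_squares_le_sum_abs)
    then have "dist (s, t) (0, 0) < d" using that by linarith
    from d(2)[OF this] show ?thesis by (simp add: dist_norm)
  qed
  have est: "cmod ((f h h - f h 0 - f 0 h + f 0 0) - h\<^sup>2 *\<^sub>R P) \<le> e / 2 * h\<^sup>2" if h: "0 < h" "h < d / 2" for h
  proof -
    have 1: "cmod (f1 s h - f1 s 0 - h *\<^sub>R P) \<le> e / 2 * h" if s: "\<bar>s\<bar> \<le> \<bar>h\<bar>" for s
    proof -
      have "cmod ((f1 s h - h *\<^sub>R P) - (f1 s 0 - 0 *\<^sub>R P)) \<le> e / 2 * \<bar>h\<bar>"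
      proof (rule vector_mvt_bound)
        show "((\<lambda>t. f1 s t - t *\<^sub>R P) has_vector_derivative f12 s t - P) (at t)" for t
          by (auto intro!: derivative_eq_intros d12)
        show "cmod (f12 s t - P) \<le> e / 2" if "\<bar>t\<bar> \<le> \<bar>h\<bar>" for t
          using that s h by (intro near) auto
      qed
      then show ?thesis using h by (simp add: algebra_simps)
    qed
    \<comment> \<open>The function of \<open>s\<close> whose derivative was just bounded in
      \<open>1\<close>.\<close>
    have "cmod ((f h h - f h 0 - (h * h) *\<^sub>R P) - (f 0 h - f 0 0 - (0 * h) *\<^sub>R P)) \<le> (e / 2 * h) * \<bar>h\<bar>"
    proof (rule vector_mvt_bound)
      show "((\<lambda>s. f s h - f s 0 - (s * h) *\<^sub>R P) has_vector_derivative f1 s h - f1 s 0 - h *\<^sub>R P) (at s)" for s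
        by (auto intro!: derivative_eq_intros d1)
    qed (rule 1)
    then show ?thesis using h by (simp add: power2_eq_square algebra_simps)
  qed
  have "eventually (\<lambda>h. 0 < h \<and> h < d / 2) (at_right (0::real))"
    using d(1) by (auto simp: eventually_at_right_field intro!: exI[of _ "d/2"])
  then show "eventually (\<lambda>h. dist ((f h h - f h 0 - f 0 h + f 0 0) /\<^sub>R h\<^sup>2) (f12 0 0) < e) (at_right 0)"
  proof eventually_elim
    case (elim h)
    let ?D = "f h h - f h 0 - f 0 h + f 0 0"
    have "dist (?D /\<^sub>R h\<^sup>2) P = cmod ((?D - h\<^sup>2 *\<^sub>R P) /\<^sub>R h\<^sup>2)"
      using elim by (simp add: dist_norm scaleR_right_diff_distrib)
    also have "\<dots> = cmod (?D - h\<^sup>2 *\<^sub>R P) / h\<^sup>2"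
    proof -
      have "\<bar>inverse a\<bar> * X = X / a" if "a > 0" for a X :: real using that by (simp add: field_simps)
      then show ?thesis unfolding norm_scaleR using elim by simp
    qed
    also have "\<dots> \<le> e / 2" using est[of h] elim by (simp add: divide_le_eq)
    finally show ?case using e by (simp add: P_def)
  qed
qed

text \<open>The second difference is symmetric in the two variables, so both mixed derivatives are
  its limit.\<close>

lemma mixed_partials_eq:
  fixes f :: "real \<Rightarrow> real \<Rightarrow> complex"
  assumes d1: "\<And>s t. ((\<lambda>s. f s t) has_vector_derivative f1 s t) (at s)"
    and d12: "\<And>s t. ((\<lambda>t. f1 s t) has_vector_derivative f12 s t) (at t)"
    and d2: "\<And>s t. ((\<lambda>t. f s t) has_vector_derivative f2 s t) (at t)"
    and d21: "\<And>s t. ((\<lambda>s. f2 s t) has_vector_derivative f21 s t) (at s)"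
    and c: "isCont (\<lambda>p. f12 (fst p) (snd p)) (0, 0)" "isCont (\<lambda>p. f21 (fst p) (snd p)) (0, 0)"
  shows "f12 0 0 = f21 0 0"
proof (rule tendsto_unique)
  show "((\<lambda>h. (f h h - f h 0 - f 0 h + f 0 0) /\<^sub>R h\<^sup>2) \<longlongrightarrow> f12 0 0) (at_right 0)"
    by (rule mixed_difference_tendsto[OF d1 d12 c(1)])
  have "isCont (\<lambda>p. f21 (fst (snd p, fst p)) (snd (snd p, fst p))) (0::real, 0::real)"
    by (rule continuous_at_compose[of _ "\<lambda>p. (snd p, fst p)" "\<lambda>p. f21 (fst p) (snd p)", unfolded o_def])
      (use c(2) in \<open>auto intro!: continuous_intros\<close>)
  then have "((\<lambda>h. (f h h - f 0 h - f h 0 + f 0 0) /\<^sub>R h\<^sup>2) \<longlongrightarrow> f21 0 0) (at_right 0)"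
    using mixed_difference_tendsto[of "\<lambda>s t. f t s" "\<lambda>s t. f2 t s" "\<lambda>s t. f21 t s", OF d2 d21] by simp
  then show "((\<lambda>h. (f h h - f h 0 - f 0 h + f 0 0) /\<^sub>R h\<^sup>2) \<longlongrightarrow> f21 0 0) (at_right 0)"
    by (simp add: algebra_simps)
qed simp

section \<open>Partial derivatives in several complex variables\<close>

definition sh :: "(nat \<Rightarrow> complex) \<Rightarrow> nat \<Rightarrow> complex \<Rightarrow> real \<Rightarrow> nat \<Rightarrow> complex" where
  "sh w i c s = w(i := w i + of_real s * c)"

lemma sh_0 [simp]: "sh w i c 0 = w"
  by (simp add: sh_def)

lemma sh_sh: "sh (sh w i c s) i c t = sh w i c (s + t)"
  by (simp add: sh_def algebra_simps)

lemma sh_commute: "sh (sh w i c s) j d t = sh (sh w j d t) i c s"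
  by (auto simp: sh_def fun_eq_iff)

lemma sh_Cn: "w \<in> Cn n \<Longrightarrow> i < n \<Longrightarrow> sh w i c s \<in> Cn n"
  by (auto simp: sh_def Cn_def)

lemma pdiff_has_vector_derivative:
  "pdiff_ex F i c w \<Longrightarrow> ((\<lambda>t. F (sh w i c t)) has_vector_derivative pdiff F i c w) (at 0)"
  unfolding pdiff_ex_def pdiff_def sh_def by (simp add: vector_derivative_works[symmetric])

lemma pdiffI:
  assumes "((\<lambda>t. F (sh w i c t)) has_vector_derivative D) (at 0)"
  shows "pdiff_ex F i c w" "pdiff F i c w = D"
  using assms unfolding pdiff_ex_def pdiff_def sh_def
  by (auto intro: differentiableI_vector vector_derivative_at)

lemma pdiff_line:
  assumes "pdiff_ex F i c (sh w i c s)"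
  shows "((\<lambda>t. F (sh w i c t)) has_vector_derivative pdiff F i c (sh w i c s)) (at s)"
proof -
  have "((\<lambda>t. F (sh (sh w i c s) i c t)) has_vector_derivative pdiff F i c (sh w i c s)) (at (s - s))"
    using pdiff_has_vector_derivative[OF assms] by simp
  moreover have "((\<lambda>t. t - s) has_vector_derivative 1) (at s)"
    by (auto intro!: derivative_eq_intros)
  ultimately have "((\<lambda>t. F (sh (sh w i c s) i c t)) \<circ> (\<lambda>t. t - s) has_vector_derivative 1 *\<^sub>R pdiff F i c (sh w i c s)) (at s)"
    by (intro vector_diff_chain_at)
  then show ?thesis by (simp add: o_def sh_sh)
qed

text \<open>Existence and continuity of the axis derivatives only, each coordinate counting as two
  real directions. Under \<open>C2_up\<close> both \<open>F\<close> and its first derivatives have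
  this property.\<close>

definition C1n :: "nat \<Rightarrow> ((nat \<Rightarrow> complex) \<Rightarrow> complex) \<Rightarrow> bool" where
  "C1n n G \<longleftrightarrow> (\<forall>i<n. \<forall>c\<in>{1, \<i>}. (\<forall>w\<in>Cn n. pdiff_ex G i c w) \<and> continuous_on (Cn n) (pdiff G i c))"

text \<open>Two shifts reduce the claim to a function of two real parameters. Shifts commute even
  inside one coordinate, so \<open>i = j\<close> is included.\<close>

lemma pdiff_commute:
  assumes F: "C1n n F" and P: "C1n n (pdiff F i c)" "C1n n (pdiff F j d)"
    and ij: "i < n" "j < n" and cd: "c \<in> {1, \<i>}" "d \<in> {1, \<i>}" and w: "w \<in> Cn n"
  shows "pdiff (pdiff F i c) j d w = pdiff (pdiff F j d) i c w"
proof -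
  let ?w = "\<lambda>s t. sh (sh w i c s) j d t"
  have wC: "?w s t \<in> Cn n" for s t using w ij by (intro sh_Cn)
  have cont: "isCont (\<lambda>p. K (?w (fst p) (snd p))) (0, 0)" if K: "continuous_on (Cn n) K" for K :: "(nat \<Rightarrow> complex) \<Rightarrow> complex"
  proof -
    have "continuous_on UNIV (\<lambda>p. ?w (fst p) (snd p))"
    proof (rule continuous_on_coordinatewise_then_product)
      show "continuous_on UNIV (\<lambda>p. ?w (fst p) (snd p) k)" for k
        by (cases "k = j"; cases "k = i"; cases "i = j") (auto simp: sh_def intro!: continuous_intros)
    qed
    then have "continuous_on UNIV (\<lambda>p. K (?w (fst p) (snd p)))"
      by (rule continuous_on_compose2[OF K]) (auto intro: wC)
    then show ?thesis by (simp add: continuous_on_eq_continuous_at)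
  qed
  have "pdiff (pdiff F i c) j d (?w 0 0) = pdiff (pdiff F j d) i c (?w 0 0)"
  proof (rule mixed_partials_eq[where f="\<lambda>s t. F (?w s t)" and ?f1.0="\<lambda>s t. pdiff F i c (?w s t)" and ?f2.0="\<lambda>s t. pdiff F j d (?w s t)"
        and ?f12.0="\<lambda>s t. pdiff (pdiff F i c) j d (?w s t)" and ?f21.0="\<lambda>s t. pdiff (pdiff F j d) i c (?w s t)"])
    fix s t
    show "((\<lambda>s. F (?w s t)) has_vector_derivative pdiff F i c (?w s t)) (at s)"
      unfolding sh_commute[of w i c] by (rule pdiff_line) (use F ij cd w in \<open>auto simp: C1n_def sh_Cn\<close>)
    show "((\<lambda>t. pdiff F i c (?w s t)) has_vector_derivative pdiff (pdiff F i c) j d (?w s t)) (at t)"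
      by (rule pdiff_line) (use P ij cd w in \<open>auto simp: C1n_def sh_Cn\<close>)
    show "((\<lambda>t. F (?w s t)) has_vector_derivative pdiff F j d (?w s t)) (at t)"
      by (rule pdiff_line) (use F ij cd w in \<open>auto simp: C1n_def sh_Cn\<close>)
    show "((\<lambda>s. pdiff F j d (?w s t)) has_vector_derivative pdiff (pdiff F j d) i c (?w s t)) (at s)"
      unfolding sh_commute[of w i c] by (rule pdiff_line) (use P ij cd w in \<open>auto simp: C1n_def sh_Cn\<close>)
    have k: "continuous_on (Cn n) (pdiff (pdiff F i c) j d)" "continuous_on (Cn n) (pdiff (pdiff F j d) i c)"
      using P ij cd by (auto simp: C1n_def)
    show "isCont (\<lambda>p. pdiff (pdiff F i c) j d (?w (fst p) (snd p))) (0, 0)" by (rule cont[OF k(1)])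
    show "isCont (\<lambda>p. pdiff (pdiff F j d) i c (?w (fst p) (snd p))) (0, 0)" by (rule cont[OF k(2)])
  qed
  then show ?thesis by simp
qed

text \<open>The mean value bound measures the remainder against the shift \<open>s t\<close>;
  differentiability of \<open>s\<close> gives \<open>|s t| \<le> (|\<sigma>| + 1) |t|\<close> near
  0.\<close>

lemma has_vector_derivative_small:
  fixes R :: "real \<Rightarrow> complex"
  assumes s: "(s has_real_derivative \<sigma>) (at 0)" "s 0 = 0" and R0: "R 0 = 0"
    and small: "\<And>e. e > 0 \<Longrightarrow> eventually (\<lambda>t. cmod (R t) \<le> e * \<bar>s t\<bar>) (at 0)"
  shows "(R has_vector_derivative 0) (at 0)"
  unfolding has_vector_derivative_def has_derivative_at
proof (intro conjI)
  show "bounded_linear (\<lambda>x::real. x *\<^sub>R (0::complex))" by simp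
  have sq: "((\<lambda>t. s t / t) \<longlongrightarrow> \<sigma>) (at 0)" using s by (simp add: has_field_derivative_iff)
  have "((\<lambda>h. cmod (R h) / \<bar>h\<bar>) \<longlongrightarrow> 0) (at 0)"
  proof (rule tendstoI)
    fix e :: real assume e: "e > 0"
    define k where "k = \<bar>\<sigma>\<bar> + 1"
    have k: "k > 0" by (simp add: k_def)
    have "eventually (\<lambda>t. dist (s t / t) \<sigma> < 1) (at 0)" using sq by (rule tendstoD) simp
    moreover have "eventually (\<lambda>t. cmod (R t) \<le> e / (2 * k) * \<bar>s t\<bar>) (at 0)" using e k by (intro small) simp
    moreover have "eventually (\<lambda>t. t \<noteq> (0::real)) (at 0)" by (simp add: eventually_at_filter)
    ultimately show "eventually (\<lambda>h. dist (cmod (R h) / \<bar>h\<bar>) 0 < e) (at 0)"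
    proof eventually_elim
      case (elim t)
      have "\<bar>s t / t\<bar> \<le> k" using elim(1) by (simp add: dist_real_def k_def)
      then have "\<bar>s t\<bar> \<le> k * \<bar>t\<bar>" using elim(3) by (simp add: abs_divide divide_le_eq)
      then have "e / (2 * k) * \<bar>s t\<bar> \<le> e / (2 * k) * (k * \<bar>t\<bar>)" using e k by (intro mult_left_mono) auto
      also have "\<dots> = e / 2 * \<bar>t\<bar>" using k by simp
      finally have "cmod (R t) \<le> e / 2 * \<bar>t\<bar>" using elim(2) by linarith
      then have "cmod (R t) / \<bar>t\<bar> \<le> e / 2" using elim(3) by (simp add: divide_le_eq)
      then have "cmod (R t) / \<bar>t\<bar> < e" using e by linarith
      then show ?case by simp
    qed
  qed
  then show "((\<lambda>h. norm (R (0 + h) - R 0 - h *\<^sub>R 0) / norm h) \<longlongrightarrow> 0) (at 0)" by (simp add: R0)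
qed

text \<open>The base point moves together with the shift, so the derivative at one fixed point does
  not suffice; continuity of the partial derivative makes the estimate uniform in the base
  point.\<close>

lemma coordinate_increment:
  assumes G: "C1n n G" and i: "i < n" and c: "c \<in> {1, \<i>}"
    and w: "\<And>t. w t \<in> Cn n" "\<And>j. ((\<lambda>t. w t j) \<longlongrightarrow> w 0 j) (at 0)"
    and s: "(s has_real_derivative \<sigma>) (at 0)" "s 0 = 0"
  shows "((\<lambda>t. G (sh (w t) i c (s t)) - G (w t)) has_vector_derivative of_real \<sigma> * pdiff G i c (w 0)) (at 0)"
proof -
  define P0 where "P0 = pdiff G i c (w 0)"
  define R where "R t = G (sh (w t) i c (s t)) - G (w t) - s t *\<^sub>R P0" for t
  have Pc: "continuous_on (Cn n) (pdiff G i c)" using G i c by (auto simp: C1n_def)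
  \<comment> \<open>The shift ranges over \<open>nhds 0\<close>, including 0 itself, since the mean
    value bound runs over every intermediate shift.\<close>
  have "((\<lambda>p. pdiff G i c (sh (w (fst p)) i c (snd p))) \<longlongrightarrow> pdiff G i c (w 0)) (at 0 \<times>\<^sub>F nhds 0)"
  proof (rule continuous_on_tendsto_compose[OF Pc])
    show "((\<lambda>p. sh (w (fst p)) i c (snd p)) \<longlongrightarrow> w 0) (at 0 \<times>\<^sub>F nhds 0)"
    proof (rule tendsto_fun_componentwise)
      fix j
      have 1: "((\<lambda>p. w (fst p) j) \<longlongrightarrow> w 0 j) (at 0 \<times>\<^sub>F nhds (0::real))" for j
        by (rule filterlim_compose[OF w(2) filterlim_fst])
      have 2: "((\<lambda>p. snd p) \<longlongrightarrow> (0::real)) (at (0::real) \<times>\<^sub>F nhds 0)" by (rule filterlim_snd)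
      have "((\<lambda>p. w (fst p) i + of_real (snd p) * c) \<longlongrightarrow> w 0 i + of_real 0 * c) (at 0 \<times>\<^sub>F nhds 0)"
        by (intro tendsto_intros 1 2)
      then show "((\<lambda>p. sh (w (fst p)) i c (snd p) j) \<longlongrightarrow> w 0 j) (at 0 \<times>\<^sub>F nhds 0)"
        using 1[of j] by (cases "j = i") (auto simp: sh_def)
    qed
    show "w 0 \<in> Cn n" by (rule w)
    show "eventually (\<lambda>p. sh (w (fst p)) i c (snd p) \<in> Cn n) (at 0 \<times>\<^sub>F nhds 0)"
      by (intro always_eventually allI sh_Cn w i)
  qed
  then have lim: "((\<lambda>p. pdiff G i c (sh (w (fst p)) i c (snd p))) \<longlongrightarrow> P0) (at 0 \<times>\<^sub>F nhds 0)" by (simp add: P0_def)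
  have "(R has_vector_derivative 0) (at 0)"
  proof (rule has_vector_derivative_small[OF s])
    show "R 0 = 0" by (simp add: R_def s(2))
    fix e :: real assume e: "e > 0"
    have "eventually (\<lambda>p. dist (pdiff G i c (sh (w (fst p)) i c (snd p))) P0 < e) (at 0 \<times>\<^sub>F nhds 0)"
      using lim e by (rule tendstoD)
    then obtain A B where A: "eventually A (at (0::real))" and B: "eventually B (nhds (0::real))"
      and AB: "\<And>t r. A t \<Longrightarrow> B r \<Longrightarrow> dist (pdiff G i c (sh (w t) i c r)) P0 < e"
      unfolding eventually_prod_filter by auto
    obtain d where d: "d > 0" "\<And>r. \<bar>r\<bar> < d \<Longrightarrow> B r" using B unfolding eventually_nhds_metric by (auto simp: dist_real_def)
    have "isCont s 0" using s(1) by (rule DERIV_isCont)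
    then have "(s \<longlongrightarrow> 0) (at 0)" using s(2) by (simp add: isCont_def)
    then have "eventually (\<lambda>t. dist (s t) 0 < d) (at 0)" using d(1) by (rule tendstoD)
    with A show "eventually (\<lambda>t. cmod (R t) \<le> e * \<bar>s t\<bar>) (at 0)"
    proof eventually_elim
      case (elim t)
      have "cmod ((G (sh (w t) i c (s t)) - s t *\<^sub>R P0) - (G (sh (w t) i c 0) - 0 *\<^sub>R P0)) \<le> e * \<bar>s t\<bar>"
      proof (rule vector_mvt_bound)
        fix r
        have "pdiff_ex G i c (sh (w t) i c r)" using G i c sh_Cn[OF w(1) i] by (auto simp: C1n_def)
        from pdiff_line[OF this]
        show "((\<lambda>r. G (sh (w t) i c r) - r *\<^sub>R P0) has_vector_derivative pdiff G i c (sh (w t) i c r) - P0) (at r)"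
          by (auto intro!: derivative_eq_intros)
        assume "\<bar>r\<bar> \<le> \<bar>s t\<bar>"
        then have "B r" using elim(2) by (intro d) (simp add: dist_real_def)
        from AB[OF elim(1) this] show "cmod (pdiff G i c (sh (w t) i c r) - P0) \<le> e" by (simp add: dist_norm)
      qed
      then show ?case by (simp add: R_def algebra_simps)
    qed
  qed
  moreover have "((\<lambda>t. s t *\<^sub>R P0) has_vector_derivative \<sigma> *\<^sub>R P0) (at 0)"
    using has_vector_derivative_scaleR[OF s(1), of "\<lambda>_. P0" 0] by simp
  ultimately have "((\<lambda>t. R t + s t *\<^sub>R P0) has_vector_derivative 0 + \<sigma> *\<^sub>R P0) (at 0)"
    by (rule has_vector_derivative_add)
  then show ?thesis by (simp add: R_def P0_def scaleR_conv_of_real)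
qed

text \<open>Telescoping over real coordinates: components are moved one after another, first the
  real and then the imaginary part, and each step is a \<open>coordinate_increment\<close>.\<close>

lemma chain_rule_compv:
  assumes G: "C1n n G" and \<phi>: "\<And>i. i < n \<Longrightarrow> hasd c (\<phi> i) (\<phi>' i)"
  shows "hasd c (compv n G \<phi>) (\<lambda>z. \<Sum>i<n. compv n (Wz i G) \<phi> z * \<phi>' i z + compv n (Wzb i G) \<phi> z * cnj (\<phi>' i z))"
  unfolding hasd_def
proof
  fix z
  \<comment> \<open>The first \<open>m\<close> components are already moved and the others still
    frozen, so \<open>W 0\<close> is constant in \<open>t\<close> and \<open>W n\<close> is the full
    composition.\<close>
  define W where "W m t = (\<lambda>i. if i < m then \<phi> i (z + of_real t * c) else if i < n then \<phi> i z else 0)" for m t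
  have W0: "W m 0 = (\<lambda>i. if i < n then \<phi> i z else 0)" if "m \<le> n" for m using that by (auto simp: W_def)
  have WC: "W m t \<in> Cn n" if "m \<le> n" for m t using that by (auto simp: W_def Cn_def)
  have lim: "((\<lambda>t. \<phi> j (z + of_real t * c)) \<longlongrightarrow> \<phi> j z) (at 0)" if "j < n" for j
  proof -
    have "isCont (\<lambda>t. \<phi> j (z + of_real t * c)) (0::real)"
      using \<phi>[OF that] unfolding hasd_def by (meson has_vector_derivative_continuous)
    then show ?thesis by (simp add: isCont_def)
  qed
  have Wlim: "((\<lambda>t. W m t j) \<longlongrightarrow> W m 0 j) (at 0)" if "m \<le> n" for m j
    using lim that by (auto simp: W_def)
  have "((\<lambda>t. G (W m t)) has_vector_derivative
    (\<Sum>i<m. compv n (Wz i G) \<phi> z * \<phi>' i z + compv n (Wzb i G) \<phi> z * cnj (\<phi>' i z))) (at 0)" if "m \<le> n" for m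
    using that
  proof (induct m)
    case 0
    then show ?case by (simp add: W_def)
  next
    case (Suc m)
    then have m: "m < n" "m \<le> n" by auto
    define a where "a t = Re (\<phi> m (z + of_real t * c) - \<phi> m z)" for t
    define b where "b t = Im (\<phi> m (z + of_real t * c) - \<phi> m z)" for t
    have der: "((\<lambda>t. \<phi> m (z + of_real t * c)) has_vector_derivative \<phi>' m z) (at 0)"
      using \<phi>[OF m(1)] by (simp add: hasd_def)
    have "((\<lambda>t. \<phi> m (z + of_real t * c) - \<phi> m z) has_vector_derivative \<phi>' m z) (at 0)"
      using has_vector_derivative_diff[OF der has_vector_derivative_const] by simp
    then have da: "(a has_real_derivative Re (\<phi>' m z)) (at 0)" and db: "(b has_real_derivative Im (\<phi>' m z)) (at 0)"
      unfolding a_def b_def has_real_derivative_iff_has_vector_derivative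
      by (rule bounded_linear.has_vector_derivative[OF bounded_linear_Re],
          rule bounded_linear.has_vector_derivative[OF bounded_linear_Im])
    have ab0: "a 0 = 0" "b 0 = 0" by (auto simp: a_def b_def)
    \<comment> \<open>The intermediate point at which only the real part of component
      \<open>m\<close> has been moved.\<close>
    define V where "V t = sh (W m t) m 1 (a t)" for t
    have V0: "V 0 = W m 0" by (simp add: V_def ab0)
    have VC: "V t \<in> Cn n" for t unfolding V_def by (intro sh_Cn WC m)
    have alim: "(a \<longlongrightarrow> 0) (at 0)" using DERIV_isCont[OF da] by (simp add: isCont_def ab0)
    have Vlim: "((\<lambda>t. V t j) \<longlongrightarrow> V 0 j) (at 0)" for j
    proof -
      have "((\<lambda>t. W m t m + of_real (a t) * 1) \<longlongrightarrow> W m 0 m + of_real 0 * 1) (at 0)"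
        by (intro tendsto_intros Wlim alim m)
      then show ?thesis using Wlim[OF m(2), of j] unfolding V0 by (cases "j = m") (auto simp: V_def sh_def)
    qed
    have "W (Suc m) t = sh (V t) m \<i> (b t)" for t
      by (auto simp: W_def V_def sh_def a_def b_def fun_eq_iff complex_eq_iff less_Suc_eq m)
    then have split: "G (W (Suc m) t) = G (W m t) + (G (sh (W m t) m 1 (a t)) - G (W m t)) + (G (sh (V t) m \<i> (b t)) - G (V t))" for t
      by (simp add: V_def)
    define w0 where "w0 = (\<lambda>i. if i < n then \<phi> i z else 0)"
    have "((\<lambda>t. G (W (Suc m) t)) has_vector_derivative
        (\<Sum>i<m. compv n (Wz i G) \<phi> z * \<phi>' i z + compv n (Wzb i G) \<phi> z * cnj (\<phi>' i z))
        + of_real (Re (\<phi>' m z)) * pdiff G m 1 (W m 0) + of_real (Im (\<phi>' m z)) * pdiff G m \<i> (V 0)) (at 0)"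
      unfolding split
      by (intro has_vector_derivative_add Suc(1) m coordinate_increment[OF G] WC Wlim VC Vlim da db ab0) auto
    moreover have "of_real (Re (\<phi>' m z)) * pdiff G m 1 (W m 0) + of_real (Im (\<phi>' m z)) * pdiff G m \<i> (V 0)
       = compv n (Wz m G) \<phi> z * \<phi>' m z + compv n (Wzb m G) \<phi> z * cnj (\<phi>' m z)"
    proof -
      have gen: "of_real (Re x) * p + of_real (Im x) * q = (p - \<i> * q) / 2 * x + (p + \<i> * q) / 2 * cnj x" for x p q :: complex
        by (simp add: complex_eq_iff field_simps)
      show ?thesis unfolding V0 W0[OF m(2)] compv_def Wz_def Wzb_def by (rule gen)
    qed
    ultimately show ?case by (simp add: add.assoc)
  qed
  from this[of n] show "((\<lambda>t. compv n G \<phi> (z + of_real t * c)) has_vector_derivative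
     (\<Sum>i<n. compv n (Wz i G) \<phi> z * \<phi>' i z + compv n (Wzb i G) \<phi> z * cnj (\<phi>' i z))) (at 0)"
    by (simp add: compv_def W_def cong: if_cong)
qed

lemma slow_compv:
  assumes K: "slowly_increasing n K" and \<phi>: "\<And>i. i < n \<Longrightarrow> slow (\<phi> i)"
  shows "slow (compv n K \<phi>)"
proof -
  let ?w = "\<lambda>z i. if i < n then \<phi> i z else 0"
  have wC: "?w z \<in> Cn n" for z by (auto simp: Cn_def)
  obtain C k where Ck: "\<And>w. w \<in> Cn n \<Longrightarrow> cmod (K w) \<le> C * (1 + (\<Sum>i<n. (cmod (w i))\<^sup>2)) powr (real k / 2)"
    and Kc: "continuous_on (Cn n) K"
    using K unfolding slowly_increasing_def by blast
  have "slow (\<lambda>z. 1 + (\<Sum>i<n. \<phi> i z * cnj (\<phi> i z)))"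
    by (intro slow_add slow_const slow_sum slow_mult slow_cnj \<phi>) auto
  then obtain A l where A: "A > 0" "\<And>z. cmod (1 + (\<Sum>i<n. \<phi> i z * cnj (\<phi> i z))) \<le> A * (1 + cmod z) ^ l"
    using slowE by blast
  have N: "1 + (\<Sum>i<n. (cmod (\<phi> i z))\<^sup>2) \<le> max 1 A * (1 + cmod z) ^ l" for z
  proof -
    have "1 + (\<Sum>i<n. \<phi> i z * cnj (\<phi> i z)) = of_real (1 + (\<Sum>i<n. (cmod (\<phi> i z))\<^sup>2))"
      unfolding of_real_add of_real_sum complex_norm_square of_real_1 ..
    then have "1 + (\<Sum>i<n. (cmod (\<phi> i z))\<^sup>2) \<le> A * (1 + cmod z) ^ l"
      using A(2)[of z] by (simp only: norm_of_real)
    also have "\<dots> \<le> max 1 A * (1 + cmod z) ^ l" by (intro mult_right_mono) auto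
    finally show ?thesis .
  qed
  show ?thesis
  proof (rule slowI[where C="\<bar>C\<bar> * max 1 A ^ k" and k="l * k"])
    have "continuous_on UNIV ?w"
    proof (rule continuous_on_coordinatewise_then_product)
      show "continuous_on UNIV (\<lambda>z. ?w z i)" for i
        using \<phi>[of i] by (cases "i < n") (auto simp: slow_def)
    qed
    then show "continuous_on UNIV (compv n K \<phi>)" unfolding compv_def
      by (rule continuous_on_compose2[OF Kc]) (use wC in auto)
    fix z
    have X1: "1 \<le> 1 + (\<Sum>i<n. (cmod (\<phi> i z))\<^sup>2)" by (simp add: sum_nonneg)
    have "cmod (compv n K \<phi> z) \<le> C * (1 + (\<Sum>i<n. (cmod (?w z i))\<^sup>2)) powr (real k / 2)"
      unfolding compv_def by (rule Ck[OF wC])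
    also have "\<dots> \<le> \<bar>C\<bar> * (1 + (\<Sum>i<n. (cmod (?w z i))\<^sup>2)) powr (real k / 2)" by (intro mult_right_mono) auto
    also have "\<dots> = \<bar>C\<bar> * (1 + (\<Sum>i<n. (cmod (\<phi> i z))\<^sup>2)) powr (real k / 2)" by simp
    \<comment> \<open>The base is at least 1, so doubling the exponent turns the half-integer power
      into a natural one.\<close>
    also have "\<dots> \<le> \<bar>C\<bar> * (1 + (\<Sum>i<n. (cmod (\<phi> i z))\<^sup>2)) powr (real k)"
      using X1 by (intro mult_left_mono powr_mono) auto
    also have "\<dots> = \<bar>C\<bar> * (1 + (\<Sum>i<n. (cmod (\<phi> i z))\<^sup>2)) ^ k"
      using X1 by (subst powr_realpow) auto
    also have "\<dots> \<le> \<bar>C\<bar> * (max 1 A * (1 + cmod z) ^ l) ^ k"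
      using X1 by (intro mult_left_mono power_mono N) auto
    finally show "cmod (compv n K \<phi> z) \<le> \<bar>C\<bar> * max 1 A ^ k * (1 + cmod z) ^ (l * k)"
      by (simp add: power_mult_distrib power_mult mult.assoc)
  qed
qed

text \<open>The parameter \<open>-\<i>\<close> gives \<open>Wz\<close> and \<open>\<i>\<close> gives
  \<open>Wzb\<close>, so one computation covers all kinds of second Wirtinger derivatives.\<close>

definition Wg :: "complex \<Rightarrow> nat \<Rightarrow> ((nat \<Rightarrow> complex) \<Rightarrow> complex) \<Rightarrow> (nat \<Rightarrow> complex) \<Rightarrow> complex" where
  "Wg e i F w = (pdiff F i 1 w + e * pdiff F i \<i> w) / 2"

lemma Wz_eq_Wg: "Wz i F = Wg (-\<i>) i F" and Wzb_eq_Wg: "Wzb i F = Wg \<i> i F"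
  by (auto simp: Wz_def Wzb_def Wg_def fun_eq_iff)

lemma C2_up_D:
  assumes "C2_up n F"
  shows "C1n n F" "\<And>i c. i < n \<Longrightarrow> c \<in> {1, \<i>} \<Longrightarrow> C1n n (pdiff F i c)"
    "slowly_increasing n F" "\<And>i c. i < n \<Longrightarrow> c \<in> {1, \<i>} \<Longrightarrow> slowly_increasing n (pdiff F i c)"
    "\<And>i c j d. i < n \<Longrightarrow> c \<in> {1, \<i>} \<Longrightarrow> j < n \<Longrightarrow> d \<in> {1, \<i>} \<Longrightarrow> slowly_increasing n (pdiff (pdiff F i c) j d)"
proof -
  have si: "slowly_increasing n G \<Longrightarrow> continuous_on (Cn n) G" for G by (simp add: slowly_increasing_def)
  show 1: "slowly_increasing n (pdiff F i c)" if "i < n" "c \<in> {1, \<i>}" for i c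
    using assms that by (auto simp: C2_up_def)
  show 2: "slowly_increasing n (pdiff (pdiff F i c) j d)" if "i < n" "c \<in> {1, \<i>}" "j < n" "d \<in> {1, \<i>}" for i c j d
    using assms that by (auto simp: C2_up_def)
  show "slowly_increasing n F" using assms by (simp add: C2_up_def)
  have "pdiff_ex F i c w" if "i < n" "c \<in> {1, \<i>}" "w \<in> Cn n" for i c w
    using assms that by (auto simp: C2_up_def)
  with 1 show "C1n n F" by (auto simp: C1n_def intro!: si)
  have "pdiff_ex (pdiff F i c) j d w" if "i < n" "c \<in> {1, \<i>}" "j < n" "d \<in> {1, \<i>}" "w \<in> Cn n" for i c j d w
    using assms that by (auto simp: C2_up_def)
  with 2 show "C1n n (pdiff F i c)" if "i < n" "c \<in> {1, \<i>}" for i c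
    unfolding C1n_def using that by (intro allI impI ballI conjI si)
qed

lemma pdiff_Wg:
  assumes F: "C2_up n F" and ij: "i < n" "j < n" and d: "d \<in> {1, \<i>}" and w: "w \<in> Cn n"
  shows "pdiff_ex (Wg e i F) j d w"
    and "pdiff (Wg e i F) j d w = (pdiff (pdiff F i 1) j d w + e * pdiff (pdiff F i \<i>) j d w) / 2"
proof -
  have "pdiff_ex (pdiff F i c) j d w" if "c \<in> {1, \<i>}" for c
    using C2_up_D(2)[OF F ij(1) that] ij d w by (auto simp: C1n_def)
  then have d1: "((\<lambda>t. pdiff F i 1 (sh w j d t)) has_vector_derivative pdiff (pdiff F i 1) j d w) (at 0)"
    and d2: "((\<lambda>t. pdiff F i \<i> (sh w j d t)) has_vector_derivative pdiff (pdiff F i \<i>) j d w) (at 0)"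
    by (auto intro: pdiff_has_vector_derivative)
  have "((\<lambda>t. (1/2) * (pdiff F i 1 (sh w j d t) + e * pdiff F i \<i> (sh w j d t))) has_vector_derivative
     (1/2) * (pdiff (pdiff F i 1) j d w + e * pdiff (pdiff F i \<i>) j d w)) (at 0)"
    by (intro has_vector_derivative_mult_right has_vector_derivative_add d1 d2)
  then have "((\<lambda>t. Wg e i F (sh w j d t)) has_vector_derivative (pdiff (pdiff F i 1) j d w + e * pdiff (pdiff F i \<i>) j d w) / 2) (at 0)"
    by (simp add: Wg_def)
  from pdiffI[OF this] show "pdiff_ex (Wg e i F) j d w"
    "pdiff (Wg e i F) j d w = (pdiff (pdiff F i 1) j d w + e * pdiff (pdiff F i \<i>) j d w) / 2" by auto
qed

lemma C1n_Wg:
  assumes F: "C2_up n F" and i: "i < n"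
  shows "C1n n (Wg e i F)"
  unfolding C1n_def
proof (intro allI impI ballI conjI)
  fix j d assume j: "j < n" and d: "d \<in> {1, \<i>}"
  show "pdiff_ex (Wg e i F) j d w" if "w \<in> Cn n" for w by (rule pdiff_Wg(1)[OF F i j d that])
  have "continuous_on (Cn n) (\<lambda>w. (pdiff (pdiff F i 1) j d w + e * pdiff (pdiff F i \<i>) j d w) / 2)"
    using C2_up_D(5)[OF F i _ j d] by (intro continuous_intros) (auto simp: slowly_increasing_def)
  then show "continuous_on (Cn n) (pdiff (Wg e i F) j d)"
    by (rule continuous_on_eq) (simp add: pdiff_Wg(2)[OF F i j d])
qed

lemma Wg_Wg:
  assumes F: "C2_up n F" and ij: "i < n" "j < n" and w: "w \<in> Cn n"
  shows "Wg e' j (Wg e i F) w = ((pdiff (pdiff F i 1) j 1 w + e * pdiff (pdiff F i \<i>) j 1 w)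
      + e' * (pdiff (pdiff F i 1) j \<i> w + e * pdiff (pdiff F i \<i>) j \<i> w)) / 4"
proof -
  have "\<i> \<in> {1, \<i>}" by simp
  note e = pdiff_Wg(2)[OF F ij this w, of e] pdiff_Wg(2)[OF F ij insertI1 w, of e]
  show ?thesis unfolding Wg_def[of e' j] e by (simp add: field_simps)
qed

lemma Wg_commute:
  assumes F: "C2_up n F" and ij: "i < n" "j < n" and w: "w \<in> Cn n"
  shows "Wg e' j (Wg e i F) w = Wg e i (Wg e' j F) w"
proof -
  have "pdiff (pdiff F i c) j d w = pdiff (pdiff F j d) i c w" if "c \<in> {1, \<i>}" "d \<in> {1, \<i>}" for c d
    using that F ij w by (intro pdiff_commute[of n]) (auto intro: C2_up_D)
  then show ?thesis unfolding Wg_Wg[OF F ij w] Wg_Wg[OF F ij(2,1) w] by (simp add: algebra_simps)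
qed

text \<open>Composition pads with zeros and thus evaluates only inside \<open>Cn n\<close>, where
  the derivative identities are available.\<close>

lemma compv_cong: "(\<And>w. w \<in> Cn n \<Longrightarrow> K w = K' w) \<Longrightarrow> compv n K \<phi> = compv n K' \<phi>"
  unfolding compv_def by (rule ext) (auto simp: Cn_def)

lemma slow_compv_Wg:
  assumes F: "C2_up n F" and i: "i < n" and \<phi>: "\<And>i. i < n \<Longrightarrow> slow (\<phi> i)"
  shows "slow (compv n (Wg e i F) \<phi>)"
proof -
  have "slow (\<lambda>z. (1/2) * (compv n (pdiff F i 1) \<phi> z + e * compv n (pdiff F i \<i>) \<phi> z))"
    by (intro slow_cmult slow_add slow_compv C2_up_D[OF F] i \<phi>) auto
  then show ?thesis by (simp add: compv_def Wg_def)
qed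

lemma slow_compv_Wg_Wg:
  assumes F: "C2_up n F" and ij: "i < n" "j < n" and \<phi>: "\<And>i. i < n \<Longrightarrow> slow (\<phi> i)"
  shows "slow (compv n (Wg e' j (Wg e i F)) \<phi>)"
proof -
  have "slow (\<lambda>z. (1/4) * ((compv n (pdiff (pdiff F i 1) j 1) \<phi> z + e * compv n (pdiff (pdiff F i \<i>) j 1) \<phi> z)
      + e' * (compv n (pdiff (pdiff F i 1) j \<i>) \<phi> z + e * compv n (pdiff (pdiff F i \<i>) j \<i>) \<phi> z)))"
    by (intro slow_cmult slow_add slow_compv C2_up_D[OF F] ij \<phi>) auto
  moreover have "compv n (Wg e' j (Wg e i F)) \<phi> = compv n (\<lambda>w. ((pdiff (pdiff F i 1) j 1 w + e * pdiff (pdiff F i \<i>) j 1 w)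
      + e' * (pdiff (pdiff F i 1) j \<i> w + e * pdiff (pdiff F i \<i>) j \<i> w)) / 4) \<phi>"
    by (rule compv_cong) (rule Wg_Wg[OF F ij])
  ultimately show ?thesis by (simp add: compv_def)
qed

section \<open>Carre du champ and the diffusion property\<close>

lemma dd_zpoly_mult:
  "zpoly f \<Longrightarrow> zpoly g \<Longrightarrow> dd c (\<lambda>z. f z * g z) = (\<lambda>z. dd c f z * g z + f z * dd c g z)"
  by (intro hasd_imp_dd hasd_mult zpoly_hasd)

lemma dd_zpoly_cnj: "zpoly f \<Longrightarrow> dd c (\<lambda>z. cnj (f z)) = (\<lambda>z. cnj (dd c f z))"
  by (intro hasd_imp_dd hasd_cnj zpoly_hasd)

lemma dd_zpoly_add: "zpoly f \<Longrightarrow> zpoly g \<Longrightarrow> dd c (\<lambda>z. f z + g z) = (\<lambda>z. dd c f z + dd c g z)"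
  by (intro hasd_imp_dd hasd_add zpoly_hasd)

lemma dd_zpoly_cmult: "zpoly f \<Longrightarrow> dd c (\<lambda>z. a * f z) = (\<lambda>z. a * dd c f z)"
  by (intro hasd_imp_dd hasd_cmult zpoly_hasd)

text \<open>First-order terms are derivations, so the cross term comes from the Laplacian alone;
  this is where the factor \<open>2 * cos \<theta>\<close> divided out in \<open>Gam\<close>
  originates.\<close>

lemma Ldiff_mult:
  assumes f: "zpoly f" and g: "zpoly g"
  shows "Ldiff \<theta> (\<lambda>z. f z * g z) z = f z * Ldiff \<theta> g z + g z * Ldiff \<theta> f z
    + 2 * of_real (cos \<theta>) * (dd 1 f z * dd 1 g z + dd \<i> f z * dd \<i> g z)"
proof -
  have "dd c (dd c (\<lambda>z. f z * g z)) = (\<lambda>z. (dd c (dd c f) z * g z + dd c f z * dd c g z) + (dd c f z * dd c g z + f z * dd c (dd c g) z))" for c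
    using f g by (simp add: dd_zpoly_mult dd_zpoly_add zpoly_mult zpoly_hasd)
  then show ?thesis unfolding Ldiff_def by (simp add: dd_zpoly_mult[OF f g]) (simp add: algebra_simps)
qed

text \<open>The pointwise Hermitian product of real gradients; non-negativity on the diagonal is
  then evident.\<close>

definition Gd :: "(complex \<Rightarrow> complex) \<Rightarrow> (complex \<Rightarrow> complex) \<Rightarrow> complex \<Rightarrow> complex" where
  "Gd \<phi> \<psi> z = dd 1 \<phi> z * cnj (dd 1 \<psi> z) + dd \<i> \<phi> z * cnj (dd \<i> \<psi> z)"

lemma zpoly_Gd: "zpoly \<phi> \<Longrightarrow> zpoly \<psi> \<Longrightarrow> zpoly (Gd \<phi> \<psi>)"
  unfolding Gd_def by (intro zpoly_add zpoly_mult zpoly_cnj zpoly_hasd)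

lemma Gam_ae_eq:
  assumes \<phi>: "zpoly \<phi>" and \<psi>: "zpoly \<psi>" and c: "cos \<theta> \<noteq> 0"
  shows "ae_eq (Gam \<theta> \<phi> \<psi>) (Gd \<phi> \<psi>)"
proof -
  have "ae_eq (Lop \<theta> (\<lambda>w. \<phi> w * cnj (\<psi> w))) (Ldiff \<theta> (\<lambda>w. \<phi> w * cnj (\<psi> w)))"
    by (intro Lop_C2s C2s_zpoly zpoly_mult zpoly_cnj \<phi> \<psi>)
  moreover have "ae_eq (Lop \<theta> (\<lambda>w. cnj (\<psi> w))) (Ldiff \<theta> (\<lambda>w. cnj (\<psi> w)))"
    by (intro Lop_C2s C2s_zpoly zpoly_cnj \<psi>)
  moreover have "ae_eq (Lop \<theta> \<phi>) (Ldiff \<theta> \<phi>)" by (intro Lop_C2s C2s_zpoly \<phi>)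
  ultimately show ?thesis unfolding ae_eq_def
  proof eventually_elim
    case (elim z)
    have "Gam \<theta> \<phi> \<psi> z = of_real (1 / (2 * cos \<theta>)) * (2 * of_real (cos \<theta>) * Gd \<phi> \<psi> z)"
      unfolding Gam_def elim Ldiff_mult[OF \<phi> zpoly_cnj[OF \<psi>]] Gd_def dd_zpoly_cnj[OF \<psi>] by (simp add: algebra_simps)
    then show ?case using c by simp
  qed
qed

text \<open>\<open>Gam\<close> is built from chosen representatives, so measurability comes from
  their being in L^2; it is needed to transfer integrability along a.e. equality.\<close>

lemma Gam_measurable:
  assumes "zpoly \<phi>" "zpoly \<psi>"
  shows "Gam \<theta> \<phi> \<psi> \<in> borel_measurable borel"
proof -
  have "C2s (\<lambda>w. \<phi> w * cnj (\<psi> w))" "C2s (\<lambda>w. cnj (\<psi> w))" "C2s \<phi>"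
    using assms by (auto intro!: C2s_zpoly zpoly_mult zpoly_cnj)
  note [measurable] = this[THEN domL_C2s, THEN Lop_L2, THEN Lp_measurable]
    slow_measurable[OF slow_zpoly[OF assms(1)]] slow_measurable[OF slow_zpoly[OF assms(2)]]
  show ?thesis unfolding Gam_def by measurable
qed

lemma Gam_L2: "zpoly \<phi> \<Longrightarrow> zpoly \<psi> \<Longrightarrow> cos \<theta> \<noteq> 0 \<Longrightarrow> Lp 2 (Gam \<theta> \<phi> \<psi>)"
  by (rule Lp_cong_AE[OF slow_Lp[OF slow_zpoly[OF zpoly_Gd]] ae_eq_sym[OF Gam_ae_eq] Gam_measurable])

text \<open>Applying the chain rule twice splits each second derivative into a part quadratic in the
  gradients and a part linear in the second derivatives of the components. The former assembles into
  \<open>Gd\<close>, the latter joins the first-order terms to form \<open>Ldiff\<close> of the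
  components.\<close>

lemma diffusion:
  assumes F: "C2_up n F" and \<phi>: "\<And>i. i < n \<Longrightarrow> zpoly (\<phi> i)"
  shows "C2s (compv n F \<phi>)"
    and "Ldiff \<theta> (compv n F \<phi>) z = of_real (cos \<theta>) *
        (\<Sum>i<n. \<Sum>j<n. Gd (\<phi> i) (\<lambda>w. cnj (\<phi> j w)) z * compv n (Wz i (Wz j F)) \<phi> z
           + Gd (\<lambda>w. cnj (\<phi> i w)) (\<phi> j) z * compv n (Wzb i (Wzb j F)) \<phi> z
           + 2 * Gd (\<phi> i) (\<phi> j) z * compv n (Wz i (Wzb j F)) \<phi> z)
        + (\<Sum>i<n. Ldiff \<theta> (\<phi> i) z * compv n (Wz i F) \<phi> z
           + Ldiff \<theta> (\<lambda>w. cnj (\<phi> i w)) z * compv n (Wzb i F) \<phi> z)" (is "_ = ?R")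
proof -
  define a where "a c i = dd c (\<phi> i)" for c i
  define a2 where "a2 c i = dd c (dd c (\<phi> i))" for c i
  define Z where "Z i = compv n (Wz i F) \<phi>" for i
  define B where "B i = compv n (Wzb i F) \<phi>" for i
  define ZZ where "ZZ i j = compv n (Wz i (Wz j F)) \<phi>" for i j
  define BB where "BB i j = compv n (Wzb i (Wzb j F)) \<phi>" for i j
  define ZB where "ZB i j = compv n (Wz i (Wzb j F)) \<phi>" for i j
  \<comment> \<open>Symmetry of mixed derivatives merges the two mixed Wirtinger terms, whence the
    factor 2 in front of them.\<close>
  have swap: "compv n (Wzb j (Wz i F)) \<phi> = ZB i j" if "i < n" "j < n" for i j
    unfolding ZB_def Wz_eq_Wg Wzb_eq_Wg by (rule compv_cong) (rule Wg_commute[OF F that])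
  have sp: "slow (\<phi> i)" if "i < n" for i by (rule slow_zpoly[OF \<phi>[OF that]])
  have da: "hasd c (\<phi> i) (a c i)" and da2: "hasd c (a c i) (a2 c i)" and sa: "slow (a c i)" and sa2: "slow (a2 c i)"
    if "i < n" for c i
    unfolding a_def a2_def using \<phi>[OF that] by (auto intro: zpoly_hasd slow_zpoly)
  have sZ: "slow (Z i)" and sB: "slow (B i)" if "i < n" for i
    unfolding Z_def B_def Wz_eq_Wg Wzb_eq_Wg using that by (auto intro!: slow_compv_Wg F sp)
  have sZZ: "slow (ZZ i j)" and sBB: "slow (BB i j)" and sZB: "slow (ZB i j)" if "i < n" "j < n" for i j
    unfolding ZZ_def BB_def ZB_def Wz_eq_Wg Wzb_eq_Wg using that by (auto intro!: slow_compv_Wg_Wg F sp)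
  have dZ: "hasd c (Z i) (\<lambda>z. \<Sum>j<n. ZZ j i z * a c j z + ZB i j z * cnj (a c j z))" if i: "i < n" for c i
  proof -
    have "hasd c (Z i) (\<lambda>z. \<Sum>j<n. compv n (Wz j (Wz i F)) \<phi> z * a c j z + compv n (Wzb j (Wz i F)) \<phi> z * cnj (a c j z))"
      unfolding Z_def by (intro chain_rule_compv da) (simp_all add: Wz_eq_Wg C1n_Wg[OF F i])
    then show ?thesis by (rule hasd_cong) (auto simp: ZZ_def swap[OF i] intro!: sum.cong)
  qed
  have dB: "hasd c (B i) (\<lambda>z. \<Sum>j<n. ZB j i z * a c j z + BB j i z * cnj (a c j z))" if i: "i < n" for c i
    unfolding B_def ZB_def BB_def by (intro chain_rule_compv da) (simp_all add: Wzb_eq_Wg C1n_Wg[OF F i])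
  define u where "u = compv n F \<phi>"
  define u1 where "u1 c z = (\<Sum>i<n. Z i z * a c i z + B i z * cnj (a c i z))" for c z
  define u2 where "u2 c z = (\<Sum>i<n. ((\<Sum>j<n. ZZ j i z * a c j z + ZB i j z * cnj (a c j z)) * a c i z + Z i z * a2 c i z)
      + ((\<Sum>j<n. ZB j i z * a c j z + BB j i z * cnj (a c j z)) * cnj (a c i z) + B i z * cnj (a2 c i z)))" for c z
  have d1: "hasd c u (u1 c)" for c
    unfolding u_def u1_def Z_def B_def by (intro chain_rule_compv da C2_up_D[OF F])
  have d2: "hasd c (u1 c) (u2 c)" for c
    unfolding u1_def u2_def by (intro hasd_sum hasd_add hasd_mult hasd_cnj da2 dZ dB) auto
  have s1: "slow (u1 c)" for c
    unfolding u1_def by (intro slow_sum slow_add slow_mult slow_cnj sZ sB sa) auto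
  have s2: "slow (u2 c)" for c
    unfolding u2_def by (intro slow_sum slow_add slow_mult slow_cnj sZ sB sa sa2 sZZ sBB sZB) auto
  have su: "slow u" unfolding u_def by (intro slow_compv C2_up_D[OF F] sp)
  have ddu: "dd c u = u1 c" "dd c (u1 c) = u2 c" for c by (rule hasd_imp_dd[OF d1], rule hasd_imp_dd[OF d2])
  show "C2s (compv n F \<phi>)"
    unfolding u_def[symmetric] C2s_def using su d1 d2 s1 s2 by (simp add: ddu)
  \<comment> \<open>\<open>T\<close> is the linear part and \<open>Q\<close> the quadratic part of
    the second derivative in direction \<open>c\<close>.\<close>
  define T where "T c = (\<Sum>i<n. Z i z * a2 c i z + B i z * cnj (a2 c i z))" for c
  define Q where "Q c = (\<Sum>i<n. \<Sum>j<n. a c i z * a c j z * ZZ i j z + cnj (a c i z) * cnj (a c j z) * BB i j z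
      + 2 * (a c i z * cnj (a c j z)) * ZB i j z)" for c
  have u2: "u2 c z = Q c + T c" for c
  proof -
    have "u2 c z = (\<Sum>i<n. \<Sum>j<n. ZZ j i z * a c j z * a c i z) + (\<Sum>i<n. \<Sum>j<n. ZB i j z * cnj (a c j z) * a c i z)
       + (\<Sum>i<n. \<Sum>j<n. ZB j i z * a c j z * cnj (a c i z)) + (\<Sum>i<n. \<Sum>j<n. BB j i z * cnj (a c j z) * cnj (a c i z)) + T c"
      unfolding u2_def T_def by (simp add: sum.distrib sum_distrib_right distrib_right)
    also have "(\<Sum>i<n. \<Sum>j<n. ZZ j i z * a c j z * a c i z) = (\<Sum>i<n. \<Sum>j<n. ZZ i j z * a c i z * a c j z)"
      by (rule sum.swap)
    also have "(\<Sum>i<n. \<Sum>j<n. ZB j i z * a c j z * cnj (a c i z)) = (\<Sum>i<n. \<Sum>j<n. ZB i j z * a c i z * cnj (a c j z))"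
      by (rule sum.swap)
    also have "(\<Sum>i<n. \<Sum>j<n. BB j i z * cnj (a c j z) * cnj (a c i z)) = (\<Sum>i<n. \<Sum>j<n. BB i j z * cnj (a c i z) * cnj (a c j z))"
      by (rule sum.swap)
    also have "(\<Sum>i<n. \<Sum>j<n. ZZ i j z * a c i z * a c j z) + (\<Sum>i<n. \<Sum>j<n. ZB i j z * cnj (a c j z) * a c i z)
       + (\<Sum>i<n. \<Sum>j<n. ZB i j z * a c i z * cnj (a c j z)) + (\<Sum>i<n. \<Sum>j<n. BB i j z * cnj (a c i z) * cnj (a c j z)) = Q c"
      unfolding Q_def sum.distrib[symmetric] by (intro sum.cong refl) (simp add: algebra_simps)
    finally show ?thesis .
  qed
  have cnj_a: "dd c (\<lambda>w. cnj (\<phi> i w)) = (\<lambda>w. cnj (a c i w))" "dd c (dd c (\<lambda>w. cnj (\<phi> i w))) = (\<lambda>w. cnj (a2 c i w))" if "i < n" for c i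
    unfolding a_def a2_def using \<phi>[OF that] by (simp_all add: dd_zpoly_cnj zpoly_hasd)
  have dd_a: "dd c (a c i) = a2 c i" "i < n \<Longrightarrow> dd c (\<lambda>w. cnj (a c i w)) = (\<lambda>w. cnj (a2 c i w))" for c i
    using cnj_a[of i c] by (simp_all add: a_def a2_def)
  have Q: "(\<Sum>i<n. \<Sum>j<n. Gd (\<phi> i) (\<lambda>w. cnj (\<phi> j w)) z * ZZ i j z + Gd (\<lambda>w. cnj (\<phi> i w)) (\<phi> j) z * BB i j z
      + 2 * Gd (\<phi> i) (\<phi> j) z * ZB i j z) = Q 1 + Q \<i>"
    unfolding Q_def sum.distrib[symmetric]
    by (intro sum.cong refl) (simp add: Gd_def cnj_a a_def[symmetric] algebra_simps)
  let ?x = "complex_of_real (Re z)" and ?y = "complex_of_real (Im z)"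
  let ?C = "complex_of_real (cos \<theta>)" and ?S = "complex_of_real (sin \<theta>)"
  have T: "(\<Sum>i<n. Ldiff \<theta> (\<phi> i) z * Z i z + Ldiff \<theta> (\<lambda>w. cnj (\<phi> i w)) z * B i z)
     = ?C * (T 1 + T \<i> - ?x * u1 1 z - ?y * u1 \<i> z) + ?S * (?y * u1 1 z - ?x * u1 \<i> z)"
    unfolding T_def u1_def sum_distrib_left sum.distrib[symmetric] sum_subtractf[symmetric]
    by (intro sum.cong refl) (simp add: Ldiff_def cnj_a dd_a a_def[symmetric] algebra_simps)
  have "Ldiff \<theta> u z = ?C * (Q 1 + Q \<i>) + (?C * (T 1 + T \<i> - ?x * u1 1 z - ?y * u1 \<i> z) + ?S * (?y * u1 1 z - ?x * u1 \<i> z))"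
    unfolding Ldiff_def ddu u2 by (simp add: algebra_simps)
  then show "Ldiff \<theta> (compv n F \<phi>) z = ?R"
    unfolding u_def[symmetric] Z_def[symmetric] B_def[symmetric] ZZ_def[symmetric] BB_def[symmetric] ZB_def[symmetric]
    by (simp only: Q T)
qed

text \<open>The pointwise formula for \<open>Ldiff\<close> transfers because only finitely many a.e.
  identities, indexed by \<open>i, j < n\<close>, are combined.\<close>

lemma diffusion_Lop:
  assumes F: "C2_up n F" and \<phi>: "\<And>i. i < n \<Longrightarrow> zpoly (\<phi> i)" and c: "cos \<theta> \<noteq> 0"
  shows "ae_eq (Lop \<theta> (compv n F \<phi>))
    (\<lambda>z. complex_of_real (cos \<theta>) *
        (\<Sum>i<n. \<Sum>j<n. Gam \<theta> (\<phi> i) (\<lambda>w. cnj (\<phi> j w)) z * compv n (Wz i (Wz j F)) \<phi> z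
           + Gam \<theta> (\<lambda>w. cnj (\<phi> i w)) (\<phi> j) z * compv n (Wzb i (Wzb j F)) \<phi> z
           + 2 * Gam \<theta> (\<phi> i) (\<phi> j) z * compv n (Wz i (Wzb j F)) \<phi> z)
        + (\<Sum>i<n. Lop \<theta> (\<phi> i) z * compv n (Wz i F) \<phi> z
           + Lop \<theta> (\<lambda>w. cnj (\<phi> i w)) z * compv n (Wzb i F) \<phi> z))"
proof -
  have "AE z in gauss. Lop \<theta> (compv n F \<phi>) z = Ldiff \<theta> (compv n F \<phi>) z"
    using Lop_C2s[OF diffusion(1)[OF F \<phi>]] by (simp add: ae_eq_def)
  moreover have "AE z in gauss. \<forall>i\<in>{..<n}. Lop \<theta> (\<phi> i) z = Ldiff \<theta> (\<phi> i) z \<and>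
      Lop \<theta> (\<lambda>w. cnj (\<phi> i w)) z = Ldiff \<theta> (\<lambda>w. cnj (\<phi> i w)) z"
    using \<phi> by (intro eventually_ball_finite ballI eventually_conj)
      (auto intro!: Lop_C2s[unfolded ae_eq_def] C2s_zpoly zpoly_cnj)
  moreover have "AE z in gauss. \<forall>i\<in>{..<n}. \<forall>j\<in>{..<n}. Gam \<theta> (\<phi> i) (\<lambda>w. cnj (\<phi> j w)) z = Gd (\<phi> i) (\<lambda>w. cnj (\<phi> j w)) z \<and>
      Gam \<theta> (\<lambda>w. cnj (\<phi> i w)) (\<phi> j) z = Gd (\<lambda>w. cnj (\<phi> i w)) (\<phi> j) z \<and>
      Gam \<theta> (\<phi> i) (\<phi> j) z = Gd (\<phi> i) (\<phi> j) z"
    using \<phi> c by (intro eventually_ball_finite ballI eventually_conj)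
      (auto intro!: Gam_ae_eq[unfolded ae_eq_def] zpoly_cnj)
  ultimately show ?thesis unfolding ae_eq_def
  proof eventually_elim
    case (elim z)
    then show ?case by (simp add: diffusion(2)[OF F \<phi>])
  qed
qed

text \<open>\<open>A1rel\<close> is the closure of the graph in L^1; its single-valuedness makes it
  an operator, so the last two conjuncts together express the statement about the L^1
  extension.\<close>

theorem theorem4p4:
  fixes \<theta> :: real
  assumes "- (pi / 2) < \<theta>" and "\<theta> < pi / 2"
  shows
    "lin_op (domL \<theta>) (Lop \<theta>) \<and> densely_defined (domL \<theta>) \<and> closed_op (domL \<theta>) (Lop \<theta>)
   \<and> normal_op (domL \<theta>) (Lop \<theta>)
   \<and> ((\<lambda>_. 1) \<in> domL \<theta> \<and> ae_eq (Lop \<theta> (\<lambda>_. 1)) (\<lambda>_. 0))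
   \<and> (\<exists>D. (\<lambda>_. 0) \<in> D \<and> (\<forall>\<phi>\<in>D. \<forall>\<psi>\<in>D. \<forall>a b. (\<lambda>z. a * \<phi> z + b * \<psi> z) \<in> D)
        \<and> D \<subseteq> {\<phi>. \<phi> \<in> domL \<theta> \<and> Lp 4 \<phi> \<and> Lp 4 (Lop \<theta> \<phi>)
                 \<and> (\<lambda>z. complex_of_real ((cmod (\<phi> z))\<^sup>2)) \<in> domL \<theta>}
        \<and> (\<forall>\<phi>\<in>domL \<theta>. \<forall>e>0. \<exists>\<psi>\<in>D.
             Lpnorm 2 (\<lambda>z. \<phi> z - \<psi> z) + Lpnorm 2 (\<lambda>z. Lop \<theta> \<phi> z - Lop \<theta> \<psi> z) < e)
        \<and> (\<forall>\<phi>\<in>D. \<forall>\<psi>\<in>D. (\<lambda>z. \<phi> z * cnj (\<psi> z)) \<in> domL \<theta> \<and> (\<lambda>z. cnj (\<psi> z)) \<in> domL \<theta>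
             \<and> Lp 2 (Gam \<theta> \<phi> \<psi>))
        \<and> (\<forall>\<phi>1\<in>D. \<forall>\<phi>2\<in>D. \<forall>\<psi>\<in>D. \<forall>a b.
             ae_eq (Gam \<theta> (\<lambda>z. a * \<phi>1 z + b * \<phi>2 z) \<psi>) (\<lambda>z. a * Gam \<theta> \<phi>1 \<psi> z + b * Gam \<theta> \<phi>2 \<psi> z)
           \<and> ae_eq (Gam \<theta> \<psi> (\<lambda>z. a * \<phi>1 z + b * \<phi>2 z)) (\<lambda>z. cnj a * Gam \<theta> \<psi> \<phi>1 z + cnj b * Gam \<theta> \<psi> \<phi>2 z))
        \<and> (\<forall>\<phi>\<in>D. AE z in gauss. Im (Gam \<theta> \<phi> \<phi> z) = 0 \<and> Re (Gam \<theta> \<phi> \<phi> z) \<ge> 0)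
        \<and> (\<forall>n (\<phi>s :: nat \<Rightarrow> complex \<Rightarrow> complex) F. (\<forall>i<n. \<phi>s i \<in> D) \<longrightarrow> C2_up n F \<longrightarrow>
             compv n F \<phi>s \<in> domL \<theta> \<and>
             ae_eq (Lop \<theta> (compv n F \<phi>s))
               (\<lambda>z. complex_of_real (cos \<theta>) *
                  (\<Sum>i<n. \<Sum>j<n.
                     Gam \<theta> (\<phi>s i) (\<lambda>w. cnj (\<phi>s j w)) z * compv n (Wz i (Wz j F)) \<phi>s z
                   + Gam \<theta> (\<lambda>w. cnj (\<phi>s i w)) (\<phi>s j) z * compv n (Wzb i (Wzb j F)) \<phi>s z
                   + 2 * Gam \<theta> (\<phi>s i) (\<phi>s j) z * compv n (Wz i (Wzb j F)) \<phi>s z)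
                 + (\<Sum>i<n. Lop \<theta> (\<phi>s i) z * compv n (Wz i F) \<phi>s z
                   + Lop \<theta> (\<lambda>w. cnj (\<phi>s i w)) z * compv n (Wzb i F) \<phi>s z))))
   \<and> (\<forall>f g1 g2. A1rel \<theta> f g1 \<longrightarrow> A1rel \<theta> f g2 \<longrightarrow> ae_eq g1 g2)
   \<and> domL \<theta> = {f. Lp 2 f \<and> (\<exists>g. A1rel \<theta> f g \<and> Lp 2 g)}"
proof -
  \<comment> \<open>The interval for \<open>\<theta>\<close> is used here: the cosine is positive on
    it.\<close>
  have c: "cos \<theta> \<noteq> 0" using cos_gt_zero_pi[of \<theta>] assms by simp
  have lin: "zpoly (\<lambda>z. a * f z + b * g z)" if "zpoly f" "zpoly g" for a b f g
    by (intro zpoly_add zpoly_cmult that)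
  have dd_lin: "dd d (\<lambda>z. a * f z + b * g z) = (\<lambda>z. a * dd d f z + b * dd d g z)" if "zpoly f" "zpoly g" for a b f g d
    using that by (simp add: dd_zpoly_add dd_zpoly_cmult zpoly_cmult)
  have Lop4: "Lp 4 (Lop \<theta> f)" if "zpoly f" for f
    using that by (intro Lp_cong_AE[OF slow_Lp[OF slow_Ldiff[OF C2s_zpoly]] ae_eq_sym[OF Lop_C2s]]
        Lp_measurable[OF Lop_L2[OF domL_C2s]] C2s_zpoly)
  have sq: "(\<lambda>z. complex_of_real ((cmod (f z))\<^sup>2)) \<in> domL \<theta>" if "zpoly f" for f
    unfolding complex_norm_square by (intro domL_C2s C2s_zpoly zpoly_mult zpoly_cnj that)
  have Gam_left: "ae_eq (Gam \<theta> (\<lambda>z. a * f z + b * g z) h) (\<lambda>z. a * Gam \<theta> f h z + b * Gam \<theta> g h z)"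
    if p: "zpoly f" "zpoly g" "zpoly h" for a b f g h
    using Gam_ae_eq[OF lin[OF p(1,2)] p(3) c, of a b] Gam_ae_eq[OF p(1,3) c] Gam_ae_eq[OF p(2,3) c]
    unfolding ae_eq_def by eventually_elim (simp add: Gd_def dd_lin[OF p(1,2)] algebra_simps)
  have Gam_right: "ae_eq (Gam \<theta> h (\<lambda>z. a * f z + b * g z)) (\<lambda>z. cnj a * Gam \<theta> h f z + cnj b * Gam \<theta> h g z)"
    if p: "zpoly f" "zpoly g" "zpoly h" for a b f g h
    using Gam_ae_eq[OF p(3) lin[OF p(1,2)] c, of a b] Gam_ae_eq[OF p(3,1) c] Gam_ae_eq[OF p(3,2) c]
    unfolding ae_eq_def by eventually_elim (simp add: Gd_def dd_lin[OF p(1,2)] algebra_simps)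
  have Gam_pos: "AE z in gauss. Im (Gam \<theta> f f z) = 0 \<and> Re (Gam \<theta> f f z) \<ge> 0" if p: "zpoly f" for f
    using Gam_ae_eq[OF p p c] unfolding ae_eq_def by eventually_elim (simp add: Gd_def)
  show ?thesis
  \<comment> \<open>The polynomials are the core: an algebra closed under conjugation and under
    \<open>Ldiff\<close>, containing every finite Hermite sum.\<close>
  proof (intro conjI exI[of _ "Collect zpoly"])
    show "\<forall>\<phi>\<in>domL \<theta>. \<forall>e>0. \<exists>\<psi>\<in>Collect zpoly.
             Lpnorm 2 (\<lambda>z. \<phi> z - \<psi> z) + Lpnorm 2 (\<lambda>z. Lop \<theta> \<phi> z - Lop \<theta> \<psi> z) < e"
      using graph_core by simp
    show "\<forall>\<phi>\<in>Collect zpoly. \<forall>\<psi>\<in>Collect zpoly. (\<lambda>z. \<phi> z * cnj (\<psi> z)) \<in> domL \<theta> \<and> (\<lambda>z. cnj (\<psi> z)) \<in> domL \<theta>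
             \<and> Lp 2 (Gam \<theta> \<phi> \<psi>)"
      using c by (auto intro!: domL_C2s C2s_zpoly zpoly_mult zpoly_cnj Gam_L2)
    show "Collect zpoly \<subseteq> {\<phi>. \<phi> \<in> domL \<theta> \<and> Lp 4 \<phi> \<and> Lp 4 (Lop \<theta> \<phi>)
                 \<and> (\<lambda>z. complex_of_real ((cmod (\<phi> z))\<^sup>2)) \<in> domL \<theta>}"
    proof (intro subsetI CollectI conjI)
      fix f assume "f \<in> Collect zpoly"
      then have p: "zpoly f" by simp
      show "f \<in> domL \<theta>" "Lp 4 f" by (intro domL_C2s C2s_zpoly slow_Lp slow_zpoly p)+
      show "Lp 4 (Lop \<theta> f)" "(\<lambda>z. complex_of_real ((cmod (f z))\<^sup>2)) \<in> domL \<theta>" by (rule Lop4[OF p], rule sq[OF p])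
    qed
  qed (use lin Gam_left Gam_right Gam_pos lin_op_L densely_defined_L closed_op_L normal_op_L one_L
      domL_C2s[OF diffusion(1)] diffusion_Lop[OF _ _ c] A1rel_unique domL_eq_A1 zpoly_const in simp_all)
qed

end
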